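(* Let $f$ be a radial eigencubic in $\mathbb{R}^n$ and suppose a normal form of $f$ with associated decomposition $\mathbb{R}^n=\mathrm{span}(e_n)\oplus V_1\oplus V_2\oplus V_3$ is given. Then the dimensions $n_i=\dim V_i$, $i=1,2,3$, do not depend on the particular choice of the normal form of $f$, and can be recovered from $$n_1=1+\frac{|x|^2\,\operatorname{tr}\big(\mathrm{Hess}(f)^3\big)}{3L(f)}$$ (an identity of rational functions of $x\in\mathbb{R}^n$; in particular the ratio on the right is a constant), together with $n_2=\tfrac12(n-3n_1+1)$ and $n_3=2n_1+n_2-2$, where $\mathrm{Hess}(f)$ is the Hessian matrix of $f$.
   Context: For a polynomial $f$ on $\mathbb{R}^n$ put $L(f)=|\nabla f|^2\Delta f-\sum_{i,j=1}^n f_{x_i}f_{x_j}f_{x_ix_j}$. A radial eigencubic in $\mathbb{R}^n$ is a homogeneous polynomial $f\not\equiv 0$ of degree 3 such that $L(f)=\lambda |x|^2 f$ for some constant $\lambda\in\mathbb{R}$, where it is assumed that $\lambda\neq 0$. Every radial eigencubic admits a normal form: an orthogonal decomposition $\mathbb{R}^n=\mathrm{span}(e_n)\oplus V_1\oplus V_2\oplus V_3$ ($e_n$ a unit vector, the $V_i$ possibly zero) such that, writing $x=x_ne_n+\xi+\eta+\zeta$ with $\xi\in V_1,\eta\in V_2,\zeta\in V_3$, after multiplication of $f$ by a nonzero constant, $$f=x_n^3-\tfrac32x_n(2|\xi|^2+|\eta|^2-|\zeta|^2)+\psi_{111}+\psi_{102}+\psi_{012}+\psi_{030},$$ where $\psi_{ijk}$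 is a polynomial homogeneous of degree $i$ in $\xi$, $j$ in $\eta$ and $k$ in $\zeta$. *)

theory Defs
  imports "HOL-Analysis.Analysis"
begin

definition partial :: "'n \<Rightarrow> (real ^ 'n \<Rightarrow> real) \<Rightarrow> real ^ 'n \<Rightarrow> real" where
  "partial i f x = frechet_derivative f (at x) (axis i 1)"

definition gradient :: "(real ^ 'n \<Rightarrow> real) \<Rightarrow> real ^ 'n \<Rightarrow> real ^ 'n" where
  "gradient f x = (\<chi> i. partial i f x)"

definition hessian :: "(real ^ 'n \<Rightarrow> real) \<Rightarrow> real ^ 'n \<Rightarrow> real ^ 'n ^ 'n" where
  "hessian f x = (\<chi> i j. partial j (partial i f) x)"

definition laplacian :: "(real ^ 'n \<Rightarrow> real) \<Rightarrow> real ^ 'n \<Rightarrow> real" where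
  "laplacian f x = (\<Sum>i\<in>UNIV. partial i (partial i f) x)"

definition L_op :: "(real ^ 'n \<Rightarrow> real) \<Rightarrow> real ^ 'n \<Rightarrow> real" where
  "L_op f x = (norm (gradient f x))\<^sup>2 * laplacian f x
     - (\<Sum>i\<in>UNIV. \<Sum>j\<in>UNIV. partial i f x * partial j f x * partial j (partial i f) x)"

definition homogeneous_poly :: "nat \<Rightarrow> ('a::real_normed_vector \<Rightarrow> real) \<Rightarrow> bool" where
  "homogeneous_poly d f \<longleftrightarrow>
     real_polynomial_function f \<and> (\<forall>t x. f (t *\<^sub>R x) = t ^ d * f x)"

definition radial_eigencubic :: "(real ^ 'n \<Rightarrow> real) \<Rightarrow> bool" where
  "radial_eigencubic f \<longleftrightarrow>
     homogeneous_poly 3 f \<and> (\<exists>x. f x \<noteq> 0) \<and>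
     (\<exists>l. l \<noteq> 0 \<and> (\<forall>x. L_op f x = l * (norm x)\<^sup>2 * f x))"

(* The summands may be zero, and e is an arbitrary unit vector (not necessarily a coordinate vector). *)
definition orth_decomposition ::
  "'a::euclidean_space \<Rightarrow> 'a set \<Rightarrow> 'a set \<Rightarrow> 'a set \<Rightarrow> bool" where
  "orth_decomposition e V1 V2 V3 \<longleftrightarrow>
     norm e = 1 \<and> subspace V1 \<and> subspace V2 \<and> subspace V3 \<and>
     (\<forall>\<xi>\<in>V1. orthogonal e \<xi>) \<and> (\<forall>\<eta>\<in>V2. orthogonal e \<eta>) \<and> (\<forall>\<zeta>\<in>V3. orthogonal e \<zeta>) \<and>
     (\<forall>\<xi>\<in>V1. \<forall>\<eta>\<in>V2. orthogonal \<xi> \<eta>) \<and>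
     (\<forall>\<xi>\<in>V1. \<forall>\<zeta>\<in>V3. orthogonal \<xi> \<zeta>) \<and>
     (\<forall>\<eta>\<in>V2. \<forall>\<zeta>\<in>V3. orthogonal \<eta> \<zeta>) \<and>
     (\<forall>x. \<exists>t. \<exists>\<xi>\<in>V1. \<exists>\<eta>\<in>V2. \<exists>\<zeta>\<in>V3. x = t *\<^sub>R e + \<xi> + \<eta> + \<zeta>)"

(* A polynomial on V1 x V2 x V3 is represented by a polynomial on the whole triple product;
   only its values on V1 x V2 x V3 matter. Since 0 ^ 0 = 1, degree 0 in a variable
   means that the value does not depend on that variable. *)
definition trihomogeneous_poly ::
  "nat \<Rightarrow> nat \<Rightarrow> nat \<Rightarrow> 'a::euclidean_space set \<Rightarrow> 'a set \<Rightarrow> 'a set \<Rightarrow> ('a \<times> 'a \<times> 'a \<Rightarrow> real) \<Rightarrow> bool" where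
  "trihomogeneous_poly i j k V1 V2 V3 \<psi> \<longleftrightarrow>
     real_polynomial_function \<psi> \<and>
     (\<forall>a b c. \<forall>\<xi>\<in>V1. \<forall>\<eta>\<in>V2. \<forall>\<zeta>\<in>V3.
        \<psi> (a *\<^sub>R \<xi>, b *\<^sub>R \<eta>, c *\<^sub>R \<zeta>) = a ^ i * b ^ j * c ^ k * \<psi> (\<xi>, \<eta>, \<zeta>))"

definition normal_form ::
  "('a::euclidean_space \<Rightarrow> real) \<Rightarrow> 'a \<Rightarrow> 'a set \<Rightarrow> 'a set \<Rightarrow> 'a set \<Rightarrow> bool" where
  "normal_form f e V1 V2 V3 \<longleftrightarrow>
     orth_decomposition e V1 V2 V3 \<and>
     (\<exists>c \<psi>111 \<psi>102 \<psi>012 \<psi>030.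
        c \<noteq> 0 \<and>
        trihomogeneous_poly 1 1 1 V1 V2 V3 \<psi>111 \<and>
        trihomogeneous_poly 1 0 2 V1 V2 V3 \<psi>102 \<and>
        trihomogeneous_poly 0 1 2 V1 V2 V3 \<psi>012 \<and>
        trihomogeneous_poly 0 3 0 V1 V2 V3 \<psi>030 \<and>
        (\<forall>t. \<forall>\<xi>\<in>V1. \<forall>\<eta>\<in>V2. \<forall>\<zeta>\<in>V3.
           c * f (t *\<^sub>R e + \<xi> + \<eta> + \<zeta>) =
             t ^ 3 - 3 / 2 * t * (2 * (norm \<xi>)\<^sup>2 + (norm \<eta>)\<^sup>2 - (norm \<zeta>)\<^sup>2)
             + \<psi>111 (\<xi>, \<eta>, \<zeta>) + \<psi>102 (\<xi>, \<eta>, \<zeta>)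
             + \<psi>012 (\<xi>, \<eta>, \<zeta>) + \<psi>030 (\<xi>, \<eta>, \<zeta>)))"

end

(*
  Up to a constant factor, f(x) = <x x, x> / 2 for a commutative product on R^n such that <x y, z>
  is symmetric in x, y, z, and then Hess f = 3 L_x, where L_x is the multiplication by x. In the
  normal form e e = 2 e, and L_e acts as -2, -1, 1 on V1, V2, V3.

  Expanding L(f) = lambda |x|^2 f at x = e + s y gives tr L_x = 0, hence n3 = 2 n1 + n2 - 2, and
  then <(x x)(x x), x> = 4 |x|^2 <x x, x>. The Laplacian of this quintic identity is
    tr(L_x^3) + tr(L_x L_{x x}) = (n + 6) <x x, x>,
  so the formula for n1, which says tr(L_x^3) = -3 (n1 - 1) <x x, x>, amounts to
    tr(L_x L_{x x}) = (6 n1 + 2 n2 + 2) <x x, x>.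
  The components of the quintic identity along e, V1, V2, V3 show that V1 acts on V2 by multiples
  of isometries into V3, and they determine the form tr(L_x L_y) on each pair of summands: it is
  (6 n1 + 2 n2 + 2) <x, y> plus terms linear in w, the V2-part of the sum of b b over an
  orthonormal basis of V2. The contribution of w cancels at y = x x.
*)
theory Submission
  imports Defs
begin

section \<open>Orthonormal bases and orthogonal decompositions\<close>

text \<open>The obstacle is \<open>w\<close>, which measures how far the cubic carried by
  \<open>V2\<close> is from being harmonic. It cannot be assumed zero: if \<open>dim V2 = 1\<close>,
  then \<open>norm_mul_22\<close> already forces \<open>w \<noteq> 0\<close>. No classification of
  the possible cubics on \<open>V2\<close> is used; four properties of \<open>w\<close> suffice. It
  can be exchanged with any element of \<open>V2\<close> in
  \<open>(x \<odot> w) \<bullet> (y \<odot> z)\<close>; its square within \<open>V2\<close> is a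
  multiple of \<open>w\<close>; on \<open>V3\<close>, multiplication by \<open>w\<close>
  anticommutes with multiplication by elements of \<open>V1\<close>; and the cubic form
  \<open>(z \<odot> z) \<bullet> P1 (w \<odot> z)\<close> vanishes on \<open>V3\<close>. The first
  two are contractions of identities read off the component of the quintic identity along
  \<open>e\<close>. The other two start from its component along \<open>V2\<close>, studied on those
  \<open>z\<close> in \<open>V3\<close> for which \<open>x \<odot> z\<close> has no part in
  \<open>V2\<close>; the same kernel shows that the trace form vanishes between \<open>V1\<close>
  and \<open>V2\<close>. The constant \<open>6 n1 + 2 n2 + 2\<close> is tr(L_e^2) = 4 + 4 n1 + n2 +
  n3 after elimination of n3. The assumption that lambda is nonzero excludes the case n = 1.\<close>

definition onb :: "'a::euclidean_space set \<Rightarrow> 'a set \<Rightarrow> bool" where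
  "onb V B \<longleftrightarrow> B \<subseteq> V \<and> finite B \<and> card B = dim V \<and>
     (\<forall>b\<in>B. \<forall>c\<in>B. b \<bullet> c = (if b = c then 1 else 0)) \<and>
     (\<forall>x\<in>V. (\<Sum>b\<in>B. (x \<bullet> b) *\<^sub>R b) = x)"

lemma onb_exists:
  fixes V :: "'a::euclidean_space set"
  assumes "subspace V"
  shows "\<exists>B. onb V B"
proof -
  obtain B where B: "B \<subseteq> V" "pairwise orthogonal B" "\<And>x. x \<in> B \<Longrightarrow> norm x = 1"
    "independent B" "card B = dim V" "span B = V"
    by (rule orthonormal_basis_subspace[OF assms]) (rule that; assumption)
  have fin: "finite B" using B(4) independent_imp_finite by blast
  have ip: "b \<bullet> c = (if b = c then 1 else 0)" if "b \<in> B" "c \<in> B" for b c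
    using that B(2,3) unfolding pairwise_def orthogonal_def by (auto simp: norm_eq_1)
  have "(\<Sum>b\<in>B. (x \<bullet> b) *\<^sub>R b) = x" if "x \<in> V" for x
  proof -
    have "x \<in> range (\<lambda>u. \<Sum>b\<in>B. u b *\<^sub>R b)"
      using that unfolding B(6)[symmetric] span_finite[OF fin] .
    then obtain u where x: "x = (\<Sum>b\<in>B. u b *\<^sub>R b)" by (rule rangeE)
    have "x \<bullet> c = u c" if "c \<in> B" for c
    proof -
      have "x \<bullet> c = (\<Sum>b\<in>B. if b = c then u b else 0)"
        unfolding x inner_sum_left using that by (intro sum.cong) (simp_all add: ip)
      also have "\<dots> = u c" using that fin by (simp add: sum.delta)
      finally show ?thesis .
    qed
    then have "(\<Sum>b\<in>B. (x \<bullet> b) *\<^sub>R b) = (\<Sum>b\<in>B. u b *\<^sub>R b)" by (intro sum.cong) auto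
    then show ?thesis using x by metis
  qed
  then have "onb V B" unfolding onb_def using B(1,5) fin ip by (intro conjI ballI) simp_all
  then show ?thesis ..
qed

definition Bas :: "'a::euclidean_space set \<Rightarrow> 'a set" where
  "Bas V = (SOME B. onb V B)"

definition proj :: "'a::euclidean_space set \<Rightarrow> 'a \<Rightarrow> 'a" where
  "proj V x = (\<Sum>b\<in>Bas V. (x \<bullet> b) *\<^sub>R b)"

lemma onb_Bas: "subspace V \<Longrightarrow> onb V (Bas V)"
  unfolding Bas_def using onb_exists by (rule someI_ex)

lemma
  assumes "subspace V"
  shows card_Bas: "card (Bas V) = dim V"
    and Bas_in: "b \<in> Bas V \<Longrightarrow> b \<in> V"
    and Bas_norm: "b \<in> Bas V \<Longrightarrow> b \<bullet> b = 1"
    and proj_id: "x \<in> V \<Longrightarrow> proj V x = x"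
proof -
  note V = onb_Bas[OF assms, unfolded onb_def]
  show "card (Bas V) = dim V" "b \<in> Bas V \<Longrightarrow> b \<bullet> b = 1" "x \<in> V \<Longrightarrow> proj V x = x"
    using V unfolding proj_def by simp_all
  show "b \<in> Bas V \<Longrightarrow> b \<in> V" using V by blast
qed

lemma sum_Bas_norm: "subspace V \<Longrightarrow> (\<Sum>b\<in>Bas V. b \<bullet> b) = real (dim V)"
  using Bas_norm[of V] by (simp flip: card_Bas)

lemma proj_in: "subspace V \<Longrightarrow> proj V x \<in> V"
  unfolding proj_def by (intro subspace_sum subspace_scale) (simp_all add: Bas_in)

lemma parseval: "(\<Sum>b\<in>Bas V. (x \<bullet> b) * (y \<bullet> b)) = proj V x \<bullet> y"
  unfolding proj_def by (simp add: inner_sum_left inner_commute[of y])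

lemma proj_symmetric: "proj V x \<bullet> y = x \<bullet> proj V y"
  using parseval[where V = V and x = x and y = y] parseval[where V = V and x = y and y = x]
  by (simp add: mult.commute inner_commute[of x])

lemma linear_proj: "linear (proj V)"
  unfolding proj_def
  by (rule linearI)
    (auto simp: inner_add_left scaleR_add_left sum.distrib scaleR_sum_right)

lemma proj_add: "proj V (x + y) = proj V x + proj V y"
  and proj_diff: "proj V (x - y) = proj V x - proj V y"
  and proj_scale: "proj V (c *\<^sub>R x) = c *\<^sub>R proj V x"
  and proj_minus: "proj V (- x) = - proj V x"
  and proj_0: "proj V 0 = 0"
  using linear_proj[of V]
  by (rule linear_add linear_diff linear_scale linear_neg linear_0)+

lemma proj_orth: "(\<And>v. v \<in> V \<Longrightarrow> x \<bullet> v = 0) \<Longrightarrow> subspace V \<Longrightarrow> proj V x = 0"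
  unfolding proj_def by (simp add: Bas_in)

lemma proj_inner: "subspace V \<Longrightarrow> v \<in> V \<Longrightarrow> proj V x \<bullet> v = x \<bullet> v"
  by (simp add: proj_symmetric proj_id)

lemma proj_inner': "subspace V \<Longrightarrow> v \<in> V \<Longrightarrow> v \<bullet> proj V x = v \<bullet> x"
  by (metis proj_inner inner_commute)

lemma parseval_in: "subspace V \<Longrightarrow> y \<in> V \<Longrightarrow> (\<Sum>b\<in>Bas V. (x \<bullet> b) * (y \<bullet> b)) = x \<bullet> y"
  by (simp add: parseval proj_symmetric proj_id)

lemma expand_Bas: "subspace V \<Longrightarrow> linear g \<Longrightarrow> x \<in> V \<Longrightarrow> (\<Sum>b\<in>Bas V. (x \<bullet> b) *\<^sub>R g b) = g x"
proof -
  assume V: "subspace V" "linear g" "x \<in> V"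
  have "g x = g (proj V x)" using V proj_id by metis
  also have "\<dots> = (\<Sum>b\<in>Bas V. (x \<bullet> b) *\<^sub>R g b)"
    unfolding proj_def using V(2) by (simp add: linear_sum linear_scale)
  finally show ?thesis by simp
qed

lemma expand_Bas_real:
  fixes g :: "'a::euclidean_space \<Rightarrow> real"
  shows "subspace V \<Longrightarrow> linear g \<Longrightarrow> x \<in> V \<Longrightarrow> (\<Sum>b\<in>Bas V. (x \<bullet> b) * g b) = g x"
  using expand_Bas[of V g x] by simp

text \<open>The six nodes 0, 1, -1, 2, -2, 3 determine a polynomial of degree at most five, so the
  linear system for the coefficients has only the zero solution. This replaces differentiation
  whenever an identity is expanded along a line.\<close>

lemma poly5_coeffs_zero:
  assumes "\<And>s::real. a0 + a1 * s + a2 * s^2 + a3 * s^3 + a4 * s^4 + a5 * s^5 = 0"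
  shows "a0 = 0" "a1 = 0" "a2 = 0" "a3 = 0" "a4 = 0" "a5 = 0"
  using assms[of 0] assms[of 1] assms[of "-1"] assms[of 2] assms[of "-2"] assms[of 3]
  by simp_all

locale orth_decomp =
  fixes e :: "'a::euclidean_space" and V1 V2 V3 :: "'a set"
  assumes od: "orth_decomposition e V1 V2 V3"
begin

lemma od_subspace: "subspace V1" "subspace V2" "subspace V3"
  using od unfolding orth_decomposition_def by auto

lemma od_ee: "e \<bullet> e = 1"
  using od unfolding orth_decomposition_def by (auto simp: norm_eq_1)

lemma od_orth:
  "x \<in> V1 \<Longrightarrow> e \<bullet> x = 0" "x \<in> V2 \<Longrightarrow> e \<bullet> x = 0" "x \<in> V3 \<Longrightarrow> e \<bullet> x = 0"
  "x \<in> V1 \<Longrightarrow> x \<bullet> e = 0" "x \<in> V2 \<Longrightarrow> x \<bullet> e = 0" "x \<in> V3 \<Longrightarrow> x \<bullet> e = 0"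
  "x \<in> V1 \<Longrightarrow> y \<in> V2 \<Longrightarrow> x \<bullet> y = 0" "x \<in> V1 \<Longrightarrow> z \<in> V3 \<Longrightarrow> x \<bullet> z = 0"
  "y \<in> V2 \<Longrightarrow> z \<in> V3 \<Longrightarrow> y \<bullet> z = 0"
  "x \<in> V1 \<Longrightarrow> y \<in> V2 \<Longrightarrow> y \<bullet> x = 0" "x \<in> V1 \<Longrightarrow> z \<in> V3 \<Longrightarrow> z \<bullet> x = 0"
  "y \<in> V2 \<Longrightarrow> z \<in> V3 \<Longrightarrow> z \<bullet> y = 0"
  using od unfolding orth_decomposition_def orthogonal_def by (auto simp: inner_commute)

lemma od_expand: "x = (x \<bullet> e) *\<^sub>R e + proj V1 x + proj V2 x + proj V3 x"
proof -
  obtain t a b c where x: "x = t *\<^sub>R e + a + b + c" "a \<in> V1" "b \<in> V2" "c \<in> V3"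
    using od unfolding orth_decomposition_def by blast
  have "x \<bullet> e = t" using x od_orth od_ee by (simp add: inner_add_left)
  moreover have "proj V1 e = 0" "proj V2 e = 0" "proj V3 e = 0"
    "proj V1 b = 0" "proj V1 c = 0" "proj V2 a = 0" "proj V2 c = 0" "proj V3 a = 0" "proj V3 b = 0"
    using x od_orth od_subspace by (auto intro!: proj_orth)
  moreover have "proj V1 a = a" "proj V2 b = b" "proj V3 c = c"
    using x od_subspace by (auto simp: proj_id)
  ultimately have "t = x \<bullet> e" "proj V1 x = a" "proj V2 x = b" "proj V3 x = c"
    by (simp_all add: x proj_add proj_scale)
  then show ?thesis using x(1) by simp
qed

text \<open>The trace of a bilinear form is independent of the orthonormal basis: expanding the
  first argument of \<open>g c c\<close> along the decomposition and summing over \<open>c\<close>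
  folds the coefficients back into the second argument.\<close>

lemma trace_split:
  fixes g :: "'a \<Rightarrow> 'a \<Rightarrow> real"
  assumes l: "\<And>y. linear (\<lambda>x. g x y)" and r: "\<And>x. linear (g x)"
  shows "(\<Sum>c\<in>Basis. g c c) =
    g e e + (\<Sum>b\<in>Bas V1. g b b) + (\<Sum>b\<in>Bas V2. g b b) + (\<Sum>b\<in>Bas V3. g b b)"
proof -
  have full: "(\<Sum>c\<in>Basis. (c \<bullet> b) * g b c) = g b b" for b
  proof -
    have "g b b = g b (\<Sum>c\<in>Basis. (b \<bullet> c) *\<^sub>R c)" by (simp add: euclidean_representation)
    also have "\<dots> = (\<Sum>c\<in>Basis. (c \<bullet> b) * g b c)"
      using r[of b] by (simp add: linear_sum linear_scale inner_commute)
    finally show ?thesis by simp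
  qed
  have part: "(\<Sum>c\<in>Basis. g (proj V c) c) = (\<Sum>b\<in>Bas V. g b b)" for V
  proof -
    have "(\<Sum>c\<in>Basis. g (proj V c) c) = (\<Sum>c\<in>Basis. \<Sum>b\<in>Bas V. (c \<bullet> b) * g b c)"
      unfolding proj_def
      by (intro sum.cong refl) (simp add: linear_sum[OF l] linear_scale[OF l])
    also have "\<dots> = (\<Sum>b\<in>Bas V. \<Sum>c\<in>Basis. (c \<bullet> b) * g b c)" by (rule sum.swap)
    finally show ?thesis by (simp add: full)
  qed
  have "g c c = (c \<bullet> e) * g e c + g (proj V1 c) c + g (proj V2 c) c + g (proj V3 c) c" for c
  proof -
    have "g c c = g ((c \<bullet> e) *\<^sub>R e + proj V1 c + proj V2 c + proj V3 c) c"
      using od_expand[of c] by simp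
    then show ?thesis
      by (simp add: linear_add[OF l] linear_scale[OF l])
  qed
  then have "(\<Sum>c\<in>Basis. g c c) = (\<Sum>c\<in>Basis. (c \<bullet> e) * g e c)
    + (\<Sum>c\<in>Basis. g (proj V1 c) c) + (\<Sum>c\<in>Basis. g (proj V2 c) c) + (\<Sum>c\<in>Basis. g (proj V3 c) c)"
    by (simp only: sum.distrib)
  then show ?thesis by (simp only: part full)
qed

lemma od_eqI:
  assumes "x \<bullet> e = y \<bullet> e" "\<And>v. v \<in> V1 \<Longrightarrow> x \<bullet> v = y \<bullet> v"
    "\<And>v. v \<in> V2 \<Longrightarrow> x \<bullet> v = y \<bullet> v" "\<And>v. v \<in> V3 \<Longrightarrow> x \<bullet> v = y \<bullet> v"
  shows "x = y"
proof -
  have "proj V1 x = proj V1 y" "proj V2 x = proj V2 y" "proj V3 x = proj V3 y"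
    using assms od_subspace unfolding proj_def by (auto intro!: sum.cong simp: Bas_in)
  then show ?thesis using od_expand[of x] od_expand[of y] assms(1) by simp
qed

lemma od_dim:
  "real (DIM('a)) = 1 + real (dim V1) + real (dim V2) + real (dim V3)"
proof -
  have "(\<Sum>c\<in>Basis. c \<bullet> (c::'a)) = e \<bullet> e + (\<Sum>b\<in>Bas V1. b \<bullet> b) + (\<Sum>b\<in>Bas V2. b \<bullet> b) + (\<Sum>b\<in>Bas V3. b \<bullet> b)"
    using trace_split[of inner] by (simp add: linear_iff inner_add)
  then show ?thesis
    by (simp add: sum_Bas_norm od_subspace od_ee)
qed

end

section \<open>Commutative products with an invariant inner product\<close>

locale metrised_algebra =
  fixes mul :: "'a::euclidean_space \<Rightarrow> 'a \<Rightarrow> 'a" (infixl "\<odot>" 76)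
  assumes mul_add_left: "(x + y) \<odot> z = x \<odot> z + y \<odot> z"
    and mul_scale_left: "(c *\<^sub>R x) \<odot> z = c *\<^sub>R (x \<odot> z)"
    and mul_commute: "x \<odot> y = y \<odot> x"
    and mul_inner: "(x \<odot> y) \<bullet> z = x \<bullet> (y \<odot> z)"
begin

lemma mul_add_right: "z \<odot> (x + y) = z \<odot> x + z \<odot> y"
  and mul_scale_right: "z \<odot> (c *\<^sub>R x) = c *\<^sub>R (z \<odot> x)"
  using mul_add_left mul_scale_left mul_commute by metis+

lemma mul_zero_left [simp]: "0 \<odot> x = 0" and mul_zero_right [simp]: "x \<odot> 0 = 0"
  using mul_scale_left[of 0 0 x] mul_scale_right[of x 0 0] by simp_all

lemma mul_minus_left: "(- x) \<odot> y = - (x \<odot> y)"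
  and mul_minus_right: "y \<odot> (- x) = - (y \<odot> x)"
  using mul_scale_left[of "-1" x y] mul_scale_right[of y "-1" x] by simp_all

lemma mul_diff_left: "(x - y) \<odot> z = x \<odot> z - y \<odot> z"
  and mul_diff_right: "z \<odot> (x - y) = z \<odot> x - z \<odot> y"
  using mul_add_left[of x "- y" z] mul_add_right[of z x "- y"]
  by (simp_all add: mul_minus_left mul_minus_right)

lemmas mul_linear = mul_add_left mul_add_right mul_scale_left mul_scale_right
  mul_minus_left mul_minus_right mul_diff_left mul_diff_right

lemmas inner_linear = inner_add_left inner_add_right inner_scaleR_left inner_scaleR_right
  inner_minus_left inner_minus_right inner_diff_left inner_diff_right

lemma linear_mul: "linear (\<lambda>y. x \<odot> y)" and linear_mul': "linear (\<lambda>x. x \<odot> y)"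
  by (simp_all add: linear_iff mul_linear)

lemma bounded_bilinear_mul: "bounded_bilinear (\<odot>)"
  using bilinear_conv_bounded_bilinear[of "(\<odot>)"] linear_mul linear_mul' by (simp add: bilinear_def)

lemma mul_sum_right: "x \<odot> (\<Sum>i\<in>I. f i) = (\<Sum>i\<in>I. x \<odot> f i)"
  using linear_sum[OF linear_mul] .

lemma trilinear_rotate: "(x \<odot> y) \<bullet> z = (y \<odot> z) \<bullet> x"
  and trilinear_swap: "(x \<odot> y) \<bullet> z = (x \<odot> z) \<bullet> y"
  using mul_inner mul_commute by (metis inner_commute)+

definition tr :: "'a \<Rightarrow> real" where
  "tr x = (\<Sum>b\<in>Basis. (x \<odot> b) \<bullet> b)"

lemma tr_add: "tr (x + y) = tr x + tr y" and tr_scale: "tr (c *\<^sub>R x) = c * tr x"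
  unfolding tr_def by (simp_all add: mul_linear inner_linear sum.distrib sum_distrib_left)

lemma cubic_expand:
  "((x + s *\<^sub>R y) \<odot> (x + s *\<^sub>R y)) \<bullet> (x + s *\<^sub>R y) =
    (x \<odot> x) \<bullet> x + s * (3 * ((x \<odot> x) \<bullet> y)) + s^2 * (3 * ((y \<odot> y) \<bullet> x)) + s^3 * ((y \<odot> y) \<bullet> y)"
proof -
  have "(x \<odot> y) \<bullet> x = (x \<odot> x) \<bullet> y" "(x \<odot> y) \<bullet> y = (y \<odot> y) \<bullet> x"
    "(y \<odot> x) \<bullet> x = (x \<odot> x) \<bullet> y" "(y \<odot> x) \<bullet> y = (y \<odot> y) \<bullet> x"
    using trilinear_rotate trilinear_swap by metis+
  then show ?thesis
    by (simp add: mul_linear inner_linear power2_eq_square power3_eq_cube algebra_simps)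
qed

lemma square_expand:
  "(x + s *\<^sub>R y) \<odot> (x + s *\<^sub>R y) = x \<odot> x + (2 * s) *\<^sub>R (x \<odot> y) + s^2 *\<^sub>R (y \<odot> y)"
proof -
  have "(2 * s) *\<^sub>R (x \<odot> y) = s *\<^sub>R (x \<odot> y) + s *\<^sub>R (x \<odot> y)"
    by (simp flip: scaleR_add_left)
  then show ?thesis
    by (simp add: mul_linear mul_commute[of y x] power2_eq_square scaleR_add_right)
qed

lemma quintic_expand:
  fixes x y :: 'a and s :: real
  defines "z \<equiv> x + s *\<^sub>R y" and "p \<equiv> x \<odot> x" and "q \<equiv> x \<odot> y" and "r \<equiv> y \<odot> y"
  shows "((z \<odot> z) \<odot> (z \<odot> z)) \<bullet> z =
    (p \<odot> p) \<bullet> x + s * ((p \<odot> p) \<bullet> y + 4 * ((p \<odot> q) \<bullet> x))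
    + s^2 * (4 * ((p \<odot> q) \<bullet> y) + 4 * ((q \<odot> q) \<bullet> x) + 2 * ((p \<odot> r) \<bullet> x))
    + s^3 * (4 * ((q \<odot> r) \<bullet> x) + 4 * ((q \<odot> q) \<bullet> y) + 2 * ((p \<odot> r) \<bullet> y))
    + s^4 * ((r \<odot> r) \<bullet> x + 4 * ((q \<odot> r) \<bullet> y)) + s^5 * ((r \<odot> r) \<bullet> y)"
proof -
  have z2: "z \<odot> z = p + (2 * s) *\<^sub>R q + s^2 *\<^sub>R r"
    unfolding z_def p_def q_def r_def by (rule square_expand)
  show ?thesis
    unfolding z2
    by (simp add: z_def mul_linear inner_linear mul_commute[of q p] mul_commute[of r p]
        mul_commute[of r q] power2_eq_square power3_eq_cube power4_eq_xxxx algebra_simps eval_nat_numeral)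
qed

end

text \<open>
  The normal form of a radial eigencubic \<open>f\<close>, in terms of the commutative product with
  \<open>c f(x) = (x \<odot> x) \<bullet> x / 2\<close>; the hypothesis \<open>defect\<close> is the equation
  \<open>L(f) = \<lambda> |x|\<^sup>2 f\<close>.
\<close>

locale hsiang = metrised_algebra mul + orth_decomp e V1 V2 V3
  for mul :: "'a::euclidean_space \<Rightarrow> 'a \<Rightarrow> 'a" (infixl "\<odot>" 76) and e V1 V2 V3 +
  fixes nu :: real
  assumes mul_ee: "e \<odot> e = 2 *\<^sub>R e"
    and mul_e1: "x \<in> V1 \<Longrightarrow> e \<odot> x = -2 *\<^sub>R x"
    and mul_e2: "x \<in> V2 \<Longrightarrow> e \<odot> x = - x"
    and mul_e3: "x \<in> V3 \<Longrightarrow> e \<odot> x = x"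
    and T111: "x \<in> V1 \<Longrightarrow> y \<in> V1 \<Longrightarrow> z \<in> V1 \<Longrightarrow> (x \<odot> y) \<bullet> z = 0"
    and T112: "x \<in> V1 \<Longrightarrow> y \<in> V1 \<Longrightarrow> z \<in> V2 \<Longrightarrow> (x \<odot> y) \<bullet> z = 0"
    and T113: "x \<in> V1 \<Longrightarrow> y \<in> V1 \<Longrightarrow> z \<in> V3 \<Longrightarrow> (x \<odot> y) \<bullet> z = 0"
    and T122: "x \<in> V1 \<Longrightarrow> y \<in> V2 \<Longrightarrow> z \<in> V2 \<Longrightarrow> (x \<odot> y) \<bullet> z = 0"
    and T223: "x \<in> V2 \<Longrightarrow> y \<in> V2 \<Longrightarrow> z \<in> V3 \<Longrightarrow> (x \<odot> y) \<bullet> z = 0"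
    and T333: "x \<in> V3 \<Longrightarrow> y \<in> V3 \<Longrightarrow> z \<in> V3 \<Longrightarrow> (x \<odot> y) \<bullet> z = 0"
    and nu_nonzero: "nu \<noteq> 0"
    and defect: "((x \<odot> x) \<bullet> (x \<odot> x)) * tr x - ((x \<odot> x) \<odot> (x \<odot> x)) \<bullet> x
      = nu * (x \<bullet> x) * ((x \<odot> x) \<bullet> x)"
begin

section \<open>The eigencubic equation near \<open>e\<close>: traces, eigenvalue and
  dimensions\<close>

lemmas sub1 = od_subspace(1) and sub2 = od_subspace(2) and sub3 = od_subspace(3)

lemma mul_e_inner: "(e \<odot> x) \<bullet> e = 2 * (x \<bullet> e)"
  by (metis mul_ee trilinear_rotate inner_scaleR_left inner_commute)

lemma defect_at_e: "4 * tr e - 8 = 2 * nu"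
  using defect[of e] by (simp add: mul_ee mul_linear od_ee)

text \<open>Since \<open>e \<odot> e\<close> is a multiple of \<open>e\<close> and \<open>y\<close>
  is orthogonal to \<open>e\<close>, the squared norms, the cubic and the quintic at
  \<open>e + s *\<^sub>R y\<close> have no term linear in \<open>s\<close>. The linear coefficient
  of the equation is therefore just \<open>4 * tr y\<close>; the quadratic one is a condition on how
  \<open>e\<close> acts on \<open>y\<close>.\<close>

lemma defect_expand:
  assumes y: "y \<bullet> e = 0"
  shows tr_orth: "tr y = 0"
    and defect_2: "tr e * (4 * ((e \<odot> y) \<bullet> (e \<odot> y)) + 4 * ((e \<odot> y) \<bullet> y))
      - (8 * ((e \<odot> y) \<bullet> (e \<odot> y)) + 4 * ((e \<odot> (e \<odot> y)) \<bullet> (e \<odot> y)) + 8 * ((e \<odot> y) \<bullet> y))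
      = nu * (2 * (y \<bullet> y) + 3 * ((e \<odot> y) \<bullet> y))"
proof -
  have ey: "e \<bullet> y = 0" using y by (simp add: inner_commute)
  define q r where "q = e \<odot> y" and "r = y \<odot> y"
  have qe: "q \<bullet> e = 0" "e \<bullet> q = 0" using mul_e_inner[of y] y by (simp_all add: q_def inner_commute)
  have re: "r \<bullet> e = q \<bullet> y" "e \<bullet> r = q \<bullet> y"
    unfolding q_def r_def by (metis trilinear_rotate inner_commute)+
  have eq: "(e \<odot> q) \<bullet> e = 0" "(e \<odot> r) \<bullet> e = 2 * (q \<bullet> y)" "(e \<odot> q) \<bullet> y = q \<bullet> q" "(q \<odot> q) \<bullet> e = (e \<odot> q) \<bullet> q"
    using mul_e_inner qe re q_def trilinear_rotate trilinear_swap by (metis mult_zero_right)+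
  have sq: "(e + s *\<^sub>R y) \<odot> (e + s *\<^sub>R y) = 2 *\<^sub>R e + (2 * s) *\<^sub>R q + s^2 *\<^sub>R r" for s
    using square_expand[of e s y] by (simp add: mul_ee q_def r_def)
  have n2: "((e + s *\<^sub>R y) \<odot> (e + s *\<^sub>R y)) \<bullet> ((e + s *\<^sub>R y) \<odot> (e + s *\<^sub>R y))
      = 4 + s^2 * (4 * (q \<bullet> q) + 4 * (q \<bullet> y)) + s^3 * (4 * (q \<bullet> r)) + s^4 * (r \<bullet> r)" for s
    unfolding sq by (simp add: inner_linear od_ee qe re inner_commute[of r q]
        power2_eq_square power3_eq_cube power4_eq_xxxx algebra_simps)
  have q5: "(((e + s *\<^sub>R y) \<odot> (e + s *\<^sub>R y)) \<odot> ((e + s *\<^sub>R y) \<odot> (e + s *\<^sub>R y))) \<bullet> (e + s *\<^sub>R y)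
     = 8 + s^2 * (8 * (q \<bullet> q) + 4 * ((e \<odot> q) \<bullet> q) + 8 * (q \<bullet> y))
      + s^3 * (4 * ((q \<odot> r) \<bullet> e) + 4 * ((q \<odot> q) \<bullet> y) + 4 * ((e \<odot> r) \<bullet> y))
      + s^4 * ((r \<odot> r) \<bullet> e + 4 * ((q \<odot> r) \<bullet> y)) + s^5 * ((r \<odot> r) \<bullet> y)" for s
    unfolding quintic_expand mul_ee
    by (simp add: mul_ee mul_linear ey od_ee eq flip: q_def r_def)
  have cub: "((e + s *\<^sub>R y) \<odot> (e + s *\<^sub>R y)) \<bullet> (e + s *\<^sub>R y) = 2 + s^2 * (3 * (q \<bullet> y)) + s^3 * (r \<bullet> y)" for s
    unfolding cubic_expand by (simp add: mul_ee ey od_ee re flip: r_def)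
  have n1: "(e + s *\<^sub>R y) \<bullet> (e + s *\<^sub>R y) = 1 + s^2 * (y \<bullet> y)" for s
    by (simp add: inner_linear od_ee y ey power2_eq_square)
  have eq0: "(4 * tr e - 8 - 2 * nu) + (4 * tr y) * s
     + (tr e * (4 * (q \<bullet> q) + 4 * (q \<bullet> y)) - (8 * (q \<bullet> q) + 4 * ((e \<odot> q) \<bullet> q) + 8 * (q \<bullet> y))
        - nu * (2 * (y \<bullet> y) + 3 * (q \<bullet> y))) * s^2
     + (tr e * (4 * (q \<bullet> r)) + tr y * (4 * (q \<bullet> q) + 4 * (q \<bullet> y))
        - (4 * ((q \<odot> r) \<bullet> e) + 4 * ((q \<odot> q) \<bullet> y) + 4 * ((e \<odot> r) \<bullet> y)) - nu * (r \<bullet> y)) * s^3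
     + (tr e * (r \<bullet> r) + tr y * (4 * (q \<bullet> r)) - ((r \<odot> r) \<bullet> e + 4 * ((q \<odot> r) \<bullet> y))
        - nu * ((y \<bullet> y) * (3 * (q \<bullet> y)))) * s^4
     + (tr y * (r \<bullet> r) - (r \<odot> r) \<bullet> y - nu * ((y \<bullet> y) * (r \<bullet> y))) * s^5 = 0" for s
    using defect[of "e + s *\<^sub>R y"] unfolding n2 q5 cub n1 tr_add tr_scale by algebra
  show "tr y = 0" using poly5_coeffs_zero(2)[OF eq0] by simp
  show "tr e * (4 * ((e \<odot> y) \<bullet> (e \<odot> y)) + 4 * ((e \<odot> y) \<bullet> y))
      - (8 * ((e \<odot> y) \<bullet> (e \<odot> y)) + 4 * ((e \<odot> (e \<odot> y)) \<bullet> (e \<odot> y)) + 8 * ((e \<odot> y) \<bullet> y))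
      = nu * (2 * (y \<bullet> y) + 3 * ((e \<odot> y) \<bullet> y))"
    using poly5_coeffs_zero(3)[OF eq0] unfolding q_def by simp
qed

lemma tr_e_dims: "tr e = 2 - 2 * real (dim V1) - real (dim V2) + real (dim V3)"
proof -
  have "tr e = (e \<odot> e) \<bullet> e + (\<Sum>b\<in>Bas V1. (e \<odot> b) \<bullet> b) + (\<Sum>b\<in>Bas V2. (e \<odot> b) \<bullet> b)
      + (\<Sum>b\<in>Bas V3. (e \<odot> b) \<bullet> b)"
    unfolding tr_def by (rule trace_split) (simp_all add: linear_iff mul_linear inner_linear)
  also have "\<dots> = 2 + (\<Sum>b\<in>Bas V1. -2 * (b \<bullet> b)) + (\<Sum>b\<in>Bas V2. -1 * (b \<bullet> b)) + (\<Sum>b\<in>Bas V3. b \<bullet> b)"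
    by (simp add: mul_ee od_ee mul_e1 mul_e2 mul_e3 Bas_in sub1 sub2 sub3)
  finally show ?thesis
    by (simp only: sum_Bas_norm sub1 sub2 sub3 flip: sum_distrib_left)
qed

text \<open>For an eigenvector of \<open>e\<close> orthogonal to \<open>e\<close>,
  \<open>defect_2\<close> becomes a scalar relation between \<open>tr e\<close> and
  \<open>nu\<close>. Together with \<open>defect_at_e\<close>, each of the eigenvalues -2, -1 and 1
  yields \<open>tr e = 0\<close>, so one nonzero summand is enough.\<close>

lemma tr_e: "tr e = 0" and nu_eq: "nu = -4"
proof -
  have eig: "tr e * (4 * a^2 + 4 * a) - (8 * a^2 + 4 * a^3 + 8 * a) = nu * (2 + 3 * a)"
    if "y \<noteq> 0" "y \<bullet> e = 0" "e \<odot> y = a *\<^sub>R y" for y a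
  proof -
    have "(y \<bullet> y) * (tr e * (4 * a^2 + 4 * a) - (8 * a^2 + 4 * a^3 + 8 * a)) = (y \<bullet> y) * (nu * (2 + 3 * a))"
      using defect_2[OF that(2)] that(3)
      by (simp add: mul_linear inner_linear power2_eq_square power3_eq_cube algebra_simps)
    then show ?thesis using that(1) by simp
  qed
  consider (1) y where "y \<in> V1" "y \<noteq> 0" | (2) y where "y \<in> V2" "y \<noteq> 0" | (3) y where "y \<in> V3" "y \<noteq> 0"
    | (4) "V1 \<subseteq> {0}" "V2 \<subseteq> {0}" "V3 \<subseteq> {0}" by blast
  then show "tr e = 0"
  proof cases
    case 1 then show ?thesis using eig[of y "-2"] defect_at_e by (simp add: od_orth mul_e1)
  next
    case 2 then show ?thesis using eig[of y "-1"] defect_at_e by (simp add: od_orth mul_e2)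
  next
    case 3 then show ?thesis using eig[of y 1] defect_at_e by (simp add: od_orth mul_e3)
  next
    case 4
    \<comment> \<open>The whole space is now the line through \<open>e\<close>; there
      \<open>tr e = 2\<close>, and \<open>defect_at_e\<close> would give
      \<open>nu = 0\<close>.\<close>
    then have "dim V1 = 0" "dim V2 = 0" "dim V3 = 0" by simp_all
    then show ?thesis using tr_e_dims defect_at_e nu_nonzero by linarith
  qed
  then show "nu = -4" using defect_at_e by simp
qed

lemma tr_zero: "tr x = 0"
proof -
  have "tr (x - (x \<bullet> e) *\<^sub>R e) = 0"
    by (rule tr_orth) (simp add: inner_linear od_ee)
  then show ?thesis
    using tr_add[of "x - (x \<bullet> e) *\<^sub>R e" "(x \<bullet> e) *\<^sub>R e"] by (simp add: tr_scale tr_e)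
qed

lemma dim_V3: "real (dim V3) = 2 * real (dim V1) + real (dim V2) - 2"
  using tr_e tr_e_dims by simp

lemma dim_total: "real (DIM('a)) = 3 * real (dim V1) + 2 * real (dim V2) - 1"
  using od_dim dim_V3 by simp

section \<open>The quintic identity, its polar forms and its Laplacian\<close>

lemma quintic: "((x \<odot> x) \<odot> (x \<odot> x)) \<bullet> x = 4 * (x \<bullet> x) * ((x \<odot> x) \<bullet> x)"
  using defect[of x] by (simp add: tr_zero nu_eq)

lemma quintic_polar:
  fixes x y :: 'a
  defines "p \<equiv> x \<odot> x" and "q \<equiv> x \<odot> y" and "r \<equiv> y \<odot> y"
  shows quintic_1: "(p \<odot> p) \<bullet> y + 4 * ((p \<odot> q) \<bullet> x)
      = 12 * (x \<bullet> x) * (p \<bullet> y) + 8 * (x \<bullet> y) * (p \<bullet> x)"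
    and quintic_2: "4 * ((p \<odot> q) \<bullet> y) + 4 * ((q \<odot> q) \<bullet> x) + 2 * ((p \<odot> r) \<bullet> x)
      = 12 * (x \<bullet> x) * (r \<bullet> x) + 24 * (x \<bullet> y) * (p \<bullet> y) + 4 * (y \<bullet> y) * (p \<bullet> x)"
    and quintic_4: "(r \<odot> r) \<bullet> x + 4 * ((q \<odot> r) \<bullet> y)
      = 12 * (y \<bullet> y) * (r \<bullet> x) + 8 * (x \<bullet> y) * (r \<bullet> y)"
proof -
  have n: "(x + s *\<^sub>R y) \<bullet> (x + s *\<^sub>R y) = x \<bullet> x + s * (2 * (x \<bullet> y)) + s^2 * (y \<bullet> y)" for s
    by (simp add: inner_linear inner_commute[of y x] power2_eq_square algebra_simps)
  have eq0: "((p \<odot> p) \<bullet> x - 4 * (x \<bullet> x) * (p \<bullet> x))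
    + ((p \<odot> p) \<bullet> y + 4 * ((p \<odot> q) \<bullet> x) - (12 * (x \<bullet> x) * (p \<bullet> y) + 8 * (x \<bullet> y) * (p \<bullet> x))) * s
    + (4 * ((p \<odot> q) \<bullet> y) + 4 * ((q \<odot> q) \<bullet> x) + 2 * ((p \<odot> r) \<bullet> x)
      - (12 * (x \<bullet> x) * (r \<bullet> x) + 24 * (x \<bullet> y) * (p \<bullet> y) + 4 * (y \<bullet> y) * (p \<bullet> x))) * s^2
    + (4 * ((q \<odot> r) \<bullet> x) + 4 * ((q \<odot> q) \<bullet> y) + 2 * ((p \<odot> r) \<bullet> y)
      - (4 * (x \<bullet> x) * (r \<bullet> y) + 24 * (x \<bullet> y) * (r \<bullet> x) + 12 * (y \<bullet> y) * (p \<bullet> y))) * s^3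
    + ((r \<odot> r) \<bullet> x + 4 * ((q \<odot> r) \<bullet> y) - (12 * (y \<bullet> y) * (r \<bullet> x) + 8 * (x \<bullet> y) * (r \<bullet> y))) * s^4
    + ((r \<odot> r) \<bullet> y - 4 * (y \<bullet> y) * (r \<bullet> y)) * s^5 = 0" for s
    using quintic[of "x + s *\<^sub>R y"]
    unfolding quintic_expand cubic_expand n p_def[symmetric] q_def[symmetric] r_def[symmetric]
    by algebra
  show "(p \<odot> p) \<bullet> y + 4 * ((p \<odot> q) \<bullet> x) = 12 * (x \<bullet> x) * (p \<bullet> y) + 8 * (x \<bullet> y) * (p \<bullet> x)"
    using poly5_coeffs_zero(2)[OF eq0] by simp
  show "4 * ((p \<odot> q) \<bullet> y) + 4 * ((q \<odot> q) \<bullet> x) + 2 * ((p \<odot> r) \<bullet> x)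
      = 12 * (x \<bullet> x) * (r \<bullet> x) + 24 * (x \<bullet> y) * (p \<bullet> y) + 4 * (y \<bullet> y) * (p \<bullet> x)"
    using poly5_coeffs_zero(3)[OF eq0] by simp
  show "(r \<odot> r) \<bullet> x + 4 * ((q \<odot> r) \<bullet> y) = 12 * (y \<bullet> y) * (r \<bullet> x) + 8 * (x \<bullet> y) * (r \<bullet> y)"
    using poly5_coeffs_zero(5)[OF eq0] by simp
qed

text \<open>Pairing the sum with \<open>u\<close> gives \<open>tr u\<close>, so this is harmonicity
  of the cubic in vector form.\<close>

lemma sum_squares_zero: "(\<Sum>b\<in>Basis. b \<odot> b) = 0"
proof -
  have "(\<Sum>b\<in>Basis. b \<odot> b) \<bullet> u = 0" for u
    using tr_zero[of u] unfolding tr_def inner_sum_left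
    by (subst trilinear_swap) (simp add: mul_commute)
  then show ?thesis by (metis inner_eq_zero_iff)
qed

text \<open>Multiplications are self-adjoint, so this is tr(L_x L_y).\<close>

definition gram :: "'a \<Rightarrow> 'a \<Rightarrow> real" where
  "gram x y = (\<Sum>b\<in>Basis. (x \<odot> b) \<bullet> (y \<odot> b))"

text \<open>Summing \<open>quintic_2\<close> over \<open>y\<close> in an orthonormal basis is taking
  half the Laplacian. The terms with \<open>b \<odot> b\<close> disappear by
  \<open>sum_squares_zero\<close>; on the right \<open>24 + 4 n\<close> remains, and division by 4
  gives \<open>n + 6\<close>.\<close>

lemma cube_trace_gram:
  "(\<Sum>b\<in>Basis. (x \<odot> (x \<odot> b)) \<bullet> (x \<odot> b)) + gram x (x \<odot> x) =
     (real (DIM('a)) + 6) * ((x \<odot> x) \<bullet> x)"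
proof -
  have "4 * ((x \<odot> (x \<odot> b)) \<bullet> (x \<odot> b)) + 4 * ((x \<odot> b) \<bullet> ((x \<odot> x) \<odot> b)) + 2 * (((x \<odot> x) \<odot> x) \<bullet> (b \<odot> b))
     = 12 * (x \<bullet> x) * (x \<bullet> (b \<odot> b)) + 24 * ((x \<bullet> b) * ((x \<odot> x) \<bullet> b)) + 4 * ((x \<odot> x) \<bullet> x) * (b \<bullet> b)" for b
  proof -
    have "(((x \<odot> x) \<odot> (x \<odot> b)) \<bullet> b) = (x \<odot> b) \<bullet> ((x \<odot> x) \<odot> b)"
      "((x \<odot> b) \<odot> (x \<odot> b)) \<bullet> x = (x \<odot> (x \<odot> b)) \<bullet> (x \<odot> b)"
      "((x \<odot> x) \<odot> (b \<odot> b)) \<bullet> x = ((x \<odot> x) \<odot> x) \<bullet> (b \<odot> b)"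
      by (metis mul_inner mul_commute inner_commute)+
    then show ?thesis using quintic_2[of x b] by (simp add: inner_commute algebra_simps)
  qed
  then have "(\<Sum>b\<in>Basis. 4 * ((x \<odot> (x \<odot> b)) \<bullet> (x \<odot> b)) + 4 * ((x \<odot> b) \<bullet> ((x \<odot> x) \<odot> b)) + 2 * (((x \<odot> x) \<odot> x) \<bullet> (b \<odot> b)))
     = (\<Sum>b\<in>Basis. 12 * (x \<bullet> x) * (x \<bullet> (b \<odot> b)) + 24 * ((x \<bullet> b) * ((x \<odot> x) \<bullet> b)) + 4 * ((x \<odot> x) \<bullet> x) * (b \<bullet> b))"
    by simp
  then have "4 * (\<Sum>b\<in>Basis. (x \<odot> (x \<odot> b)) \<bullet> (x \<odot> b)) + 4 * gram x (x \<odot> x)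
      + 2 * (((x \<odot> x) \<odot> x) \<bullet> (\<Sum>b\<in>Basis. b \<odot> b))
    = 12 * (x \<bullet> x) * (x \<bullet> (\<Sum>b\<in>Basis. b \<odot> b)) + 24 * (\<Sum>b\<in>Basis. (x \<bullet> b) * ((x \<odot> x) \<bullet> b))
      + 4 * ((x \<odot> x) \<bullet> x) * (\<Sum>b\<in>(Basis::'a set). b \<bullet> b)"
    unfolding gram_def inner_sum_right sum.distrib sum_distrib_left .
  moreover have "(\<Sum>b\<in>Basis. (x \<bullet> b) * ((x \<odot> x) \<bullet> b)) = (x \<odot> x) \<bullet> x"
    by (metis euclidean_inner inner_commute)
  moreover have "(\<Sum>b\<in>(Basis::'a set). b \<bullet> b) = real (DIM('a))" by simp
  ultimately show ?thesis by (simp add: sum_squares_zero algebra_simps)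
qed

section \<open>The Peirce decomposition\<close>

abbreviation "P1 \<equiv> proj V1"
abbreviation "P2 \<equiv> proj V2"
abbreviation "P3 \<equiv> proj V3"

lemma P_in [simp]: "P1 x \<in> V1" "P2 x \<in> V2" "P3 x \<in> V3"
  by (simp_all add: proj_in sub1 sub2 sub3)

lemma P_inner [simp]:
  "x \<in> V1 \<Longrightarrow> P1 u \<bullet> x = u \<bullet> x" "x \<in> V2 \<Longrightarrow> P2 u \<bullet> x = u \<bullet> x" "x \<in> V3 \<Longrightarrow> P3 u \<bullet> x = u \<bullet> x"
  by (simp_all add: proj_inner sub1 sub2 sub3)

lemma P_id [simp]: "x \<in> V1 \<Longrightarrow> P1 x = x" "x \<in> V2 \<Longrightarrow> P2 x = x" "x \<in> V3 \<Longrightarrow> P3 x = x"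
  by (simp_all add: proj_id sub1 sub2 sub3)

lemmas sub_closed = subspace_add[OF sub1] subspace_add[OF sub2] subspace_add[OF sub3]
  subspace_scale[OF sub1] subspace_scale[OF sub2] subspace_scale[OF sub3]
  subspace_neg[OF sub1] subspace_neg[OF sub2] subspace_neg[OF sub3]
  subspace_diff[OF sub1] subspace_diff[OF sub2] subspace_diff[OF sub3]

lemma zero_in [simp]: "0 \<in> V1" "0 \<in> V2" "0 \<in> V3"
  by (simp_all add: subspace_0 sub1 sub2 sub3)

lemma perp_products:
  "x \<in> V1 \<Longrightarrow> y \<in> V1 \<Longrightarrow> (x \<odot> y) \<bullet> e = -2 * (x \<bullet> y)"
  "x \<in> V2 \<Longrightarrow> y \<in> V2 \<Longrightarrow> (x \<odot> y) \<bullet> e = - (x \<bullet> y)"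
  "x \<in> V3 \<Longrightarrow> y \<in> V3 \<Longrightarrow> (x \<odot> y) \<bullet> e = x \<bullet> y"
  "x \<in> V1 \<Longrightarrow> y \<in> V2 \<Longrightarrow> (x \<odot> y) \<bullet> e = 0"
  "x \<in> V1 \<Longrightarrow> y \<in> V3 \<Longrightarrow> (x \<odot> y) \<bullet> e = 0"
  "x \<in> V2 \<Longrightarrow> y \<in> V3 \<Longrightarrow> (x \<odot> y) \<bullet> e = 0"
  by (simp_all add: mul_inner mul_commute[of _ e] mul_e1 mul_e2 mul_e3 inner_linear od_orth)

lemma mul_11: "x \<in> V1 \<Longrightarrow> y \<in> V1 \<Longrightarrow> x \<odot> y = (-2 * (x \<bullet> y)) *\<^sub>R e"
  by (rule od_eqI) (simp_all add: perp_products od_ee od_orth T111 T112 T113)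

lemma T_perm:
  "x \<in> V1 \<Longrightarrow> y \<in> V1 \<Longrightarrow> z \<in> V2 \<Longrightarrow> (x \<odot> z) \<bullet> y = 0"
  "x \<in> V1 \<Longrightarrow> y \<in> V1 \<Longrightarrow> z \<in> V3 \<Longrightarrow> (x \<odot> z) \<bullet> y = 0"
  "x \<in> V1 \<Longrightarrow> y \<in> V2 \<Longrightarrow> z \<in> V2 \<Longrightarrow> (y \<odot> z) \<bullet> x = 0"
  "x \<in> V2 \<Longrightarrow> y \<in> V2 \<Longrightarrow> z \<in> V3 \<Longrightarrow> (x \<odot> z) \<bullet> y = 0"
  using T112 T113 T122 T223 trilinear_rotate trilinear_swap by metis+

lemma mul_12_in: "x \<in> V1 \<Longrightarrow> y \<in> V2 \<Longrightarrow> x \<odot> y \<in> V3"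
proof -
  assume xy: "x \<in> V1" "y \<in> V2"
  have "x \<odot> y = P3 (x \<odot> y)"
    by (rule od_eqI) (simp_all add: xy perp_products od_orth T_perm T122)
  then show ?thesis by (metis P_in(3))
qed

lemma mul_22: "x \<in> V2 \<Longrightarrow> y \<in> V2 \<Longrightarrow> x \<odot> y = (- (x \<bullet> y)) *\<^sub>R e + P2 (x \<odot> y)"
  apply (rule od_eqI)
     apply (simp_all add: perp_products od_ee inner_linear od_orth(1-6))
   apply (simp_all add: T_perm(3) T223)
  by (simp_all add: od_orth)

lemma mul_13: "x \<in> V1 \<Longrightarrow> y \<in> V3 \<Longrightarrow> x \<odot> y = P2 (x \<odot> y) + P3 (x \<odot> y)"
  apply (rule od_eqI)
     apply (simp_all add: perp_products od_ee inner_linear od_orth(1-6))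
   apply (simp_all add: T_perm(2))
  by (simp_all add: od_orth)

lemma mul_23: "x \<in> V2 \<Longrightarrow> y \<in> V3 \<Longrightarrow> x \<odot> y = P1 (x \<odot> y) + P3 (x \<odot> y)"
  apply (rule od_eqI)
     apply (simp_all add: perp_products od_ee inner_linear od_orth(1-6))
   apply (simp_all add: T_perm(4))
  by (simp_all add: od_orth)

lemma mul_33: "x \<in> V3 \<Longrightarrow> y \<in> V3 \<Longrightarrow> x \<odot> y = (x \<bullet> y) *\<^sub>R e + P1 (x \<odot> y) + P2 (x \<odot> y)"
  apply (rule od_eqI)
     apply (simp_all add: perp_products od_ee inner_linear od_orth(1-6))
   apply (simp_all add: T333)
  by (simp_all add: od_orth)

section \<open>Norm identities from the component of the quintic along \<open>e\<close>\<close>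

lemma block_inner:
  "a \<in> V1 \<Longrightarrow> b \<in> V2 \<Longrightarrow> c \<in> V3 \<Longrightarrow> a' \<in> V1 \<Longrightarrow> b' \<in> V2 \<Longrightarrow> c' \<in> V3 \<Longrightarrow>
    (t *\<^sub>R e + a + b + c) \<bullet> (t' *\<^sub>R e + a' + b' + c') = t * t' + a \<bullet> a' + b \<bullet> b' + c \<bullet> c'"
  by (simp add: inner_linear od_orth od_ee)

lemma mul_e_block:
  "a \<in> V1 \<Longrightarrow> b \<in> V2 \<Longrightarrow> c \<in> V3 \<Longrightarrow>
    e \<odot> (t *\<^sub>R e + a + b + c) = (2 * t) *\<^sub>R e + (-2 *\<^sub>R a) + (- b) + c"
  by (simp add: mul_linear mul_ee mul_e1 mul_e2 mul_e3)

text \<open>This is the derivative of the quintic identity at \<open>y\<close> in the direction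
  \<open>e\<close>, found as the coefficient of \<open>s^4\<close> at
  \<open>e + s *\<^sub>R y\<close>. As \<open>e\<close> acts by a scalar on each summand, only inner
  products of products of two elements occur in it.\<close>

lemma quartic:
  assumes "y \<bullet> e = 0"
  shows "(y \<odot> y) \<bullet> (e \<odot> (y \<odot> y)) + 4 * ((y \<odot> (e \<odot> y)) \<bullet> (y \<odot> y)) = 12 * (y \<bullet> y) * ((e \<odot> y) \<bullet> y)"
proof -
  have "((y \<odot> y) \<odot> (y \<odot> y)) \<bullet> e = (y \<odot> y) \<bullet> (e \<odot> (y \<odot> y))"
    "((e \<odot> y) \<odot> (y \<odot> y)) \<bullet> y = (y \<odot> (e \<odot> y)) \<bullet> (y \<odot> y)"
    "(y \<odot> y) \<bullet> e = (e \<odot> y) \<bullet> y"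
    by (metis mul_inner mul_commute inner_commute)+
  then show ?thesis using quintic_4[of y e] assms by (simp add: inner_commute)
qed

lemma square_blocks:
  assumes x: "x \<in> V1" and y: "y \<in> V2" and z: "z \<in> V3"
  shows "(x + y + z) \<odot> (x + y + z) = (-2 * (x \<bullet> x) - y \<bullet> y + z \<bullet> z) *\<^sub>R e
    + (2 *\<^sub>R P1 (y \<odot> z) + P1 (z \<odot> z))
    + (2 *\<^sub>R P2 (x \<odot> z) + P2 (y \<odot> y) + P2 (z \<odot> z))
    + (2 *\<^sub>R (x \<odot> y) + 2 *\<^sub>R P3 (x \<odot> z) + 2 *\<^sub>R P3 (y \<odot> z))"
proof -
  have "(x + y + z) \<odot> (x + y + z) = x \<odot> x + y \<odot> y + z \<odot> z + 2 *\<^sub>R (x \<odot> y) + 2 *\<^sub>R (x \<odot> z) + 2 *\<^sub>R (y \<odot> z)"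
    by (simp add: mul_linear mul_commute[of y x] mul_commute[of z x] mul_commute[of z y] scaleR_2)
  also have "\<dots> = (-2 * (x \<bullet> x) - y \<bullet> y + z \<bullet> z) *\<^sub>R e
    + (2 *\<^sub>R P1 (y \<odot> z) + P1 (z \<odot> z))
    + (2 *\<^sub>R P2 (x \<odot> z) + P2 (y \<odot> y) + P2 (z \<odot> z))
    + (2 *\<^sub>R (x \<odot> y) + 2 *\<^sub>R P3 (x \<odot> z) + 2 *\<^sub>R P3 (y \<odot> z))"
    apply (subst mul_11[OF x x], subst mul_22[OF y y], subst mul_33[OF z z])
    apply (subst mul_13[OF x z], subst mul_23[OF y z])
    by (simp add: scaleR_add_right scaleR_add_left algebra_simps)
  finally show ?thesis .
qed

text \<open>This is \<open>quartic\<close> at \<open>x + y + z\<close>, with \<open>t\<close>,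
  \<open>a\<close>, \<open>b\<close>, \<open>c\<close> the components of the square. Setting
  variables to zero or changing a sign then isolates identities of a fixed multidegree.\<close>

lemma quartic_blocks:
  fixes x y z :: 'a
  assumes x: "x \<in> V1" and y: "y \<in> V2" and z: "z \<in> V3"
  defines "a \<equiv> 2 *\<^sub>R P1 (y \<odot> z) + P1 (z \<odot> z)"
    and "b \<equiv> 2 *\<^sub>R P2 (x \<odot> z) + P2 (y \<odot> y) + P2 (z \<odot> z)"
    and "c \<equiv> 2 *\<^sub>R (x \<odot> y) + 2 *\<^sub>R P3 (x \<odot> z) + 2 *\<^sub>R P3 (y \<odot> z)"
    and "t \<equiv> -2 * (x \<bullet> x) - y \<bullet> y + z \<bullet> z"
  shows "2 * t^2 - 2 * (a \<bullet> a) - b \<bullet> b + c \<bullet> c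
      + 4 * ((4 * (x \<bullet> x) + y \<bullet> y + z \<bullet> z) * t + P1 (z \<odot> z) \<bullet> a
        + (- P2 (y \<odot> y) + P2 (z \<odot> z) - P2 (x \<odot> z)) \<bullet> b
        + (-3 *\<^sub>R (x \<odot> y) - P3 (x \<odot> z)) \<bullet> c)
    = 12 * (x \<bullet> x + y \<bullet> y + z \<bullet> z) * t"
proof -
  define u where "u = x + y + z"
  have ue: "u \<bullet> e = 0" using x y z by (simp add: u_def inner_linear od_orth)
  have abc: "a \<in> V1" "b \<in> V2" "c \<in> V3"
    using x y z by (auto simp: a_def b_def c_def mul_12_in intro!: sub_closed)
  have eu: "e \<odot> u = (-2 *\<^sub>R x) + (- y) + z"
    using x y z by (simp add: u_def mul_linear mul_e1 mul_e2 mul_e3)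
  have uu: "u \<odot> u = t *\<^sub>R e + a + b + c"
    unfolding u_def a_def b_def c_def t_def by (rule square_blocks[OF x y z])
  \<comment> \<open>These are the components of \<open>u \<odot> (e \<odot> u)\<close>. No
    \<open>y \<odot> z\<close> appears, because \<open>e\<close> acts with opposite signs on
    \<open>V2\<close> and \<open>V3\<close>.\<close>
  define t' a' b' c' where "t' = 4 * (x \<bullet> x) + y \<bullet> y + z \<bullet> z" and "a' = P1 (z \<odot> z)"
    and "b' = - P2 (y \<odot> y) + P2 (z \<odot> z) - P2 (x \<odot> z)" and "c' = -3 *\<^sub>R (x \<odot> y) - P3 (x \<odot> z)"
  have abc': "a' \<in> V1" "b' \<in> V2" "c' \<in> V3"
    using x y z by (auto simp: a'_def b'_def c'_def mul_12_in intro!: sub_closed)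
  have ueu: "u \<odot> (e \<odot> u) = t' *\<^sub>R e + a' + b' + c'"
  proof -
    have s3: "3 *\<^sub>R v = v + (v + v)" for v :: 'a
      using scaleR_left_distrib[of 1 2 v] by (simp add: scaleR_2)
    have "u \<odot> (e \<odot> u) = -2 *\<^sub>R (x \<odot> x) - y \<odot> y + z \<odot> z - 3 *\<^sub>R (x \<odot> y) - x \<odot> z"
      unfolding eu
      by (simp add: u_def mul_linear mul_commute[of y x] mul_commute[of z x] mul_commute[of z y]
          scaleR_2 s3 algebra_simps)
    also have "\<dots> = t' *\<^sub>R e + a' + b' + c'"
      apply (subst mul_11[OF x x], subst mul_22[OF y y], subst mul_33[OF z z])
      apply (subst mul_13[OF x z])
      by (simp add: t'_def a'_def b'_def c'_def scaleR_add_right scaleR_add_left algebra_simps)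
    finally show ?thesis .
  qed
  have n: "u \<bullet> u = x \<bullet> x + y \<bullet> y + z \<bullet> z" "(e \<odot> u) \<bullet> u = t"
    using x y z unfolding eu by (simp_all add: u_def inner_linear od_orth t_def)
  have "(t *\<^sub>R e + a + b + c) \<bullet> ((2 * t) *\<^sub>R e + (-2 *\<^sub>R a) + (- b) + c)
      + 4 * ((t' *\<^sub>R e + a' + b' + c') \<bullet> (t *\<^sub>R e + a + b + c)) = 12 * (x \<bullet> x + y \<bullet> y + z \<bullet> z) * t"
    using quartic[OF ue] unfolding ueu uu n mul_e_block[OF abc] .
  moreover have "(t *\<^sub>R e + a + b + c) \<bullet> ((2 * t) *\<^sub>R e + (-2 *\<^sub>R a) + (- b) + c)
     = t * (2 * t) + a \<bullet> (-2 *\<^sub>R a) + b \<bullet> (- b) + c \<bullet> c"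
    using abc by (intro block_inner sub_closed)
  moreover have "(t' *\<^sub>R e + a' + b' + c') \<bullet> (t *\<^sub>R e + a + b + c) = t' * t + a' \<bullet> a + b' \<bullet> b + c' \<bullet> c"
    using abc abc' by (intro block_inner)
  ultimately show ?thesis
    unfolding t'_def[symmetric] a'_def[symmetric] b'_def[symmetric] c'_def[symmetric]
    by (simp add: power2_eq_square)
qed

text \<open>The case \<open>x = z = 0\<close> of \<open>quartic_blocks\<close> is Cartan's eikonal
  equation on \<open>V2\<close>: the cubic \<open>g y = (y \<odot> y) \<bullet> y\<close> has |grad
  g|^2 = 18 |y|^4. Removing it from the case \<open>z = 0\<close> leaves the composition law between
  \<open>V1\<close> and \<open>V2\<close>.\<close>

lemma norm_mul_12:
  assumes x: "x \<in> V1" and y: "y \<in> V2"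
  shows "(x \<odot> y) \<bullet> (x \<odot> y) = (x \<bullet> x) * (y \<bullet> y)"
    and norm_mul_22: "P2 (y \<odot> y) \<bullet> P2 (y \<odot> y) = 2 * (y \<bullet> y)^2"
proof -
  show *: "P2 (y \<odot> y) \<bullet> P2 (y \<odot> y) = 2 * (y \<bullet> y)^2"
    using quartic_blocks[OF zero_in(1) y zero_in(3)]
    by (simp add: proj_0 inner_linear power2_eq_square)
  show "(x \<odot> y) \<bullet> (x \<odot> y) = (x \<bullet> x) * (y \<bullet> y)"
    using quartic_blocks[OF x y zero_in(3)] *
    by (simp add: proj_0 inner_linear power2_eq_square algebra_simps)
qed

lemma norm_mul_33:
  assumes z: "z \<in> V3"
  shows "2 * (P1 (z \<odot> z) \<bullet> P1 (z \<odot> z)) + 3 * (P2 (z \<odot> z) \<bullet> P2 (z \<odot> z)) = 6 * (z \<bullet> z)^2"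
  using quartic_blocks[OF zero_in(1) zero_in(2) z]
  by (simp add: proj_0 inner_linear power2_eq_square)

lemma norm_mul_13:
  assumes x: "x \<in> V1" and z: "z \<in> V3"
  shows "3 * (P2 (x \<odot> z) \<bullet> P2 (x \<odot> z)) + P3 (x \<odot> z) \<bullet> P3 (x \<odot> z) = 3 * (x \<bullet> x) * (z \<bullet> z)"
  using quartic_blocks[OF x zero_in(2) z] norm_mul_33[OF z]
  by (simp add: proj_0 inner_linear power2_eq_square algebra_simps inner_commute)

lemma norm_mul_23:
  assumes y: "y \<in> V2" and z: "z \<in> V3"
  shows "P3 (y \<odot> z) \<bullet> P3 (y \<odot> z) = (y \<bullet> y) * (z \<bullet> z) + 2 * (P1 (y \<odot> z) \<bullet> P1 (y \<odot> z))
     + 1/2 * ((y \<odot> y) \<bullet> P2 (z \<odot> z))"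
proof -
  have "P2 (y \<odot> y) \<bullet> P2 (z \<odot> z) = (y \<odot> y) \<bullet> P2 (z \<odot> z)" by simp
  then show ?thesis
  using quartic_blocks[OF zero_in(1) y z] norm_mul_33[OF z] norm_mul_22[OF zero_in(1) y]
  by (simp add: proj_0 inner_linear power2_eq_square algebra_simps inner_commute)
qed

text \<open>Once the norm identities in fewer variables are subtracted from
  \<open>quartic_blocks\<close>, the remaining terms have degrees (1,2,1) and (2,1,1) in
  \<open>x\<close>, \<open>y\<close>, \<open>z\<close>. The first are even and the second odd in
  \<open>y\<close>, so comparing \<open>y\<close> with \<open>- y\<close> separates them.\<close>

lemma mixed_121:
  assumes x: "x \<in> V1" and y: "y \<in> V2" and z: "z \<in> V3"
  shows "(y \<odot> y) \<bullet> P2 (x \<odot> z) + (x \<odot> y) \<bullet> (y \<odot> z) = 0"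
    and mixed_211: "(x \<odot> y) \<bullet> (x \<odot> z) = 0"
proof -
  have y': "- y \<in> V2" using y by (simp add: subspace_neg sub2)
  have i: "P3 (x \<odot> z) \<bullet> (x \<odot> y) = (x \<odot> z) \<bullet> (x \<odot> y)" "P3 (y \<odot> z) \<bullet> (x \<odot> y) = (y \<odot> z) \<bullet> (x \<odot> y)"
    "P2 (y \<odot> y) \<bullet> P2 (x \<odot> z) = (y \<odot> y) \<bullet> P2 (x \<odot> z)"
    using mul_12_in[OF x y] by simp_all
  note a = quartic_blocks[OF x y z] quartic_blocks[OF x y' z] norm_mul_13[OF x z] norm_mul_23[OF y z]
    norm_mul_33[OF z] norm_mul_22[OF x y] norm_mul_12[OF x y]
  note s = proj_0 inner_linear power2_eq_square mul_linear proj_minus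
  have "-16 * ((y \<odot> y) \<bullet> P2 (x \<odot> z)) - 24 * ((x \<odot> y) \<bullet> (x \<odot> z)) - 16 * ((x \<odot> y) \<bullet> (y \<odot> z)) = 0"
    "-16 * ((y \<odot> y) \<bullet> P2 (x \<odot> z)) + 24 * ((x \<odot> y) \<bullet> (x \<odot> z)) - 16 * ((x \<odot> y) \<bullet> (y \<odot> z)) = 0"
    using a i
    by (simp_all add: s algebra_simps inner_commute)
  then show "(y \<odot> y) \<bullet> P2 (x \<odot> z) + (x \<odot> y) \<bullet> (y \<odot> z) = 0" "(x \<odot> y) \<bullet> (x \<odot> z) = 0" by simp_all
qed

end

section \<open>Polarised identities\<close>

lemma polarize2:
  fixes B :: "'a::real_vector \<Rightarrow> 'a \<Rightarrow> real"
  assumes l: "\<And>x. linear (B x)" and sym: "\<And>x y. B x y = B y x" and V: "subspace V"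
    and diag: "\<And>x. x \<in> V \<Longrightarrow> B x x = 0" and xy: "x \<in> V" "y \<in> V"
  shows "B x y = 0"
proof -
  have r: "B (u + v) z = B u z + B v z" for u v z
    using linear_add[OF l[of z], of u v] sym by metis
  have "B (x + y) (x + y) = B x x + B y y + 2 * B x y"
    by (simp add: r linear_add[OF l] sym[of y x])
  then show ?thesis using diag[of "x + y"] diag xy V by (simp add: subspace_add)
qed

lemma polarize3:
  fixes S :: "'a::real_vector \<Rightarrow> 'a \<Rightarrow> 'a \<Rightarrow> real"
  assumes l: "\<And>x y. linear (S x y)" and sym: "\<And>x y z. S x y z = S y x z" "\<And>x y z. S x y z = S x z y"
    and V: "subspace V" and diag: "\<And>x. x \<in> V \<Longrightarrow> S x x x = 0" and xyz: "x \<in> V" "y \<in> V" "z \<in> V"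
  shows "S x y z = 0"
proof -
  have a: "S u v (a + b) = S u v a + S u v b" "S u v (- a) = - S u v a" for u v a b
    using linear_add[OF l] linear_neg[OF l] by blast+
  have a2: "S u (a + b) v = S u a v + S u b v" "S u (- a) v = - S u a v" for u v a b
    using a[of u v] by (simp_all only: sym(2)[of u v])
  have a3: "S (a + b) u v = S a u v + S b u v" "S (- a) u v = - S a u v" for u v a b
    using a2(1)[of u _ _ v] a2(2)[of u _ v] by (simp_all only: sym(1)[of u])
  have s: "S y x x = S x x y" "S x y x = S x x y" "S y x y = S x y y" "S y y x = S x y y" for x y
    by (rule trans[OF sym(1) sym(2)], rule sym(2), rule sym(1), rule trans[OF sym(2) sym(1)])
  have xxy: "S x x y = 0" if "x \<in> V" "y \<in> V" for x y
  proof -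
    have "S (x + y) (x + y) (x + y) = S x x x + 3 * S x x y + 3 * S x y y + S y y y"
      "S (x + - y) (x + - y) (x + - y) = S x x x - 3 * S x x y + 3 * S x y y - S y y y"
      unfolding a a2 a3 by (simp_all add: s[where x = x and y = y])
    moreover have "x + y \<in> V" "x + - y \<in> V" using that V by (simp_all add: subspace_add subspace_diff)
    ultimately show ?thesis using diag[of x] diag[of y] diag[of "x + y"] diag[of "x + - y"] that by linarith
  qed
  have "S (x + y) (x + y) z = S x x z + S y y z + 2 * S x y z"
    unfolding a2 a3 using sym(1)[of y x z] by simp
  then show ?thesis using xxy V xyz by (simp add: subspace_add)
qed

text \<open>Expanding \<open>A b\<close> in the basis of \<open>W\<close> produces a double sum
  whose coefficients \<open>A b \<bullet> c\<close> are also those of \<open>A' c\<close> in the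
  basis of \<open>V\<close>. This is cyclicity of the trace for a map between two subspaces.\<close>

lemma sum_Bas_adjoint:
  fixes g :: "'a::euclidean_space \<Rightarrow> 'a \<Rightarrow> real"
  assumes l: "\<And>y. linear (\<lambda>x. g x y)" and r: "\<And>x. linear (g x)"
    and V: "subspace V" and W: "subspace W"
    and A: "\<And>x. x \<in> V \<Longrightarrow> A x \<in> W" and A': "\<And>y. y \<in> W \<Longrightarrow> A' y \<in> V"
    and adj: "\<And>x y. x \<in> V \<Longrightarrow> y \<in> W \<Longrightarrow> A x \<bullet> y = x \<bullet> A' y"
  shows "(\<Sum>b\<in>Bas V. g (A b) b) = (\<Sum>c\<in>Bas W. g c (A' c))"
proof -
  have "(\<Sum>b\<in>Bas V. g (A b) b) = (\<Sum>b\<in>Bas V. \<Sum>c\<in>Bas W. (A b \<bullet> c) * g c b)"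
    using expand_Bas_real[OF W l] A Bas_in[OF V] by (intro sum.cong refl) simp
  also have "\<dots> = (\<Sum>c\<in>Bas W. \<Sum>b\<in>Bas V. (A b \<bullet> c) * g c b)" by (rule sum.swap)
  also have "\<dots> = (\<Sum>c\<in>Bas W. \<Sum>b\<in>Bas V. (A' c \<bullet> b) * g c b)"
    using adj Bas_in[OF V] Bas_in[OF W] by (intro sum.cong refl) (simp add: inner_commute)
  also have "\<dots> = (\<Sum>c\<in>Bas W. g c (A' c))"
    using expand_Bas_real[OF V r] A' Bas_in[OF W] by (intro sum.cong refl) simp
  finally show ?thesis .
qed

context hsiang
begin

lemmas lin = linear_iff mul_linear inner_linear proj_add proj_scale proj_diff proj_minus

lemma norm_mul_12_polar:
  assumes x: "x \<in> V1" "x' \<in> V1" and y: "y \<in> V2" "y' \<in> V2"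
  shows norm_mul_12_V2: "(x \<odot> y) \<bullet> (x \<odot> y') = (x \<bullet> x) * (y \<bullet> y')"
    and norm_mul_12_V1: "(x \<odot> y) \<bullet> (x' \<odot> y) = (x \<bullet> x') * (y \<bullet> y)"
proof -
  have "(x \<odot> y) \<bullet> (x \<odot> y') - (x \<bullet> x) * (y \<bullet> y') = 0"
    by (rule polarize2[where V = V2 and B = "\<lambda>u v. (x \<odot> u) \<bullet> (x \<odot> v) - (x \<bullet> x) * (u \<bullet> v)"])
      (simp_all add: lin sub2 y norm_mul_12 x algebra_simps inner_commute)
  then show "(x \<odot> y) \<bullet> (x \<odot> y') = (x \<bullet> x) * (y \<bullet> y')" by simp
  have "(x \<odot> y) \<bullet> (x' \<odot> y) - (x \<bullet> x') * (y \<bullet> y) = 0"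
    by (rule polarize2[where V = V1 and B = "\<lambda>u v. (u \<odot> y) \<bullet> (v \<odot> y) - (u \<bullet> v) * (y \<bullet> y)"])
      (simp_all add: lin sub1 y norm_mul_12 x algebra_simps inner_commute)
  then show "(x \<odot> y) \<bullet> (x' \<odot> y) = (x \<bullet> x') * (y \<bullet> y)" by simp
qed

text \<open>The component in \<open>V2\<close> is the polarised norm identity, and the one in
  \<open>V3\<close> vanishes by \<open>mixed_211\<close>. Thus a nonzero \<open>x\<close> embeds
  \<open>V2\<close> into \<open>V3\<close> by a multiple of an isometry, and a second multiplication
  by \<open>x\<close> inverts it up to \<open>x \<bullet> x\<close>.\<close>

lemma mul_1_12:
  assumes x: "x \<in> V1" and y: "y \<in> V2"
  shows "x \<odot> (x \<odot> y) = (x \<bullet> x) *\<^sub>R y"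
proof (rule od_eqI)
  have p: "x \<odot> y \<in> V3" by (rule mul_12_in[OF x y])
  show "(x \<odot> (x \<odot> y)) \<bullet> e = ((x \<bullet> x) *\<^sub>R y) \<bullet> e"
    by (simp add: perp_products x p od_orth y)
  show "(x \<odot> (x \<odot> y)) \<bullet> v = ((x \<bullet> x) *\<^sub>R y) \<bullet> v" if "v \<in> V1" for v
    using that x p y by (simp add: T_perm od_orth)
  have *: "(x \<odot> (x \<odot> y)) \<bullet> v = (x \<odot> y) \<bullet> (x \<odot> v)" for v
    by (metis mul_inner mul_commute)
  show "(x \<odot> (x \<odot> y)) \<bullet> v = ((x \<bullet> x) *\<^sub>R y) \<bullet> v" if "v \<in> V2" for v
    unfolding * using norm_mul_12_V2[OF x x y that] by simp
  show "(x \<odot> (x \<odot> y)) \<bullet> v = ((x \<bullet> x) *\<^sub>R y) \<bullet> v" if "v \<in> V3" for v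
    unfolding * using mixed_211[OF x y that] that y by (simp add: od_orth)
qed

lemma P1_mul_2_12:
  assumes x: "x \<in> V1" and y: "y \<in> V2"
  shows "P1 (y \<odot> (x \<odot> y)) = (y \<bullet> y) *\<^sub>R x"
proof (rule od_eqI)
  show "P1 (y \<odot> (x \<odot> y)) \<bullet> v = ((y \<bullet> y) *\<^sub>R x) \<bullet> v" if "v \<in> V1" for v
  proof -
    have "(y \<odot> (x \<odot> y)) \<bullet> v = (x \<odot> y) \<bullet> (v \<odot> y)" by (metis mul_inner mul_commute)
    then show ?thesis using that norm_mul_12_V1[OF x that y y] by simp
  qed
qed (use x P_in(1) od_orth in simp_all)

lemma mixed_121_polar:
  assumes x: "x \<in> V1" and y: "y \<in> V2" "y' \<in> V2" and z: "z \<in> V3"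
  shows "(x \<odot> y) \<bullet> (y' \<odot> z) + (x \<odot> y') \<bullet> (y \<odot> z) = -2 * (P2 (y \<odot> y') \<bullet> (x \<odot> z))"
proof -
  have *: "2 * (P2 (u \<odot> u) \<bullet> (x \<odot> z)) + 2 * ((x \<odot> u) \<bullet> (u \<odot> z)) = 0" if "u \<in> V2" for u
    using mixed_121[OF x that z] by (simp add: proj_symmetric[of V2 "u \<odot> u"])
  have "2 * (P2 (y \<odot> y') \<bullet> (x \<odot> z)) + ((x \<odot> y) \<bullet> (y' \<odot> z) + (x \<odot> y') \<bullet> (y \<odot> z)) = 0"
    by (rule polarize2[where V = V2 and B = "\<lambda>u v. 2 * (P2 (u \<odot> v) \<bullet> (x \<odot> z)) + ((x \<odot> u) \<bullet> (v \<odot> z) + (x \<odot> v) \<bullet> (u \<odot> z))"])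
      (use * in \<open>simp_all add: lin sub2 y mul_commute algebra_simps\<close>)
  then show ?thesis by simp
qed

lemma norm_mul_13_polar:
  assumes x: "x \<in> V1" and z: "z \<in> V3" "z' \<in> V3"
  shows "3 * (P2 (x \<odot> z) \<bullet> P2 (x \<odot> z')) + P3 (x \<odot> z) \<bullet> P3 (x \<odot> z') = 3 * (x \<bullet> x) * (z \<bullet> z')"
proof -
  have "3 * (P2 (x \<odot> z) \<bullet> P2 (x \<odot> z')) + P3 (x \<odot> z) \<bullet> P3 (x \<odot> z') - 3 * (x \<bullet> x) * (z \<bullet> z') = 0"
    by (rule polarize2[where V = V3 and B = "\<lambda>u v. 3 * (P2 (x \<odot> u) \<bullet> P2 (x \<odot> v)) + P3 (x \<odot> u) \<bullet> P3 (x \<odot> v) - 3 * (x \<bullet> x) * (u \<bullet> v)"])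
      (use norm_mul_13[OF x] in \<open>simp_all add: lin sub3 z inner_commute algebra_simps\<close>)
  then show ?thesis by simp
qed

lemma norm_mul_23_polar:
  assumes y: "y \<in> V2" "y' \<in> V2" and z: "z \<in> V3" "z' \<in> V3"
  shows norm_mul_23_V3: "P3 (y \<odot> z) \<bullet> P3 (y \<odot> z') = (y \<bullet> y) * (z \<bullet> z') + 2 * (P1 (y \<odot> z) \<bullet> P1 (y \<odot> z'))
      + 1/2 * (P2 (y \<odot> y) \<bullet> (z \<odot> z'))"
    and norm_mul_23_V2: "P3 (y \<odot> z) \<bullet> P3 (y' \<odot> z) = (y \<bullet> y') * (z \<bullet> z) + 2 * (P1 (y \<odot> z) \<bullet> P1 (y' \<odot> z))
      + 1/2 * (P2 (y \<odot> y') \<bullet> (z \<odot> z))"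
proof -
  have *: "P3 (u \<odot> v) \<bullet> P3 (u \<odot> v) = (u \<bullet> u) * (v \<bullet> v) + 2 * (P1 (u \<odot> v) \<bullet> P1 (u \<odot> v))
      + 1/2 * (P2 (u \<odot> u) \<bullet> (v \<odot> v))" if "u \<in> V2" "v \<in> V3" for u v
    using norm_mul_23[OF that] by (simp add: proj_symmetric[of V2 "u \<odot> u"])
  have "P3 (y \<odot> z) \<bullet> P3 (y \<odot> z') - (y \<bullet> y) * (z \<bullet> z') - 2 * (P1 (y \<odot> z) \<bullet> P1 (y \<odot> z'))
      - 1/2 * (P2 (y \<odot> y) \<bullet> (z \<odot> z')) = 0"
    by (rule polarize2[where V = V3 and B = "\<lambda>z z'. P3 (y \<odot> z) \<bullet> P3 (y \<odot> z') - (y \<bullet> y) * (z \<bullet> z')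
        - 2 * (P1 (y \<odot> z) \<bullet> P1 (y \<odot> z')) - 1/2 * (P2 (y \<odot> y) \<bullet> (z \<odot> z'))"])
      (use *[OF y(1)] in \<open>simp_all add: lin sub3 z inner_commute mul_commute algebra_simps\<close>)
  then show "P3 (y \<odot> z) \<bullet> P3 (y \<odot> z') = (y \<bullet> y) * (z \<bullet> z') + 2 * (P1 (y \<odot> z) \<bullet> P1 (y \<odot> z'))
      + 1/2 * (P2 (y \<odot> y) \<bullet> (z \<odot> z'))" by simp
  have "P3 (y \<odot> z) \<bullet> P3 (y' \<odot> z) - (y \<bullet> y') * (z \<bullet> z) - 2 * (P1 (y \<odot> z) \<bullet> P1 (y' \<odot> z))
      - 1/2 * (P2 (y \<odot> y') \<bullet> (z \<odot> z)) = 0"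
    by (rule polarize2[where V = V2 and B = "\<lambda>y y'. P3 (y \<odot> z) \<bullet> P3 (y' \<odot> z) - (y \<bullet> y') * (z \<bullet> z)
        - 2 * (P1 (y \<odot> z) \<bullet> P1 (y' \<odot> z)) - 1/2 * (P2 (y \<odot> y') \<bullet> (z \<odot> z))"])
      (use *[OF _ z(1)] in \<open>simp_all add: lin sub2 y inner_commute mul_commute algebra_simps\<close>)
  then show "P3 (y \<odot> z) \<bullet> P3 (y' \<odot> z) = (y \<bullet> y') * (z \<bullet> z) + 2 * (P1 (y \<odot> z) \<bullet> P1 (y' \<odot> z))
      + 1/2 * (P2 (y \<odot> y') \<bullet> (z \<odot> z))" by simp
qed

section \<open>The commutative product on \<open>V2\<close> and its cubic identity\<close>

definition m :: "'a \<Rightarrow> 'a \<Rightarrow> 'a" where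
  "m y y' = P2 (y \<odot> y')"

lemma m_in [simp]: "m y y' \<in> V2" by (simp add: m_def)

lemma m_commute: "m y y' = m y' y" by (simp add: m_def mul_commute)

lemma m_linear: "m (a + b) c = m a c + m b c" "m c (a + b) = m c a + m c b"
  "m (r *\<^sub>R a) c = r *\<^sub>R m a c" "m c (r *\<^sub>R a) = r *\<^sub>R m c a"
  by (simp_all add: m_def mul_linear proj_add proj_scale)

lemma m_inner: "a \<in> V2 \<Longrightarrow> c \<in> V2 \<Longrightarrow> m a b \<bullet> c = a \<bullet> m b c"
  unfolding m_def using mul_inner by (metis P_inner(2) inner_commute)

lemma norm_m_polar:
  assumes y: "y \<in> V2" and v: "v \<in> V2"
  shows norm_m_1: "m y v \<bullet> m y y = 2 * (y \<bullet> y) * (y \<bullet> v)"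
    and norm_m_2: "2 * (m y v \<bullet> m y v) + m y y \<bullet> m v v = 2 * (y \<bullet> y) * (v \<bullet> v) + 4 * (y \<bullet> v)^2"
proof -
  have eq0: "0 + (4 * (m y v \<bullet> m y y) - 8 * (y \<bullet> y) * (y \<bullet> v)) * s
      + (4 * (m y v \<bullet> m y v) + 2 * (m y y \<bullet> m v v) - 4 * (y \<bullet> y) * (v \<bullet> v) - 8 * (y \<bullet> v)^2) * s^2
      + (4 * (m y v \<bullet> m v v) - 8 * (v \<bullet> v) * (y \<bullet> v)) * s^3 + 0 * s^4 + 0 * s^5 = 0" for s
  proof -
    have in2: "y + s *\<^sub>R v \<in> V2" using y v by (simp add: sub_closed)
    have n: "(y + s *\<^sub>R v) \<bullet> (y + s *\<^sub>R v) = y \<bullet> y + 2 * s * (y \<bullet> v) + s^2 * (v \<bullet> v)"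
      by (simp add: inner_linear inner_commute[of v y] power2_eq_square algebra_simps)
    have q: "m (y + s *\<^sub>R v) (y + s *\<^sub>R v) = m y y + (2 * s) *\<^sub>R m y v + s^2 *\<^sub>R m v v"
    proof -
      have "(2 * s) *\<^sub>R m y v = s *\<^sub>R m y v + s *\<^sub>R m y v" by (simp flip: scaleR_add_left)
      then show ?thesis
        by (simp add: m_linear m_commute[of v y] power2_eq_square scaleR_add_right)
    qed
    have qq: "m (y + s *\<^sub>R v) (y + s *\<^sub>R v) \<bullet> m (y + s *\<^sub>R v) (y + s *\<^sub>R v)
      = m y y \<bullet> m y y + 4 * s * (m y v \<bullet> m y y) + s^2 * (4 * (m y v \<bullet> m y v) + 2 * (m y y \<bullet> m v v))
       + s^3 * (4 * (m y v \<bullet> m v v)) + s^4 * (m v v \<bullet> m v v)"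
      unfolding q
      by (simp add: inner_linear inner_commute[of "m y y" "m y v"] inner_commute[of "m v v" "m y v"]
        inner_commute[of "m v v" "m y y"] power2_eq_square power3_eq_cube power4_eq_xxxx algebra_simps)
    have N: "m u u \<bullet> m u u = 2 * (u \<bullet> u)^2" if "u \<in> V2" for u
      using norm_mul_22[OF zero_in(1) that] by (simp add: m_def)
    show ?thesis using N[OF in2] N[OF y] N[OF v] unfolding qq n by algebra
  qed
  show "m y v \<bullet> m y y = 2 * (y \<bullet> y) * (y \<bullet> v)"
    using poly5_coeffs_zero(2)[OF eq0] by simp
  show "2 * (m y v \<bullet> m y v) + m y y \<bullet> m v v = 2 * (y \<bullet> y) * (v \<bullet> v) + 4 * (y \<bullet> v)^2"
    using poly5_coeffs_zero(3)[OF eq0] by simp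
qed

text \<open>This is the differentiated eikonal equation: the first polar coefficient of
  \<open>norm_mul_22\<close>, rearranged by invariance of the inner product. Its full linearisation
  \<open>m_cubic\<close> is what the traces of \<open>m\<close> contract.\<close>

lemma m_self:
  assumes y: "y \<in> V2"
  shows "m y (m y y) = (2 * (y \<bullet> y)) *\<^sub>R y"
proof (rule od_eqI)
  show "m y (m y y) \<bullet> v = ((2 * (y \<bullet> y)) *\<^sub>R y) \<bullet> v" if "v \<in> V2" for v
  proof -
    have "m y (m y y) \<bullet> v = m y v \<bullet> m y y"
      using m_inner[of "m y y" v y] that by (simp add: m_commute inner_commute)
    then show ?thesis using norm_m_1[OF y that] by simp
  qed
qed (use y m_in od_orth in simp_all)

lemma m_cubic:
  assumes a: "a \<in> V2" "b \<in> V2" "c \<in> V2"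
  shows "m a (m b c) + m b (m a c) + m c (m a b) =
    2 *\<^sub>R ((a \<bullet> b) *\<^sub>R c + (a \<bullet> c) *\<^sub>R b + (b \<bullet> c) *\<^sub>R a)"
proof -
  have "(m a (m b c) + m b (m a c) + m c (m a b) -
    2 *\<^sub>R ((a \<bullet> b) *\<^sub>R c + (a \<bullet> c) *\<^sub>R b + (b \<bullet> c) *\<^sub>R a)) \<bullet> v = 0" for v
  proof (rule polarize3[where V = V2 and S = "\<lambda>a b c. (m a (m b c) + m b (m a c) + m c (m a b) -
    2 *\<^sub>R ((a \<bullet> b) *\<^sub>R c + (a \<bullet> c) *\<^sub>R b + (b \<bullet> c) *\<^sub>R a)) \<bullet> v"])
    show "linear (\<lambda>c. (m a (m b c) + m b (m a c) + m c (m a b) -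
      2 *\<^sub>R ((a \<bullet> b) *\<^sub>R c + (a \<bullet> c) *\<^sub>R b + (b \<bullet> c) *\<^sub>R a)) \<bullet> v)" for a b
      by (simp add: linear_iff m_linear inner_linear algebra_simps)
  qed (simp_all add: sub2 a m_commute inner_commute m_self inner_linear algebra_simps)
  then show ?thesis by (metis inner_eq_zero_iff eq_iff_diff_eq_0)
qed

section \<open>The trace vector of the product on the second summand\<close>

text \<open>For \<open>y\<close> in \<open>V2\<close>, \<open>w \<bullet> y\<close> is the trace of
  \<open>m y\<close> on \<open>V2\<close>, hence one sixth of the Laplacian of the cubic
  \<open>m y y \<bullet> y\<close> there; \<open>w\<close> vanishes exactly when that cubic is
  harmonic.\<close>

definition w :: 'a where
  "w = (\<Sum>b\<in>Bas V2. m b b)"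

lemma w_in [simp]: "w \<in> V2"
  unfolding w_def by (rule subspace_sum[OF sub2]) simp

lemma w_inner: "y \<in> V2 \<Longrightarrow> w \<bullet> y = (\<Sum>b\<in>Bas V2. (y \<odot> b) \<bullet> b)"
  unfolding w_def inner_sum_left
  by (rule sum.cong[OF refl]) (simp add: m_def trilinear_rotate[of _ _ y] mul_commute)

text \<open>Two linear relations determine the two pairings. Their sum comes from
  \<open>mixed_121_polar\<close> at \<open>m y y\<close> and \<open>y\<close>, simplified by
  \<open>m_self\<close>; the other relation is \<open>norm_mul_23_V3\<close> applied to
  \<open>x \<odot> y\<close> and \<open>z\<close>.\<close>

lemma mixed_131:
  assumes x: "x \<in> V1" and y: "y \<in> V2" and z: "z \<in> V3"
  shows "(x \<odot> m y y) \<bullet> (y \<odot> z) = -2 * (y \<bullet> y) * (y \<bullet> (x \<odot> z))"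
    and "(x \<odot> y) \<bullet> (m y y \<odot> z) = -2 * (y \<bullet> y) * (y \<bullet> (x \<odot> z))"
proof -
  have p: "x \<odot> y \<in> V3" by (rule mul_12_in[OF x y])
  have 1: "(x \<odot> m y y) \<bullet> (y \<odot> z) + (x \<odot> y) \<bullet> (m y y \<odot> z) = -4 * (y \<bullet> y) * (y \<bullet> (x \<odot> z))"
    using mixed_121_polar[OF x m_in y z, of y y] m_self[OF y]
    by (simp add: m_commute[of "m y y" y] flip: m_def)
  \<comment> \<open>This is \<open>mixed_121_polar\<close> with both elements of \<open>V2\<close>
    equal to \<open>y\<close>, read as a formula for a component in \<open>V3\<close>.\<close>
  have yp: "P3 (y \<odot> (x \<odot> y)) = - (x \<odot> m y y)"
  proof (rule od_eqI)
    show "P3 (y \<odot> (x \<odot> y)) \<bullet> v = - (x \<odot> m y y) \<bullet> v" if v: "v \<in> V3" for v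
    proof -
      have "(y \<odot> (x \<odot> y)) \<bullet> v = (x \<odot> y) \<bullet> (y \<odot> v)" by (metis mul_inner mul_commute)
      also have "\<dots> = - (m y y \<bullet> (x \<odot> v))" using mixed_121_polar[OF x y y v] by (simp add: m_def)
      also have "\<dots> = - ((x \<odot> m y y) \<bullet> v)" by (metis mul_inner mul_commute)
      finally show ?thesis using v by simp
    qed
  qed (use mul_12_in[OF x m_in] od_orth P_in(3) in simp_all)
  have "P3 (y \<odot> (x \<odot> y)) \<bullet> P3 (y \<odot> z) = (y \<bullet> y) * ((x \<odot> y) \<bullet> z) + 2 * (P1 (y \<odot> (x \<odot> y)) \<bullet> P1 (y \<odot> z))
      + 1/2 * (P2 (y \<odot> y) \<bullet> ((x \<odot> y) \<odot> z))"
    by (rule norm_mul_23_V3[OF y y p z])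
  moreover have "P3 (y \<odot> (x \<odot> y)) \<bullet> P3 (y \<odot> z) = - ((x \<odot> m y y) \<bullet> (y \<odot> z))"
    unfolding yp using mul_12_in[OF x m_in] by (simp add: inner_commute[of _ "P3 (y \<odot> z)"] inner_commute[of "y \<odot> z"])
  moreover have "(x \<odot> y) \<bullet> z = y \<bullet> (x \<odot> z)" "x \<bullet> (y \<odot> z) = y \<bullet> (x \<odot> z)"
    by (metis mul_inner mul_commute)+
  moreover have "P1 (y \<odot> (x \<odot> y)) \<bullet> P1 (y \<odot> z) = (y \<bullet> y) * (x \<bullet> (y \<odot> z))"
    unfolding P1_mul_2_12[OF x y] using x by (simp add: proj_inner' sub1)
  moreover have "P2 (y \<odot> y) \<bullet> ((x \<odot> y) \<odot> z) = (x \<odot> y) \<bullet> (m y y \<odot> z)"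
    unfolding m_def by (metis mul_inner mul_commute)
  ultimately have 2: "- ((x \<odot> m y y) \<bullet> (y \<odot> z)) = 3 * ((y \<bullet> y) * (y \<bullet> (x \<odot> z)))
      + 1/2 * ((x \<odot> y) \<bullet> (m y y \<odot> z))"
    by simp
  show "(x \<odot> m y y) \<bullet> (y \<odot> z) = -2 * (y \<bullet> y) * (y \<bullet> (x \<odot> z))"
    "(x \<odot> y) \<bullet> (m y y \<odot> z) = -2 * (y \<bullet> y) * (y \<bullet> (x \<odot> z))"
    using 1 2 by simp_all
qed

text \<open>The hypothesis \<open>diag\<close> is cubic in \<open>y\<close>. Its polarisation with
  two arguments equal to \<open>b\<close>, summed over the basis, contracts \<open>m b b\<close> to
  \<open>w\<close>; of the factor \<open>dim V2 + 2\<close>, the dimension is the sum of the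
  \<open>b \<bullet> b\<close> and the 2 comes from the two cross terms
  \<open>(y \<bullet> b) * k b\<close>.\<close>

lemma trace_polar:
  fixes f :: "'a \<Rightarrow> 'a \<Rightarrow> real" and k :: "'a \<Rightarrow> real"
  assumes f: "\<And>y. linear (\<lambda>x. f x y)" "\<And>x. linear (f x)" and k: "linear k"
    and diag: "\<And>y. y \<in> V2 \<Longrightarrow> f (m y y) y = -2 * (y \<bullet> y) * k y"
    and y: "y \<in> V2"
  shows "f w y + 2 * (\<Sum>b\<in>Bas V2. f (m y b) b) = -2 * (real (dim V2) + 2) * k y"
proof -
  have fs: "f (u + v) x = f u x + f v x" "f (r *\<^sub>R u) x = r * f u x"
    "f x (u + v) = f x u + f x v" "f x (r *\<^sub>R u) = r * f x u"
    "k (u + v) = k u + k v" "k (r *\<^sub>R u) = r * k u" for u v x r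
    using f(1)[of x] f(2)[of x] k by (simp_all add: linear_iff)
  have P: "f (m a b) c + f (m a c) b + f (m b c) a
      + 2 * ((a \<bullet> b) * k c + (a \<bullet> c) * k b + (b \<bullet> c) * k a) = 0"
    if "a \<in> V2" "b \<in> V2" "c \<in> V2" for a b c
    by (rule polarize3[where V = V2 and S = "\<lambda>a b c. f (m a b) c + f (m a c) b + f (m b c) a
      + 2 * ((a \<bullet> b) * k c + (a \<bullet> c) * k b + (b \<bullet> c) * k a)"])
      (use that diag in \<open>simp_all add: linear_iff fs m_linear inner_linear sub2 m_commute inner_commute algebra_simps\<close>)
  have "(\<Sum>b\<in>Bas V2. f (m b b) y + 2 * f (m y b) b + 2 * ((b \<bullet> b) * k y + 2 * ((y \<bullet> b) * k b))) = (\<Sum>b\<in>Bas V2. 0)"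
  proof (rule sum.cong[OF refl])
    fix b assume "b \<in> Bas V2"
    then have b: "b \<in> V2" by (rule Bas_in[OF sub2])
    show "f (m b b) y + 2 * f (m y b) b + 2 * ((b \<bullet> b) * k y + 2 * ((y \<bullet> b) * k b)) = 0"
      using P[OF b b y] by (simp add: m_commute[of b y] inner_commute[of b y] algebra_simps)
  qed
  then have "(\<Sum>b\<in>Bas V2. f (m b b) y) + 2 * (\<Sum>b\<in>Bas V2. f (m y b) b)
      + 2 * ((\<Sum>b\<in>Bas V2. b \<bullet> b) * k y + 2 * (\<Sum>b\<in>Bas V2. (y \<bullet> b) * k b)) = 0"
    by (simp add: sum.distrib sum_distrib_left sum_distrib_right)
  moreover have "(\<Sum>b\<in>Bas V2. f (m b b) y) = f w y"
    unfolding w_def by (simp add: linear_sum[OF f(1)])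
  moreover have "(\<Sum>b\<in>Bas V2. (y \<bullet> b) * k b) = k y"
    by (rule expand_Bas_real[OF sub2 k y])
  ultimately show ?thesis by (simp add: sum_Bas_norm[OF sub2] algebra_simps)
qed

text \<open>
  Both cubic identities of \<open>mixed_131\<close>, traced over \<open>V2\<close>; the two trace terms agree because
  \<open>m y\<close> is symmetric.
\<close>

lemma w_swap:
  assumes x: "x \<in> V1" and y: "y \<in> V2" and z: "z \<in> V3"
  shows "(x \<odot> w) \<bullet> (y \<odot> z) = (x \<odot> y) \<bullet> (w \<odot> z)"
proof -
  define f where "f a b = (x \<odot> a) \<bullet> (b \<odot> z)" for a b
  have fl: "linear (\<lambda>a. f a b)" "linear (f a)" for a b
    unfolding f_def by (simp_all add: lin)
  have k: "linear (\<lambda>y. y \<bullet> (x \<odot> z))" by (simp add: lin)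
  have "f w y + 2 * (\<Sum>b\<in>Bas V2. f (m y b) b) = -2 * (real (dim V2) + 2) * (y \<bullet> (x \<odot> z))"
    by (rule trace_polar[OF fl k _ y]) (simp add: f_def mixed_131 x z)
  moreover have "f y w + 2 * (\<Sum>b\<in>Bas V2. f b (m y b)) = -2 * (real (dim V2) + 2) * (y \<bullet> (x \<odot> z))"
    by (rule trace_polar[OF fl(2) fl(1) k _ y]) (simp add: f_def mixed_131 x z)
  moreover have "(\<Sum>b\<in>Bas V2. f (m y b) b) = (\<Sum>b\<in>Bas V2. f b (m y b))"
    by (rule sum_Bas_adjoint[OF fl sub2 sub2]) (simp_all add: m_commute m_inner)
  ultimately show ?thesis unfolding f_def by simp
qed

text \<open>Contract two arguments of \<open>m_cubic\<close> over an orthonormal basis.\<close>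

lemma sum_m_sq:
  assumes c: "c \<in> V2"
  shows "(\<Sum>b\<in>Bas V2. m b (m b c)) = (real (dim V2) + 2) *\<^sub>R c - (1/2) *\<^sub>R m c w"
proof -
  have "(\<Sum>b\<in>Bas V2. 2 *\<^sub>R m b (m b c) + m c (m b b)) = (\<Sum>b\<in>Bas V2. 2 *\<^sub>R ((b \<bullet> b) *\<^sub>R c + 2 *\<^sub>R ((c \<bullet> b) *\<^sub>R b)))"
  proof (rule sum.cong[OF refl])
    fix b assume "b \<in> Bas V2"
    then have b: "b \<in> V2" by (rule Bas_in[OF sub2])
    show "2 *\<^sub>R m b (m b c) + m c (m b b) = 2 *\<^sub>R ((b \<bullet> b) *\<^sub>R c + 2 *\<^sub>R ((c \<bullet> b) *\<^sub>R b))"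
      using m_cubic[OF b b c]
      by (simp add: inner_commute[of b c] scaleR_2 algebra_simps) (simp flip: scaleR_add_left)
  qed
  then have "2 *\<^sub>R (\<Sum>b\<in>Bas V2. m b (m b c)) + (\<Sum>b\<in>Bas V2. m c (m b b))
     = 2 *\<^sub>R ((\<Sum>b\<in>Bas V2. b \<bullet> b) *\<^sub>R c + 2 *\<^sub>R (\<Sum>b\<in>Bas V2. (c \<bullet> b) *\<^sub>R b))"
    by (simp only: sum.distrib scaleR_sum_right[symmetric] scaleR_sum_left[symmetric])
  moreover have "(\<Sum>b\<in>Bas V2. m c (m b b)) = m c w"
  proof -
    have "linear (m c)" by (simp add: linear_iff m_linear)
    then show ?thesis unfolding w_def by (simp add: linear_sum)
  qed
  moreover have "(\<Sum>b\<in>Bas V2. (c \<bullet> b) *\<^sub>R b) = c"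
    using c proj_id[OF sub2] unfolding proj_def by simp
  ultimately have "2 *\<^sub>R (\<Sum>b\<in>Bas V2. m b (m b c)) + m c w = 2 *\<^sub>R ((real (dim V2) + 2) *\<^sub>R c)"
    by (simp add: sum_Bas_norm[OF sub2] scaleR_add_left)
  then have "(1/2) *\<^sub>R (2 *\<^sub>R (\<Sum>b\<in>Bas V2. m b (m b c)) + m c w) = (real (dim V2) + 2) *\<^sub>R c" by simp
  then show ?thesis by (simp add: scaleR_add_right eq_diff_eq)
qed

text \<open>The double contraction \<open>tau\<close> is evaluated twice. Summing first over
  \<open>i\<close> with \<open>sum_m_sq\<close> expresses it by \<open>w \<bullet> c\<close> and
  \<open>m w w \<bullet> c\<close>. Pairing \<open>m_cubic\<close> at \<open>i\<close>,
  \<open>c\<close>, \<open>j\<close> with \<open>m i j\<close> and summing turns all three left-hand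
  terms into \<open>tau\<close> and all three right-hand terms into multiples of
  \<open>w \<bullet> c\<close>, so \<open>tau = 2 * (w \<bullet> c)\<close>.\<close>

lemma mul_ww: "m w w = (4 - 2 * real (dim V2)) *\<^sub>R w"
proof -
  let ?n = "real (dim V2)" and ?B = "Bas V2"
  have key: "m w w \<bullet> c = ((4 - 2 * ?n) *\<^sub>R w) \<bullet> c" if c: "c \<in> V2" for c
  proof -
    have B: "b \<in> V2" if "b \<in> ?B" for b using Bas_in[OF sub2 that] .
    define tau where "tau = (\<Sum>j\<in>?B. \<Sum>i\<in>?B. m c j \<bullet> m i (m i j))"
    have wc: "(\<Sum>j\<in>?B. m c j \<bullet> j) = w \<bullet> c"
      unfolding w_def inner_sum_left
      by (intro sum.cong refl) (metis m_inner B c m_commute inner_commute)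
    have "tau = (\<Sum>j\<in>?B. m c j \<bullet> ((?n + 2) *\<^sub>R j - (1/2) *\<^sub>R m j w))"
      unfolding tau_def by (intro sum.cong refl) (simp flip: inner_sum_right add: sum_m_sq B)
    also have "\<dots> = (?n + 2) * (\<Sum>j\<in>?B. m c j \<bullet> j) - 1/2 * (\<Sum>j\<in>?B. m c j \<bullet> m j w)"
      by (simp add: inner_linear sum_subtractf sum_distrib_left)
    also have "(\<Sum>j\<in>?B. m c j \<bullet> m j w) = c \<bullet> (\<Sum>j\<in>?B. m j (m j w))"
      unfolding inner_sum_right by (intro sum.cong refl) (simp add: m_inner c B)
    also have "\<dots> = (?n + 2) * (w \<bullet> c) - 1/2 * (m w w \<bullet> c)"
      unfolding sum_m_sq[OF w_in] by (simp add: inner_linear inner_commute)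
    finally have 1: "tau = (?n + 2) * (w \<bullet> c) - 1/2 * ((?n + 2) * (w \<bullet> c) - 1/2 * (m w w \<bullet> c))"
      unfolding wc .
    have "(\<Sum>j\<in>?B. \<Sum>i\<in>?B. m i (m c j) \<bullet> m i j + m c (m i j) \<bullet> m i j + m j (m i c) \<bullet> m i j)
      = (\<Sum>j\<in>?B. \<Sum>i\<in>?B. 2 * ((c \<bullet> i) * (m j i \<bullet> j) + (i \<bullet> j) * (m i j \<bullet> c) + (c \<bullet> j) * (m i j \<bullet> i)))"
    proof (intro sum.cong refl)
      fix i j assume ij: "j \<in> ?B" "i \<in> ?B"
      have "(m i (m c j) + m c (m i j) + m j (m i c)) \<bullet> m i j
         = (2 *\<^sub>R ((i \<bullet> c) *\<^sub>R j + (i \<bullet> j) *\<^sub>R c + (c \<bullet> j) *\<^sub>R i)) \<bullet> m i j"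
        using m_cubic[OF B[OF ij(2)] c B[OF ij(1)]] by simp
      then show "m i (m c j) \<bullet> m i j + m c (m i j) \<bullet> m i j + m j (m i c) \<bullet> m i j
        = 2 * ((c \<bullet> i) * (m j i \<bullet> j) + (i \<bullet> j) * (m i j \<bullet> c) + (c \<bullet> j) * (m i j \<bullet> i))"
        by (simp add: inner_linear inner_commute m_commute)
    qed
    then have S: "(\<Sum>j\<in>?B. \<Sum>i\<in>?B. m i (m c j) \<bullet> m i j) + (\<Sum>j\<in>?B. \<Sum>i\<in>?B. m c (m i j) \<bullet> m i j)
        + (\<Sum>j\<in>?B. \<Sum>i\<in>?B. m j (m i c) \<bullet> m i j)
      = 2 * ((\<Sum>j\<in>?B. \<Sum>i\<in>?B. (c \<bullet> i) * (m j i \<bullet> j)) + (\<Sum>j\<in>?B. \<Sum>i\<in>?B. (i \<bullet> j) * (m i j \<bullet> c))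
        + (\<Sum>j\<in>?B. \<Sum>i\<in>?B. (c \<bullet> j) * (m i j \<bullet> i)))"
      by (simp only: sum.distrib sum_distrib_left[symmetric])
    have a1: "(\<Sum>j\<in>?B. \<Sum>i\<in>?B. m i (m c j) \<bullet> m i j) = tau"
      unfolding tau_def by (intro sum.cong refl) (metis m_inner m_in m_commute B inner_commute)
    have a3: "(\<Sum>j\<in>?B. \<Sum>i\<in>?B. m j (m i c) \<bullet> m i j) = tau"
      unfolding a1[symmetric] by (subst sum.swap) (simp add: m_commute)
    \<comment> \<open>Self-adjointness of \<open>m j\<close> carries it across the trace over
      \<open>i\<close>; after that only the order of summation differs from
      \<open>tau\<close>.\<close>
    have a2: "(\<Sum>j\<in>?B. \<Sum>i\<in>?B. m c (m i j) \<bullet> m i j) = tau"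
    proof -
      have "(\<Sum>i\<in>?B. m c (m i j) \<bullet> m i j) = (\<Sum>i\<in>?B. m c i \<bullet> m j (m j i))" if j: "j \<in> ?B" for j
      proof -
        have "(\<Sum>i\<in>?B. m c (m j i) \<bullet> m j i) = (\<Sum>i\<in>?B. m c i \<bullet> m j (m j i))"
          by (rule sum_Bas_adjoint[where g = "\<lambda>u v. m c u \<bullet> m j v", OF _ _ sub2 sub2])
            (simp_all add: linear_iff m_linear inner_linear m_inner B[OF j] m_commute[of j])
        then show ?thesis by (simp add: m_commute[of j])
      qed
      then have "(\<Sum>j\<in>?B. \<Sum>i\<in>?B. m c (m i j) \<bullet> m i j) = (\<Sum>j\<in>?B. \<Sum>i\<in>?B. m c i \<bullet> m j (m j i))" by simp
      also have "\<dots> = tau" unfolding tau_def by (rule sum.swap)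
      finally show ?thesis .
    qed
    have r1: "(\<Sum>j\<in>?B. \<Sum>i\<in>?B. (c \<bullet> i) * (m j i \<bullet> j)) = w \<bullet> c"
    proof -
      have "(\<Sum>i\<in>?B. (c \<bullet> i) * (m j i \<bullet> j)) = m c j \<bullet> j" for j
        using expand_Bas_real[OF sub2 _ c, of "\<lambda>i. m j i \<bullet> j"]
        by (simp add: linear_iff m_linear inner_linear m_commute)
      then show ?thesis by (simp add: wc)
    qed
    have r3: "(\<Sum>j\<in>?B. \<Sum>i\<in>?B. (c \<bullet> j) * (m i j \<bullet> i)) = w \<bullet> c"
      by (subst sum.swap) (rule r1)
    have r2: "(\<Sum>j\<in>?B. \<Sum>i\<in>?B. (i \<bullet> j) * (m i j \<bullet> c)) = w \<bullet> c"
    proof -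
      have "(\<Sum>i\<in>?B. (i \<bullet> j) * (m i j \<bullet> c)) = m j j \<bullet> c" if "j \<in> ?B" for j
        using expand_Bas_real[OF sub2 _ B[OF that], of "\<lambda>i. m i j \<bullet> c"]
        by (simp add: linear_iff m_linear inner_linear inner_commute)
      then show ?thesis by (simp add: w_def inner_sum_left)
    qed
    have "3 * tau = 6 * (w \<bullet> c)" using S unfolding a1 a2 a3 r1 r2 r3 by simp
    then show ?thesis using 1 by (simp add: algebra_simps)
  qed
  show ?thesis
    by (rule od_eqI) (use key m_in w_in od_orth in simp_all)
qed

section \<open>The elements of \<open>V3\<close> that \<open>V1\<close> does not send into
  \<open>V2\<close>\<close>

lemma mul_1_kernel:
  assumes x: "x \<in> V1" and z: "z \<in> V3" and k: "P2 (x \<odot> z) = 0"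
  shows mul_1_kernel_in: "x \<odot> z \<in> V3"
    and mul_1_1_kernel: "x \<odot> (x \<odot> z) = (3 * (x \<bullet> x)) *\<^sub>R z"
proof -
  have n: "x \<odot> z = P3 (x \<odot> z)" using mul_13[OF x z] k by simp
  then show in3: "x \<odot> z \<in> V3" by (metis P_in(3))
  have *: "(x \<odot> (x \<odot> z)) \<bullet> v = (x \<odot> z) \<bullet> (x \<odot> v)" for v
    by (metis mul_inner mul_commute)
  show "x \<odot> (x \<odot> z) = (3 * (x \<bullet> x)) *\<^sub>R z"
  proof (rule od_eqI)
    show "(x \<odot> (x \<odot> z)) \<bullet> e = ((3 * (x \<bullet> x)) *\<^sub>R z) \<bullet> e"
      by (simp add: perp_products x in3 od_orth z)
    show "(x \<odot> (x \<odot> z)) \<bullet> v = ((3 * (x \<bullet> x)) *\<^sub>R z) \<bullet> v" if "v \<in> V1" for v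
      using that x in3 z by (simp add: T_perm od_orth)
    show "(x \<odot> (x \<odot> z)) \<bullet> v = ((3 * (x \<bullet> x)) *\<^sub>R z) \<bullet> v" if "v \<in> V2" for v
      unfolding * using mixed_211[OF x that z] that z by (simp add: od_orth inner_commute)
    \<comment> \<open>Because \<open>x \<odot> z\<close> has no part in \<open>V2\<close>, the first
      term of \<open>norm_mul_13_polar\<close> drops out and the factor 3 remains.\<close>
    show "(x \<odot> (x \<odot> z)) \<bullet> v = ((3 * (x \<bullet> x)) *\<^sub>R z) \<bullet> v" if "v \<in> V3" for v
    proof -
      have "(x \<odot> z) \<bullet> P3 (x \<odot> v) = (x \<odot> z) \<bullet> (x \<odot> v)" by (rule proj_inner'[OF sub3 in3])
      then show ?thesis unfolding * using norm_mul_13_polar[OF x z that] k n by simp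
    qed
  qed
qed

text \<open>
  The \<open>y\<close>-component of the gradient of \<open>quintic\<close> at \<open>x + s z\<close>, to second order in \<open>s\<close>.
\<close>

lemma mixed_212_kernel:
  assumes x: "x \<in> V1" and y: "y \<in> V2" and z: "z \<in> V3" and k: "P2 (x \<odot> z) = 0"
  shows "(y \<odot> (x \<odot> z)) \<bullet> (x \<odot> z) = -3 * (x \<bullet> x) * ((y \<odot> z) \<bullet> z)"
proof -
  define n where "n = x \<odot> z"
  define h where "h = (y \<odot> z) \<bullet> z"
  define X Z where "X = x \<bullet> x" and "Z = z \<bullet> z"
  define a b where "a = P1 (z \<odot> z)" and "b = P2 (z \<odot> z)"
  define c where "c = a + b"
  have ab: "a \<in> V1" "b \<in> V2" by (simp_all add: a_def b_def)
  have n3: "n \<in> V3" unfolding n_def by (rule mul_1_kernel_in[OF x z k])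
  have xn: "x \<odot> n = (3 * X) *\<^sub>R z" unfolding n_def X_def by (rule mul_1_1_kernel[OF x z k])
  have zz: "z \<odot> z = Z *\<^sub>R e + c" using mul_33[OF z z] unfolding Z_def c_def a_def b_def add.assoc .
  have xy3: "x \<odot> y \<in> V3" by (rule mul_12_in[OF x y])
  have p: "(x + s *\<^sub>R z) \<odot> (x + s *\<^sub>R z) = (-2 * X + s^2 * Z) *\<^sub>R e + (2 * s) *\<^sub>R n + s^2 *\<^sub>R c" for s
    unfolding square_expand zz mul_11[OF x x] n_def[symmetric] X_def[symmetric]
    by (simp add: scaleR_add_left scaleR_add_right algebra_simps)
  have o: "z \<bullet> e = 0" "e \<bullet> y = 0" "n \<bullet> y = 0" "c \<bullet> y = h" "x \<bullet> (x \<odot> y) = 0" "z \<bullet> (x \<odot> y) = 0" "x \<bullet> y = 0" "z \<bullet> y = 0"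
    "x \<bullet> (z \<odot> y) = 0" "z \<bullet> (z \<odot> y) = h"
    "(e \<odot> n) \<bullet> y = 0" "(e \<odot> c) \<bullet> y = - h" "(z \<odot> n) \<bullet> (x \<odot> y) = 0" "(x \<odot> c) \<bullet> (x \<odot> y) = X * h"
  proof -
    show "z \<bullet> e = 0" "e \<bullet> y = 0" "n \<bullet> y = 0" "x \<bullet> (x \<odot> y) = 0" "x \<bullet> y = 0" "z \<bullet> y = 0"
      using x y z n3 xy3 by (simp_all add: od_orth)
    show "(z \<odot> n) \<bullet> (x \<odot> y) = 0" using z n3 xy3 by (simp add: T333)
    show "z \<bullet> (z \<odot> y) = h" unfolding h_def by (metis mul_commute inner_commute)
    have by': "b \<bullet> y = h" unfolding b_def h_def using y by (simp add: trilinear_rotate[of z z y] mul_commute)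
    then show cy: "c \<bullet> y = h" using ab y by (simp add: c_def inner_linear od_orth)
    show "z \<bullet> (x \<odot> y) = 0" "x \<bullet> (z \<odot> y) = 0"
      using n3 y unfolding n_def by (metis mul_inner mul_commute od_orth(12))+
    show "(e \<odot> n) \<bullet> y = 0" using n3 y by (simp add: mul_e3 od_orth)
    show "(e \<odot> c) \<bullet> y = - h" using ab y by' by (simp add: c_def mul_linear mul_e1 mul_e2 inner_linear od_orth)
    have "(x \<odot> c) \<bullet> (x \<odot> y) = (x \<odot> (x \<odot> y)) \<bullet> c" by (metis mul_inner mul_commute inner_commute)
    then show "(x \<odot> c) \<bullet> (x \<odot> y) = X * h"
      using cy by (simp add: mul_1_12[OF x y] inner_commute X_def)
  qed
  \<comment> \<open>Only the coefficient of \<open>s^2\<close> is wanted; these two names collect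
    the higher coefficients so that the expansion has the shape required by
    \<open>poly5_coeffs_zero\<close>.\<close>
  define A3 A4 where "A3 = 4 * ((n \<odot> c) \<bullet> y) + 4 * ((z \<odot> c) \<bullet> (x \<odot> y) + (x \<odot> c) \<bullet> (z \<odot> y) + 2 * ((z \<odot> n) \<bullet> (z \<odot> y)))"
    and "A4 = (c \<odot> c) \<bullet> y - 2 * Z * h + 4 * (Z * h + (z \<odot> c) \<bullet> (z \<odot> y)) - 12 * Z * h"
  have eq0: "0 + 0 * s + (4 * X * h + 4 * ((n \<odot> n) \<bullet> y) + 4 * (X * h - 2 * X * h + 6 * X * h) - 12 * X * h) * s^2
     + A3 * s^3 + A4 * s^4 + 0 * s^5 = 0" for s
  proof -
    define t where "t = -2 * X + s^2 * Z"
    let ?u = "x + s *\<^sub>R z"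
    let ?p = "t *\<^sub>R e + (2 * s) *\<^sub>R n + s^2 *\<^sub>R c"
    have g: "(?p \<odot> ?p) \<bullet> y + 4 * ((?p \<odot> (?u \<odot> y)) \<bullet> ?u) = 12 * (?u \<bullet> ?u) * (?p \<bullet> y) + 8 * (?u \<bullet> y) * (?p \<bullet> ?u)"
      using quintic_1[of ?u y] unfolding p t_def[symmetric] .
    have 1: "(?p \<odot> ?p) \<bullet> y = - 2 * t * s^2 * h + 4 * s^2 * ((n \<odot> n) \<bullet> y) + 4 * s^3 * ((n \<odot> c) \<bullet> y) + s^4 * ((c \<odot> c) \<bullet> y)"
    proof -
      have "(?p \<odot> ?p) \<bullet> y = t^2 * ((e \<odot> e) \<bullet> y) + 4 * s * t * ((e \<odot> n) \<bullet> y) + 2 * t * s^2 * ((e \<odot> c) \<bullet> y)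
        + 4 * s^2 * ((n \<odot> n) \<bullet> y) + 4 * s^3 * ((n \<odot> c) \<bullet> y) + s^4 * ((c \<odot> c) \<bullet> y)"
        by (simp add: mul_linear inner_linear mul_commute[of n e] mul_commute[of c e] mul_commute[of c n]
            del: mult_minus_left) algebra
      then show ?thesis by (simp add: mul_ee o)
    qed
    have 2: "(?p \<odot> (?u \<odot> y)) \<bullet> ?u = (?u \<odot> ?p) \<bullet> (?u \<odot> y)"
      by (metis mul_inner mul_commute)
    have 3: "?u \<odot> ?p = (-2 * t) *\<^sub>R x + (s * t) *\<^sub>R z + (6 * s * X) *\<^sub>R z + s^2 *\<^sub>R (x \<odot> c)
        + (2 * s^2) *\<^sub>R (z \<odot> n) + s^3 *\<^sub>R (z \<odot> c)"
      using mul_e1[OF x] mul_e3[OF z]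
      by (simp add: mul_linear xn mul_commute[of x e] mul_commute[of z e] scaleR_add_right
          power2_eq_square power3_eq_cube algebra_simps)
    have 4: "(?u \<odot> ?p) \<bullet> (?u \<odot> y) = s^2 * X * h + s^3 * ((z \<odot> c) \<bullet> (x \<odot> y))
       + s * ((s * t) * h + 6 * s * X * h + s^2 * ((x \<odot> c) \<bullet> (z \<odot> y)) + 2 * s^2 * ((z \<odot> n) \<bullet> (z \<odot> y))
         + s^3 * ((z \<odot> c) \<bullet> (z \<odot> y)))"
      unfolding 3 by (simp add: mul_linear inner_linear o)
    have xz: "x \<bullet> z = 0" using x z by (simp add: od_orth)
    have 5: "?u \<bullet> ?u = X + s^2 * Z" "?p \<bullet> y = s^2 * h" "?u \<bullet> y = 0"
      using xz by (simp_all add: inner_linear o X_def Z_def inner_commute[of z x] power2_eq_square)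
    show ?thesis
      using g unfolding 2 4 1 5 unfolding A3_def A4_def t_def by algebra
  qed
  have "4 * ((n \<odot> n) \<bullet> y) + 12 * X * h = 0"
    using poly5_coeffs_zero(3)[OF eq0] by (simp add: algebra_simps)
  moreover have "(n \<odot> n) \<bullet> y = (y \<odot> n) \<bullet> n" by (metis trilinear_rotate)
  ultimately show ?thesis by (simp add: n_def X_def h_def)
qed

text \<open>On the kernel \<open>I\<close>, multiplication by \<open>x\<close> has square
  \<open>3 * (x \<bullet> x)\<close>, and polarising \<open>mixed_212_kernel\<close> says that
  conjugation by it reverses the sign of the compression of \<open>y\<close>. So the two anticommute
  on \<open>I\<close>. Evaluating the polar form at \<open>z\<close> and \<open>x \<odot> z\<close>
  makes the wanted pairing equal to its own negative.\<close>

lemma kernel_anti: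
  assumes x: "x \<in> V1" and y: "y \<in> V2" and z: "z \<in> V3" and k: "P2 (x \<odot> z) = 0"
  shows "(y \<odot> z) \<bullet> (x \<odot> z) = 0"
proof (cases "x = 0")
  case False
  define I where "I = {z \<in> V3. P2 (x \<odot> z) = 0}"
  have subI: "subspace I"
    unfolding I_def subspace_def by (auto simp: mul_linear proj_add proj_scale proj_0 sub_closed)
  have zI: "z \<in> I" using z k by (simp add: I_def)
  have nI: "x \<odot> z \<in> I"
    using mul_1_kernel_in[OF x z k] mul_1_1_kernel[OF x z k] z
    by (simp add: I_def proj_scale proj_orth[OF _ sub2] od_orth)
  have "(y \<odot> (x \<odot> z)) \<bullet> (x \<odot> (x \<odot> z)) + 3 * (x \<bullet> x) * ((y \<odot> z) \<bullet> (x \<odot> z)) = 0"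
  proof (rule polarize2[where V = I and B = "\<lambda>u v. (y \<odot> (x \<odot> u)) \<bullet> (x \<odot> v) + 3 * (x \<bullet> x) * ((y \<odot> u) \<bullet> v)"])
    show "(y \<odot> (x \<odot> u)) \<bullet> (x \<odot> v) + 3 * (x \<bullet> x) * ((y \<odot> u) \<bullet> v) = (y \<odot> (x \<odot> v)) \<bullet> (x \<odot> u) + 3 * (x \<bullet> x) * ((y \<odot> v) \<bullet> u)" for u v
      using trilinear_swap[of y "x \<odot> u" "x \<odot> v"] trilinear_swap[of y u v] by simp
    show "(y \<odot> (x \<odot> u)) \<bullet> (x \<odot> u) + 3 * (x \<bullet> x) * ((y \<odot> u) \<bullet> u) = 0" if "u \<in> I" for u
      using mixed_212_kernel[OF x y, of u] that by (simp add: I_def)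
  qed (simp_all add: lin subI zI nI algebra_simps)
  then have "6 * (x \<bullet> x) * ((y \<odot> z) \<bullet> (x \<odot> z)) = 0"
    unfolding mul_1_1_kernel[OF x z k]
    using trilinear_swap[of y "x \<odot> z" z] by simp
  then show ?thesis using False by simp
qed simp

text \<open>This is \<open>x \<bullet> x\<close> times the orthogonal projection of
  \<open>V3\<close> onto the kernel of \<open>z \<mapsto> P2 (x \<odot> z)\<close>: by
  \<open>mul_1_12\<close> the subtracted term is the same multiple of the projection onto
  \<open>x \<odot> V2\<close>. The scaling avoids a division when \<open>x = 0\<close>.\<close>

definition ker :: "'a \<Rightarrow> 'a \<Rightarrow> 'a" where
  "ker x z = (x \<bullet> x) *\<^sub>R z - x \<odot> P2 (x \<odot> z)"

lemma ker_props:
  assumes x: "x \<in> V1" and z: "z \<in> V3"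
  shows ker_in: "ker x z \<in> V3" and ker_kernel: "P2 (x \<odot> ker x z) = 0"
    and mul_ker: "x \<odot> ker x z = (x \<bullet> x) *\<^sub>R P3 (x \<odot> z)"
    and ker_symmetric: "z' \<in> V3 \<Longrightarrow> ker x z \<bullet> z' = z \<bullet> ker x z'"
proof -
  show "ker x z \<in> V3" unfolding ker_def using x z by (intro sub_closed mul_12_in) simp_all
  show *: "x \<odot> ker x z = (x \<bullet> x) *\<^sub>R P3 (x \<odot> z)"
    unfolding ker_def using mul_1_12[OF x, of "P2 (x \<odot> z)"] mul_13[OF x z]
    by (simp add: mul_linear scaleR_diff_right[symmetric]) (metis add_diff_cancel_left')
  show "P2 (x \<odot> ker x z) = 0"
    unfolding * by (simp add: proj_scale proj_orth[OF _ sub2] od_orth)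
  assume z': "z' \<in> V3"
  have *: "(x \<odot> P2 (x \<odot> u)) \<bullet> v = P2 (x \<odot> u) \<bullet> P2 (x \<odot> v)" for u v
    by (metis mul_inner mul_commute P_in(2) P_inner(2) inner_commute)
  have "(x \<odot> P2 (x \<odot> z)) \<bullet> z' = z \<bullet> (x \<odot> P2 (x \<odot> z'))"
    using *[of z z'] *[of z' z] by (simp only: inner_commute)
  then show "ker x z \<bullet> z' = z \<bullet> ker x z'"
    unfolding ker_def by (simp add: inner_linear)
qed

text \<open>By \<open>mul_1_12\<close> the map \<open>P3 (x \<odot> _)\<close> kills
  \<open>x \<odot> V2\<close>, so the trace lives on the kernel, where anticommuting operators have
  a product of trace zero. Concretely, the self-adjoint \<open>ker x\<close> is moved from one
  factor to the other: on one side each summand vanishes by \<open>kernel_anti\<close>, on the other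
  \<open>x \<bullet> x\<close> times the desired sum appears.\<close>

lemma trace_13_23:
  assumes x: "x \<in> V1" and y: "y \<in> V2"
  shows "(\<Sum>b\<in>Bas V3. P3 (x \<odot> b) \<bullet> (y \<odot> b)) = 0"
proof (cases "x = 0")
  case False
  have "(\<Sum>b\<in>Bas V3. (y \<odot> ker x b) \<bullet> P3 (x \<odot> b)) = (\<Sum>b\<in>Bas V3. (y \<odot> b) \<bullet> P3 (x \<odot> ker x b))"
    by (rule sum_Bas_adjoint[where g = "\<lambda>u v. (y \<odot> u) \<bullet> P3 (x \<odot> v)", OF _ _ sub3 sub3])
      (simp_all add: lin ker_in ker_symmetric x)
  moreover have "(y \<odot> ker x b) \<bullet> P3 (x \<odot> b) = 0" if "b \<in> Bas V3" for b
  proof -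
    have b: "b \<in> V3" using that by (rule Bas_in[OF sub3])
    have "(x \<bullet> x) * ((y \<odot> ker x b) \<bullet> P3 (x \<odot> b)) = 0"
      using kernel_anti[OF x y ker_in[OF x b] ker_kernel[OF x b]] by (simp add: mul_ker[OF x b])
    then show ?thesis using False by simp
  qed
  moreover have "(\<Sum>b\<in>Bas V3. (y \<odot> b) \<bullet> P3 (x \<odot> ker x b)) = (x \<bullet> x) * (\<Sum>b\<in>Bas V3. P3 (x \<odot> b) \<bullet> (y \<odot> b))"
    unfolding sum_distrib_left
  proof (rule sum.cong[OF refl])
    fix b assume "b \<in> Bas V3"
    then have b: "b \<in> V3" by (rule Bas_in[OF sub3])
    show "(y \<odot> b) \<bullet> P3 (x \<odot> ker x b) = (x \<bullet> x) * (P3 (x \<odot> b) \<bullet> (y \<odot> b))"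
      by (simp add: mul_ker[OF x b] proj_scale inner_commute)
  qed
  ultimately show ?thesis using False by simp
qed (simp add: proj_0)

text \<open>For \<open>w\<close> the relation of \<open>kernel_anti\<close> extends from the kernel
  to all of \<open>V3\<close>. Up to the factor \<open>x \<bullet> x\<close>, \<open>z\<close>
  splits into a kernel part and \<open>x \<odot> a\<close> with \<open>a\<close> in
  \<open>V2\<close>. For the second part, \<open>w_swap\<close> makes the two terms on the left of
  \<open>mixed_121_polar\<close> equal, and its right-hand side vanishes by
  \<open>mixed_211\<close>.\<close>

lemma anti_w:
  assumes x: "x \<in> V1" and z: "z \<in> V3"
  shows "(w \<odot> z) \<bullet> P3 (x \<odot> z) = 0"
proof (cases "x = 0")
  case False
  define n where "n = P3 (x \<odot> z)"
  define a where "a = P2 (x \<odot> z)"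
  have n3: "n \<in> V3" and a2: "a \<in> V2" by (simp_all add: n_def a_def)
  have Xn: "x \<odot> ker x z = (x \<bullet> x) *\<^sub>R n" unfolding n_def by (rule mul_ker[OF x z])
  have Xz: "(x \<bullet> x) *\<^sub>R z = ker x z + x \<odot> a" by (simp add: ker_def a_def)
  have 1: "(w \<odot> ker x z) \<bullet> n = 0"
    using kernel_anti[OF x w_in ker_in[OF x z] ker_kernel[OF x z]] False by (simp add: Xn)
  have "(x \<odot> m a w) \<bullet> n = 0"
    using mixed_211[OF x m_in ker_in[OF x z], of a w] False by (simp add: Xn)
  then have "m a w \<bullet> (x \<odot> n) = 0" by (metis mul_inner mul_commute)
  then have "(x \<odot> a) \<bullet> (w \<odot> n) = 0"
    using mixed_121_polar[OF x a2 w_in n3] w_swap[OF x a2 n3] by (simp add: m_def)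
  then have 2: "(w \<odot> (x \<odot> a)) \<bullet> n = 0" by (metis mul_inner mul_commute)
  have "(w \<odot> ((x \<bullet> x) *\<^sub>R z)) \<bullet> n = 0" unfolding Xz using 1 2 by (simp add: lin)
  then show ?thesis using False by (simp add: lin n_def)
qed (simp add: proj_0)

lemma anti_w_polar:
  assumes x: "x \<in> V1" and z: "z \<in> V3" "z' \<in> V3"
  shows "(w \<odot> z) \<bullet> P3 (x \<odot> z') = - ((w \<odot> z') \<bullet> P3 (x \<odot> z))"
proof -
  have "(w \<odot> z) \<bullet> P3 (x \<odot> z') + (w \<odot> z') \<bullet> P3 (x \<odot> z) = 0"
    by (rule polarize2[where V = V3 and B = "\<lambda>u v. (w \<odot> u) \<bullet> P3 (x \<odot> v) + (w \<odot> v) \<bullet> P3 (x \<odot> u)"])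
      (simp_all add: lin sub3 z anti_w x algebra_simps)
  then show ?thesis by simp
qed

text \<open>Let S and X be multiplication by \<open>w\<close> and by
  \<open>x = P1 (w \<odot> z)\<close>, compressed to \<open>V3\<close>; they anticommute by
  \<open>anti_w_polar\<close>. For the vector \<open>k\<close> one has S^2 k = W k + (c/2) S k.
  Evaluating the anticommutation on the pairs formed from \<open>k\<close> and S k gives c W (k, X
  k) = 0, and (k, X k) is \<open>W^2\<close> times \<open>(z \<odot> z) \<bullet> x\<close>, since
  the terms containing \<open>x \<odot> w\<close> are orthogonal.\<close>

lemma cubic_w:
  assumes z: "z \<in> V3"
  shows "(z \<odot> z) \<bullet> P1 (w \<odot> z) = 0"
proof (cases "w = 0")
  case False
  define x where "x = P1 (w \<odot> z)"
  define W where "W = w \<bullet> w"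
  define c where "c = 4 - 2 * real (dim V2)"
  have x: "x \<in> V1" by (simp add: x_def)
  have W: "W \<noteq> 0" using False by (simp add: W_def)
  \<comment> \<open>The norm of \<open>m w w\<close> is known both from the eikonal equation and
    from \<open>mul_ww\<close>; comparing the two values excludes \<open>c = 0\<close>.\<close>
  have "c^2 * W = 2 * W^2"
    using norm_mul_22[OF zero_in(1) w_in] mul_ww
    by (simp add: W_def c_def power2_eq_square flip: m_def)
  then have c: "c \<noteq> 0" using W by auto
  \<comment> \<open>The analogue of \<open>ker\<close> with \<open>V1\<close> and \<open>V2\<close>
    interchanged: \<open>W\<close> times the projection of \<open>z\<close> onto the kernel of
    \<open>P1 (w \<odot> _)\<close> on \<open>V3\<close>.\<close>
  define k where "k = W *\<^sub>R z - x \<odot> w"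
  define b where "b = P3 (w \<odot> k)"
  have k3: "k \<in> V3" unfolding k_def using z x by (intro sub_closed mul_12_in) simp_all
  have b3: "b \<in> V3" by (simp add: b_def)
  have k0: "P1 (w \<odot> k) = 0"
    using P1_mul_2_12[OF x w_in] by (simp add: k_def lin x_def W_def)
  \<comment> \<open>The quadratic relation for multiplication by \<open>w\<close>: in
    \<open>norm_mul_23_V3\<close> at \<open>y = w\<close> the \<open>V1\<close> term vanishes on
    \<open>k\<close>, and \<open>mul_ww\<close> turns the last term back into multiplication by
    \<open>w\<close>.\<close>
  have Sb: "P3 (w \<odot> b) = W *\<^sub>R k + (c / 2) *\<^sub>R b"
  proof (rule od_eqI)
    show "P3 (w \<odot> b) \<bullet> v = (W *\<^sub>R k + (c / 2) *\<^sub>R b) \<bullet> v" if v: "v \<in> V3" for v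
    proof -
      have "P3 (w \<odot> b) \<bullet> v = b \<bullet> P3 (w \<odot> v)"
        using v b3 by (simp add: proj_inner' sub3) (metis mul_inner mul_commute)
      also have "\<dots> = W * (k \<bullet> v) + 1/2 * (m w w \<bullet> (k \<odot> v))"
        using norm_mul_23_V3[OF w_in w_in k3 v] by (simp add: b_def k0 W_def m_def)
      also have "m w w \<bullet> (k \<odot> v) = c * (b \<bullet> v)"
        using v by (simp add: mul_ww c_def b_def) (metis mul_inner mul_commute)
      finally show ?thesis by (simp add: inner_linear)
    qed
  qed (use b3 k3 od_orth P_in(3) in \<open>simp_all add: inner_linear\<close>)
  have anti: "P3 (w \<odot> u) \<bullet> (x \<odot> v) = - (P3 (w \<odot> v) \<bullet> (x \<odot> u))" if "u \<in> V3" "v \<in> V3" for u v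
    using anti_w_polar[OF x that] by (simp add: proj_symmetric)
  have 1: "b \<bullet> (x \<odot> k) = 0" using anti[OF k3 k3] by (simp add: b_def)
  have 2: "b \<bullet> (x \<odot> b) = - W * (k \<bullet> (x \<odot> k))"
    using anti[OF k3 b3] 1 by (simp add: Sb inner_linear flip: b_def)
  have 3: "W * (k \<bullet> (x \<odot> b)) + c / 2 * (b \<bullet> (x \<odot> b)) = 0"
    using anti[OF b3 b3] by (simp add: Sb inner_linear)
  have "k \<bullet> (x \<odot> b) = b \<bullet> (x \<odot> k)" by (metis mul_inner mul_commute inner_commute)
  then have g: "k \<bullet> (x \<odot> k) = 0" using 1 2 3 W c by simp
  have o: "(x \<odot> w) \<bullet> (x \<odot> z) = 0" "z \<bullet> (x \<odot> (x \<odot> w)) = 0" "(x \<odot> w) \<bullet> (x \<odot> (x \<odot> w)) = 0"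
    using mixed_211[OF x w_in z] z mul_12_in[OF x w_in] by (simp_all add: mul_1_12[OF x w_in] od_orth)
  have "W^2 * (z \<bullet> (x \<odot> z)) = 0"
    using g unfolding k_def by (simp add: lin o power2_eq_square)
  then have "z \<bullet> (x \<odot> z) = 0" using W by simp
  then show ?thesis unfolding x_def[symmetric] by (metis mul_inner mul_commute)
qed (simp add: proj_0)

section \<open>The trace form\<close>

text \<open>Cyclicity of the trace for multiplications compressed to \<open>V\<close> and
  \<open>W\<close>. It trades sums over \<open>V3\<close> for sums over \<open>V1\<close> or
  \<open>V2\<close>, where the products are better understood.\<close>

lemma sum_swap:
  assumes V: "subspace V" and W: "subspace W"
  shows "(\<Sum>b\<in>Bas V. proj W (u \<odot> b) \<bullet> (v \<odot> b)) = (\<Sum>c\<in>Bas W. proj V (u \<odot> c) \<bullet> (v \<odot> c))"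
proof -
  have "(\<Sum>b\<in>Bas V. proj W (u \<odot> b) \<bullet> (v \<odot> b)) = (\<Sum>c\<in>Bas W. c \<bullet> (v \<odot> proj V (u \<odot> c)))"
  proof (rule sum_Bas_adjoint[where g = "\<lambda>x y. x \<bullet> (v \<odot> y)", OF _ _ V W])
    show "proj W (u \<odot> x) \<bullet> y = x \<bullet> proj V (u \<odot> y)" if "x \<in> V" "y \<in> W" for x y
      using that V W by (simp add: proj_inner proj_inner') (metis mul_inner mul_commute)
  qed (simp_all add: lin proj_in V W)
  also have "\<dots> = (\<Sum>c\<in>Bas W. proj V (u \<odot> c) \<bullet> (v \<odot> c))"
    by (intro sum.cong refl) (metis mul_inner mul_commute inner_commute)
  finally show ?thesis .
qed

lemma gram_split:
  "gram u v = (u \<odot> e) \<bullet> (v \<odot> e) + (\<Sum>b\<in>Bas V1. (u \<odot> b) \<bullet> (v \<odot> b))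
    + (\<Sum>b\<in>Bas V2. (u \<odot> b) \<bullet> (v \<odot> b)) + (\<Sum>b\<in>Bas V3. (u \<odot> b) \<bullet> (v \<odot> b))"
  unfolding gram_def by (rule trace_split) (simp_all add: lin)

lemma tr_split:
  "0 = (u \<odot> e) \<bullet> e + (\<Sum>b\<in>Bas V1. (u \<odot> b) \<bullet> b)
    + (\<Sum>b\<in>Bas V2. (u \<odot> b) \<bullet> b) + (\<Sum>b\<in>Bas V3. (u \<odot> b) \<bullet> b)"
  unfolding tr_zero[of u, symmetric] tr_def by (rule trace_split) (simp_all add: lin)

lemma gram_commute: "gram u v = gram v u"
  unfolding gram_def by (simp add: inner_commute)

lemma gram_linear:
  "gram (a + b) c = gram a c + gram b c" "gram c (a + b) = gram c a + gram c b"
  "gram (r *\<^sub>R a) c = r * gram a c" "gram c (r *\<^sub>R a) = r * gram c a"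
  unfolding gram_def by (simp_all add: lin sum.distrib sum_distrib_left)

lemma Bas_mem: "b \<in> Bas V1 \<Longrightarrow> b \<in> V1" "b \<in> Bas V2 \<Longrightarrow> b \<in> V2" "b \<in> Bas V3 \<Longrightarrow> b \<in> V3"
  using Bas_in sub1 sub2 sub3 by blast+

lemma Bas_norm': "b \<in> Bas V1 \<Longrightarrow> b \<bullet> b = 1" "b \<in> Bas V2 \<Longrightarrow> b \<bullet> b = 1" "b \<in> Bas V3 \<Longrightarrow> b \<bullet> b = 1"
  using Bas_norm sub1 sub2 sub3 by blast+

text \<open>In \<open>tr y = 0\<close> the blocks of \<open>e\<close> and \<open>V1\<close>
  contribute nothing, so the block of \<open>V3\<close> must balance that of
  \<open>V2\<close>.\<close>

lemma sum_33: "y \<in> V2 \<Longrightarrow> (\<Sum>b\<in>Bas V3. (y \<odot> b) \<bullet> b) = - (w \<bullet> y)"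
  using tr_split[of y] by (simp add: mul_commute[of y e] mul_e2 inner_linear od_orth T_perm(1) Bas_mem
      mul_commute[of y] w_inner cong: sum.cong)

text \<open>The value of tr(L_e^2), that is \<open>4 + 4 * dim V1 + dim V2 + dim V3\<close>,
  rewritten with \<open>dim_V3\<close>.\<close>

definition q0 :: real where
  "q0 = 6 * real (dim V1) + 2 * real (dim V2) + 2"

lemma gram_e:
  shows gram_ee: "gram e e = q0"
    and gram_e1: "x \<in> V1 \<Longrightarrow> gram e x = 0"
    and gram_e2: "y \<in> V2 \<Longrightarrow> gram e y = -2 * (w \<bullet> y)"
    and gram_e3: "z \<in> V3 \<Longrightarrow> gram e z = 0"
proof -
  have S: "gram e u = 2 * (e \<bullet> (u \<odot> e)) - 2 * (\<Sum>b\<in>Bas V1. (u \<odot> b) \<bullet> b)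
    - (\<Sum>b\<in>Bas V2. (u \<odot> b) \<bullet> b) + (\<Sum>b\<in>Bas V3. (u \<odot> b) \<bullet> b)" for u
  proof -
    have "(\<Sum>b\<in>Bas V1. (e \<odot> b) \<bullet> (u \<odot> b)) = (\<Sum>b\<in>Bas V1. -2 * ((u \<odot> b) \<bullet> b))"
      "(\<Sum>b\<in>Bas V2. (e \<odot> b) \<bullet> (u \<odot> b)) = (\<Sum>b\<in>Bas V2. - ((u \<odot> b) \<bullet> b))"
      "(\<Sum>b\<in>Bas V3. (e \<odot> b) \<bullet> (u \<odot> b)) = (\<Sum>b\<in>Bas V3. (u \<odot> b) \<bullet> b)"
      by (intro sum.cong refl; simp add: Bas_mem mul_e1 mul_e2 mul_e3 inner_commute)+
    then show ?thesis unfolding gram_split by (simp add: mul_ee sum_negf flip: sum_distrib_left)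
  qed
  have "(\<Sum>b\<in>Bas V1. (e \<odot> b) \<bullet> b) = (\<Sum>b\<in>Bas V1. -2)"
    "(\<Sum>b\<in>Bas V2. (e \<odot> b) \<bullet> b) = (\<Sum>b\<in>Bas V2. -1)" "(\<Sum>b\<in>Bas V3. (e \<odot> b) \<bullet> b) = (\<Sum>b\<in>Bas V3. 1)"
    by (intro sum.cong refl; simp add: Bas_mem Bas_norm' mul_e1 mul_e2 mul_e3)+
  then show "gram e e = q0"
    unfolding S q0_def by (simp add: mul_ee od_ee card_Bas sub1 sub2 sub3 dim_V3)
  show "gram e x = 0" if x: "x \<in> V1"
  proof -
    have "(\<Sum>b\<in>Bas V1. (x \<odot> b) \<bullet> b) = 0" "(\<Sum>b\<in>Bas V2. (x \<odot> b) \<bullet> b) = 0"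
      by (intro sum.neutral ballI; simp add: x Bas_mem T111 T122)+
    then show ?thesis unfolding S using tr_split[of x] x
      by (simp add: mul_commute[of x e] mul_e1 inner_linear od_orth)
  qed
  show "gram e z = 0" if z: "z \<in> V3"
  proof -
    have "(\<Sum>b\<in>Bas V1. (z \<odot> b) \<bullet> b) = 0" "(\<Sum>b\<in>Bas V2. (z \<odot> b) \<bullet> b) = 0"
      by (intro sum.neutral ballI; simp add: z Bas_mem T_perm mul_commute[of z])+
    then show ?thesis unfolding S using tr_split[of z] z
      by (simp add: mul_commute[of z e] mul_e3 inner_linear od_orth)
  qed
  show "gram e y = -2 * (w \<bullet> y)" if y: "y \<in> V2"
  proof -
    have "(\<Sum>b\<in>Bas V1. (y \<odot> b) \<bullet> b) = 0"
      by (intro sum.neutral ballI; simp add: y Bas_mem T_perm mul_commute[of y])+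
    then show ?thesis unfolding S sum_33[OF y] w_inner[OF y, symmetric] using y
      by (simp add: mul_commute[of y e] mul_e2 inner_linear od_orth)
  qed
qed

lemma inner_blocks:
  "x \<in> V1 \<Longrightarrow> z \<in> V3 \<Longrightarrow> u \<in> V1 \<Longrightarrow> v \<in> V3 \<Longrightarrow>
    (x \<odot> z) \<bullet> (u \<odot> v) = P2 (x \<odot> z) \<bullet> P2 (u \<odot> v) + P3 (x \<odot> z) \<bullet> P3 (u \<odot> v)"
  "x \<in> V2 \<Longrightarrow> z \<in> V3 \<Longrightarrow> u \<in> V2 \<Longrightarrow> v \<in> V3 \<Longrightarrow>
    (x \<odot> z) \<bullet> (u \<odot> v) = P1 (x \<odot> z) \<bullet> P1 (u \<odot> v) + P3 (x \<odot> z) \<bullet> P3 (u \<odot> v)"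
  "x \<in> V3 \<Longrightarrow> z \<in> V3 \<Longrightarrow> u \<in> V3 \<Longrightarrow> v \<in> V3 \<Longrightarrow>
    (x \<odot> z) \<bullet> (u \<odot> v) = (x \<bullet> z) * (u \<bullet> v) + P1 (x \<odot> z) \<bullet> P1 (u \<odot> v) + P2 (x \<odot> z) \<bullet> P2 (u \<odot> v)"
  "x \<in> V2 \<Longrightarrow> z \<in> V2 \<Longrightarrow> u \<in> V2 \<Longrightarrow> v \<in> V2 \<Longrightarrow>
    (x \<odot> z) \<bullet> (u \<odot> v) = (x \<bullet> z) * (u \<bullet> v) + m x z \<bullet> m u v"
  "x \<in> V1 \<Longrightarrow> z \<in> V3 \<Longrightarrow> u \<in> V2 \<Longrightarrow> v \<in> V3 \<Longrightarrow> (x \<odot> z) \<bullet> (u \<odot> v) = P3 (x \<odot> z) \<bullet> (u \<odot> v)"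
  "x \<in> V1 \<Longrightarrow> z \<in> V3 \<Longrightarrow> u \<in> V3 \<Longrightarrow> v \<in> V3 \<Longrightarrow> (x \<odot> z) \<bullet> (u \<odot> v) = P2 (x \<odot> z) \<bullet> (u \<odot> v)"
  "x \<in> V2 \<Longrightarrow> z \<in> V3 \<Longrightarrow> u \<in> V3 \<Longrightarrow> v \<in> V3 \<Longrightarrow> (x \<odot> z) \<bullet> (u \<odot> v) = P1 (x \<odot> z) \<bullet> (u \<odot> v)"
  "x \<in> V2 \<Longrightarrow> z \<in> V2 \<Longrightarrow> u \<in> V2 \<Longrightarrow> v \<in> V3 \<Longrightarrow> (x \<odot> z) \<bullet> (u \<odot> v) = 0"
proof -
  show "x \<in> V1 \<Longrightarrow> z \<in> V3 \<Longrightarrow> u \<in> V1 \<Longrightarrow> v \<in> V3 \<Longrightarrow>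
    (x \<odot> z) \<bullet> (u \<odot> v) = P2 (x \<odot> z) \<bullet> P2 (u \<odot> v) + P3 (x \<odot> z) \<bullet> P3 (u \<odot> v)"
    by (subst mul_13, assumption, assumption, subst mul_13[of u], assumption, assumption)
      (simp add: inner_add_left inner_add_right od_orth)
  show "x \<in> V2 \<Longrightarrow> z \<in> V3 \<Longrightarrow> u \<in> V2 \<Longrightarrow> v \<in> V3 \<Longrightarrow>
    (x \<odot> z) \<bullet> (u \<odot> v) = P1 (x \<odot> z) \<bullet> P1 (u \<odot> v) + P3 (x \<odot> z) \<bullet> P3 (u \<odot> v)"
    by (subst mul_23, assumption, assumption, subst mul_23[of u], assumption, assumption)
      (simp add: inner_add_left inner_add_right od_orth)
  show "x \<in> V3 \<Longrightarrow> z \<in> V3 \<Longrightarrow> u \<in> V3 \<Longrightarrow> v \<in> V3 \<Longrightarrow>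
    (x \<odot> z) \<bullet> (u \<odot> v) = (x \<bullet> z) * (u \<bullet> v) + P1 (x \<odot> z) \<bullet> P1 (u \<odot> v) + P2 (x \<odot> z) \<bullet> P2 (u \<odot> v)"
    by (subst mul_33, assumption, assumption, subst mul_33[of u], assumption, assumption)
      (simp add: inner_add_left inner_add_right od_orth od_ee)
  show "x \<in> V2 \<Longrightarrow> z \<in> V2 \<Longrightarrow> u \<in> V2 \<Longrightarrow> v \<in> V2 \<Longrightarrow>
    (x \<odot> z) \<bullet> (u \<odot> v) = (x \<bullet> z) * (u \<bullet> v) + m x z \<bullet> m u v"
    by (subst mul_22, assumption, assumption, subst mul_22[of u], assumption, assumption)
      (simp add: inner_linear od_orth od_ee m_def)
  show "x \<in> V1 \<Longrightarrow> z \<in> V3 \<Longrightarrow> u \<in> V2 \<Longrightarrow> v \<in> V3 \<Longrightarrow> (x \<odot> z) \<bullet> (u \<odot> v) = P3 (x \<odot> z) \<bullet> (u \<odot> v)"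
    by (subst mul_13, assumption, assumption, subst (1 2) mul_23, assumption, assumption)
      (simp add: inner_add_left inner_add_right od_orth)
  show "x \<in> V1 \<Longrightarrow> z \<in> V3 \<Longrightarrow> u \<in> V3 \<Longrightarrow> v \<in> V3 \<Longrightarrow> (x \<odot> z) \<bullet> (u \<odot> v) = P2 (x \<odot> z) \<bullet> (u \<odot> v)"
    by (subst mul_13, assumption, assumption, subst (1 2) mul_33, assumption, assumption)
      (simp add: inner_add_left inner_add_right od_orth)
  show "x \<in> V2 \<Longrightarrow> z \<in> V3 \<Longrightarrow> u \<in> V3 \<Longrightarrow> v \<in> V3 \<Longrightarrow> (x \<odot> z) \<bullet> (u \<odot> v) = P1 (x \<odot> z) \<bullet> (u \<odot> v)"
    by (subst mul_23, assumption, assumption, subst (1 2) mul_33, assumption, assumption)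
      (simp add: inner_add_left inner_add_right od_orth)
  show "x \<in> V2 \<Longrightarrow> z \<in> V2 \<Longrightarrow> u \<in> V2 \<Longrightarrow> v \<in> V3 \<Longrightarrow> (x \<odot> z) \<bullet> (u \<odot> v) = 0"
    by (subst mul_22, assumption, assumption, subst mul_23[of u], assumption, assumption)
      (simp add: inner_linear od_orth)
qed

lemma sum_norm_12:
  "x \<in> V1 \<Longrightarrow> (\<Sum>b\<in>Bas V2. (x \<odot> b) \<bullet> (x \<odot> b)) = real (dim V2) * (x \<bullet> x)"
  "y \<in> V2 \<Longrightarrow> (\<Sum>b\<in>Bas V1. (y \<odot> b) \<bullet> (y \<odot> b)) = real (dim V1) * (y \<bullet> y)"
proof -
  assume "x \<in> V1"
  then have "(\<Sum>b\<in>Bas V2. (x \<odot> b) \<bullet> (x \<odot> b)) = (\<Sum>b\<in>Bas V2. x \<bullet> x)"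
    by (intro sum.cong refl) (simp add: norm_mul_12 Bas_mem Bas_norm')
  then show "(\<Sum>b\<in>Bas V2. (x \<odot> b) \<bullet> (x \<odot> b)) = real (dim V2) * (x \<bullet> x)"
    by (simp add: card_Bas sub2)
next
  assume "y \<in> V2"
  then have "(\<Sum>b\<in>Bas V1. (y \<odot> b) \<bullet> (y \<odot> b)) = (\<Sum>b\<in>Bas V1. y \<bullet> y)"
    by (intro sum.cong refl) (simp add: mul_commute[of y] norm_mul_12 Bas_mem Bas_norm')
  then show "(\<Sum>b\<in>Bas V1. (y \<odot> b) \<bullet> (y \<odot> b)) = real (dim V1) * (y \<bullet> y)"
    by (simp add: card_Bas sub1)
qed

text \<open>In the block of \<open>V3\<close>, \<open>norm_mul_13\<close> trades the unknown
  \<open>V3\<close> part of \<open>x \<odot> b\<close> for its \<open>V2\<close> part, and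
  \<open>sum_swap\<close> identifies the trace of the latter with the block of
  \<open>V2\<close>.\<close>

lemma gram_11_diag:
  assumes x: "x \<in> V1"
  shows "gram x x = q0 * (x \<bullet> x)"
proof -
  have 1: "(\<Sum>b\<in>Bas V1. (x \<odot> b) \<bullet> (x \<odot> b)) = 4 * (x \<bullet> x)"
  proof -
    have "(\<Sum>b\<in>Bas V1. (x \<odot> b) \<bullet> (x \<odot> b)) = (\<Sum>b\<in>Bas V1. 4 * ((x \<bullet> b) * (x \<bullet> b)))"
      by (intro sum.cong refl) (simp add: mul_11 x Bas_mem od_ee)
    then show ?thesis by (simp add: parseval_in sub1 x flip: sum_distrib_left)
  qed
  have 3: "(\<Sum>b\<in>Bas V3. (x \<odot> b) \<bullet> (x \<odot> b)) = (\<Sum>b\<in>Bas V3. 3 * (x \<bullet> x) - 2 * (P2 (x \<odot> b) \<bullet> (x \<odot> b)))"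
  proof (intro sum.cong refl)
    fix b assume b: "b \<in> Bas V3"
    show "(x \<odot> b) \<bullet> (x \<odot> b) = 3 * (x \<bullet> x) - 2 * (P2 (x \<odot> b) \<bullet> (x \<odot> b))"
      using inner_blocks(1)[of x b x b] norm_mul_13[of x b] x Bas_mem(3)[OF b] Bas_norm'(3)[OF b]
      by (simp add: inner_commute)
  qed
  have 4: "(\<Sum>b\<in>Bas V3. P2 (x \<odot> b) \<bullet> (x \<odot> b)) = real (dim V2) * (x \<bullet> x)"
  proof -
    have "(\<Sum>b\<in>Bas V3. P2 (x \<odot> b) \<bullet> (x \<odot> b)) = (\<Sum>c\<in>Bas V2. P3 (x \<odot> c) \<bullet> (x \<odot> c))"
      by (rule sum_swap[OF sub3 sub2])
    also have "\<dots> = (\<Sum>c\<in>Bas V2. (x \<odot> c) \<bullet> (x \<odot> c))"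
      by (intro sum.cong refl) (simp add: mul_12_in x Bas_mem)
    finally show ?thesis using sum_norm_12(1)[OF x] by simp
  qed
  show ?thesis
    unfolding gram_split 1 sum_norm_12(1)[OF x] 3 sum_subtractf
    by (simp add: 4 card_Bas sub3 dim_V3 q0_def mul_commute[of x e] mul_e1 x algebra_simps flip: sum_distrib_left)
qed

text \<open>The product rules annihilate every block except that of \<open>V3\<close>, which is the
  trace in \<open>trace_13_23\<close>.\<close>

lemma gram_12:
  assumes x: "x \<in> V1" and y: "y \<in> V2"
  shows "gram x y = 0"
proof -
  have "(\<Sum>b\<in>Bas V1. (x \<odot> b) \<bullet> (y \<odot> b)) = 0"
    by (intro sum.neutral ballI) (simp add: mul_11 x y Bas_mem inner_commute[of e] mul_commute[of y] perp_products)
  moreover have "(\<Sum>b\<in>Bas V2. (x \<odot> b) \<bullet> (y \<odot> b)) = 0"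
  proof (intro sum.neutral ballI)
    fix b assume "b \<in> Bas V2"
    then have b: "b \<in> V2" by (rule Bas_mem)
    show "(x \<odot> b) \<bullet> (y \<odot> b) = 0"
      using mul_12_in[OF x b] by (subst mul_22[OF y b]) (simp add: inner_linear od_orth)
  qed
  moreover have "(\<Sum>b\<in>Bas V3. (x \<odot> b) \<bullet> (y \<odot> b)) = (\<Sum>b\<in>Bas V3. P3 (x \<odot> b) \<bullet> (y \<odot> b))"
    by (intro sum.cong refl) (simp add: inner_blocks(5) x y Bas_mem)
  ultimately show ?thesis
    unfolding gram_split using x y
    by (simp add: trace_13_23 mul_commute[of _ e] mul_e1 mul_e2 inner_linear od_orth)
qed

text \<open>Summing \<open>mixed_121\<close> over a basis of \<open>V2\<close> produces
  \<open>w\<close>; by \<open>sum_swap\<close> the block of \<open>V3\<close> contributes the same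
  amount again.\<close>

lemma gram_13:
  assumes x: "x \<in> V1" and z: "z \<in> V3"
  shows "gram x z = -2 * (w \<bullet> (x \<odot> z))"
proof -
  have "(\<Sum>b\<in>Bas V1. (x \<odot> b) \<bullet> (z \<odot> b)) = 0"
    by (intro sum.neutral ballI) (simp add: mul_11 x z Bas_mem inner_commute[of e] mul_commute[of z] perp_products)
  moreover have 2: "(\<Sum>b\<in>Bas V2. (x \<odot> b) \<bullet> (z \<odot> b)) = - (w \<bullet> (x \<odot> z))"
  proof -
    have "(\<Sum>b\<in>Bas V2. (x \<odot> b) \<bullet> (z \<odot> b)) = (\<Sum>b\<in>Bas V2. - (m b b \<bullet> (x \<odot> z)))"
    proof (intro sum.cong refl)
      fix b assume "b \<in> Bas V2"
      then have b: "b \<in> V2" by (rule Bas_mem)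
      show "(x \<odot> b) \<bullet> (z \<odot> b) = - (m b b \<bullet> (x \<odot> z))"
        using mixed_121[OF x b z] by (simp add: m_def proj_symmetric mul_commute[of z b])
    qed
    then show ?thesis by (simp add: w_def inner_sum_left sum_negf)
  qed
  moreover have "(\<Sum>b\<in>Bas V3. (x \<odot> b) \<bullet> (z \<odot> b)) = - (w \<bullet> (x \<odot> z))"
  proof -
    have "(\<Sum>b\<in>Bas V3. (x \<odot> b) \<bullet> (z \<odot> b)) = (\<Sum>b\<in>Bas V3. P2 (x \<odot> b) \<bullet> (z \<odot> b))"
      by (intro sum.cong refl) (simp add: inner_blocks(6) x z Bas_mem)
    also have "\<dots> = (\<Sum>c\<in>Bas V2. P3 (x \<odot> c) \<bullet> (z \<odot> c))" by (rule sum_swap[OF sub3 sub2])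
    also have "\<dots> = (\<Sum>c\<in>Bas V2. (x \<odot> c) \<bullet> (z \<odot> c))"
      by (intro sum.cong refl) (simp add: mul_12_in x Bas_mem)
    finally show ?thesis using 2 by simp
  qed
  ultimately show ?thesis
    unfolding gram_split using x z
    by (simp add: mul_commute[of _ e] mul_e1 mul_e3 inner_linear od_orth)
qed

text \<open>Half of the term with \<open>w\<close> comes from the block of \<open>V2\<close> through
  \<open>norm_m_2\<close>, the other half from the block of \<open>V3\<close> through
  \<open>norm_mul_23_V3\<close> and \<open>sum_33\<close>.\<close>

lemma gram_22_diag:
  assumes y: "y \<in> V2"
  shows "gram y y = q0 * (y \<bullet> y) - w \<bullet> (y \<odot> y)"
proof -
  have W: "w \<bullet> (y \<odot> y) = w \<bullet> m y y" by (simp add: m_def proj_inner' sub2)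
  have 2: "(\<Sum>b\<in>Bas V2. (y \<odot> b) \<bullet> (y \<odot> b)) = (real (dim V2) + 3) * (y \<bullet> y) - 1/2 * (w \<bullet> m y y)"
  proof -
    have "(\<Sum>b\<in>Bas V2. (y \<odot> b) \<bullet> (y \<odot> b)) = (\<Sum>b\<in>Bas V2. y \<bullet> y + 3 * ((y \<bullet> b) * (y \<bullet> b)) - 1/2 * (m b b \<bullet> m y y))"
    proof (intro sum.cong refl)
      fix b assume b: "b \<in> Bas V2"
      show "(y \<odot> b) \<bullet> (y \<odot> b) = y \<bullet> y + 3 * ((y \<bullet> b) * (y \<bullet> b)) - 1/2 * (m b b \<bullet> m y y)"
        using inner_blocks(4)[of y b y b] norm_m_2[of y b] y Bas_mem(2)[OF b] Bas_norm'(2)[OF b]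
        by (simp add: power2_eq_square inner_commute[of "m b b"])
    qed
    also have "\<dots> = real (dim V2) * (y \<bullet> y) + 3 * (\<Sum>b\<in>Bas V2. (y \<bullet> b) * (y \<bullet> b)) - 1/2 * (w \<bullet> m y y)"
      by (simp add: sum_subtractf sum.distrib card_Bas sub2 w_def inner_sum_left flip: sum_distrib_left sum_divide_distrib)
    finally show ?thesis by (simp add: parseval_in sub2 y algebra_simps)
  qed
  have 3: "(\<Sum>b\<in>Bas V3. (y \<odot> b) \<bullet> (y \<odot> b))
    = (\<Sum>b\<in>Bas V3. y \<bullet> y + 3 * (P1 (y \<odot> b) \<bullet> (y \<odot> b)) + 1/2 * ((m y y \<odot> b) \<bullet> b))"
  proof (intro sum.cong refl)
    fix b assume b: "b \<in> Bas V3"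
    have "P2 (y \<odot> y) \<bullet> (b \<odot> b) = (m y y \<odot> b) \<bullet> b" unfolding m_def by (metis mul_inner)
    then show "(y \<odot> b) \<bullet> (y \<odot> b) = y \<bullet> y + 3 * (P1 (y \<odot> b) \<bullet> (y \<odot> b)) + 1/2 * ((m y y \<odot> b) \<bullet> b)"
      using inner_blocks(2)[of y b y b] norm_mul_23_V3[of y y b b] y Bas_mem(3)[OF b] Bas_norm'(3)[OF b]
      by (simp add: inner_commute)
  qed
  have 4: "(\<Sum>b\<in>Bas V3. P1 (y \<odot> b) \<bullet> (y \<odot> b)) = real (dim V1) * (y \<bullet> y)"
  proof -
    have "(\<Sum>b\<in>Bas V3. P1 (y \<odot> b) \<bullet> (y \<odot> b)) = (\<Sum>c\<in>Bas V1. P3 (y \<odot> c) \<bullet> (y \<odot> c))"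
      by (rule sum_swap[OF sub3 sub1])
    also have "\<dots> = (\<Sum>c\<in>Bas V1. (y \<odot> c) \<bullet> (y \<odot> c))"
      by (intro sum.cong refl) (simp add: mul_commute[of y] mul_12_in y Bas_mem)
    finally show ?thesis using sum_norm_12(2)[OF y] by simp
  qed
  have 5: "(\<Sum>b\<in>Bas V3. y \<bullet> y + 3 * (P1 (y \<odot> b) \<bullet> (y \<odot> b)) + 1/2 * ((m y y \<odot> b) \<bullet> b))
    = real (dim V3) * (y \<bullet> y) + 3 * (\<Sum>b\<in>Bas V3. P1 (y \<odot> b) \<bullet> (y \<odot> b)) + 1/2 * (\<Sum>b\<in>Bas V3. (m y y \<odot> b) \<bullet> b)"
    by (simp only: sum.distrib sum_distrib_left) (simp add: card_Bas sub3)
  show ?thesis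
    unfolding gram_split sum_norm_12(2)[OF y] 2 3 5 4 sum_33[OF m_in] W
    by (simp add: dim_V3 q0_def mul_commute[of y e] mul_e2 y algebra_simps)
qed

lemma gram_23:
  assumes y: "y \<in> V2" and z: "z \<in> V3"
  shows "gram y z = 0"
proof -
  have 1: "(\<Sum>b\<in>Bas V1. (y \<odot> b) \<bullet> (z \<odot> b)) = 0"
    by (intro sum.neutral ballI) (simp add: mul_commute[of y] mul_commute[of z] mixed_211 y z Bas_mem)
  moreover have "(\<Sum>b\<in>Bas V2. (y \<odot> b) \<bullet> (z \<odot> b)) = 0"
    by (intro sum.neutral ballI) (simp add: mul_commute[of z] inner_blocks(8) y z Bas_mem)
  moreover have "(\<Sum>b\<in>Bas V3. (y \<odot> b) \<bullet> (z \<odot> b)) = 0"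
  proof -
    have "(\<Sum>b\<in>Bas V3. (y \<odot> b) \<bullet> (z \<odot> b)) = (\<Sum>b\<in>Bas V3. P1 (y \<odot> b) \<bullet> (z \<odot> b))"
      by (intro sum.cong refl) (simp add: inner_blocks(7) y z Bas_mem)
    also have "\<dots> = (\<Sum>c\<in>Bas V1. P3 (y \<odot> c) \<bullet> (z \<odot> c))" by (rule sum_swap[OF sub3 sub1])
    also have "\<dots> = (\<Sum>c\<in>Bas V1. (y \<odot> c) \<bullet> (z \<odot> c))"
      by (intro sum.cong refl) (simp add: mul_commute[of y] mul_12_in y Bas_mem)
    finally show ?thesis using 1 by simp
  qed
  ultimately show ?thesis
    unfolding gram_split using y z
    by (simp add: mul_commute[of _ e] mul_e2 mul_e3 inner_linear od_orth)
qed

text \<open>The blocks reduce to four traces, with \<open>\<gamma> = \<alpha>\<close> by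
  \<open>sum_swap\<close>. The norm identities need not fix \<open>\<alpha>\<close> and
  \<open>\<beta>\<close> separately: substituting for \<open>\<delta>\<close> leaves only the
  combination \<open>3 * \<alpha> + \<beta>\<close>, which \<open>norm_mul_13\<close>
  evaluates.\<close>

lemma gram_33_diag:
  assumes z: "z \<in> V3"
  shows "gram z z = q0 * (z \<bullet> z) + w \<bullet> (z \<odot> z)"
proof -
  define \<alpha> \<beta> \<gamma> \<delta> where "\<alpha> = (\<Sum>b\<in>Bas V1. P2 (z \<odot> b) \<bullet> (z \<odot> b))"
    and "\<beta> = (\<Sum>b\<in>Bas V1. P3 (z \<odot> b) \<bullet> (z \<odot> b))"
    and "\<gamma> = (\<Sum>b\<in>Bas V2. P1 (z \<odot> b) \<bullet> (z \<odot> b))"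
    and "\<delta> = (\<Sum>b\<in>Bas V2. P3 (z \<odot> b) \<bullet> (z \<odot> b))"
  have PP: "P1 u \<bullet> P1 u = P1 u \<bullet> u" "P2 u \<bullet> P2 u = P2 u \<bullet> u" "P3 u \<bullet> P3 u = P3 u \<bullet> u" for u
    by (simp_all add: proj_symmetric)
  have 1: "(\<Sum>b\<in>Bas V1. (z \<odot> b) \<bullet> (z \<odot> b)) = \<alpha> + \<beta>"
    unfolding \<alpha>_def \<beta>_def sum.distrib[symmetric]
    by (intro sum.cong refl) (use inner_blocks(1)[OF Bas_mem(1) z Bas_mem(1) z] in \<open>simp add: mul_commute[of z] PP inner_commute\<close>)
  have 2: "(\<Sum>b\<in>Bas V2. (z \<odot> b) \<bullet> (z \<odot> b)) = \<gamma> + \<delta>"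
    unfolding \<gamma>_def \<delta>_def sum.distrib[symmetric]
    by (intro sum.cong refl) (use inner_blocks(2)[OF Bas_mem(2) z Bas_mem(2) z] in \<open>simp add: mul_commute[of z] PP inner_commute\<close>)
  have "(\<Sum>b\<in>Bas V3. (z \<odot> b) \<bullet> (z \<odot> b))
     = (\<Sum>b\<in>Bas V3. (z \<bullet> b) * (z \<bullet> b) + P1 (z \<odot> b) \<bullet> (z \<odot> b) + P2 (z \<odot> b) \<bullet> (z \<odot> b))"
    by (intro sum.cong refl) (use inner_blocks(3)[OF z Bas_mem(3) z Bas_mem(3)] in \<open>simp add: PP inner_commute\<close>)
  then have 3: "(\<Sum>b\<in>Bas V3. (z \<odot> b) \<bullet> (z \<odot> b)) = z \<bullet> z + \<beta> + \<delta>"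
    unfolding \<beta>_def \<delta>_def sum.distrib
    by (simp add: parseval_in sub3 z sum_swap[OF sub3 sub1] sum_swap[OF sub3 sub2])
  have a: "\<gamma> = \<alpha>" unfolding \<gamma>_def \<alpha>_def by (rule sum_swap[OF sub2 sub1])
  have b: "3 * \<alpha> + \<beta> = 3 * real (dim V1) * (z \<bullet> z)"
  proof -
    have "3 * \<alpha> + \<beta> = (\<Sum>b\<in>Bas V1. 3 * (P2 (z \<odot> b) \<bullet> (z \<odot> b)) + P3 (z \<odot> b) \<bullet> (z \<odot> b))"
      unfolding \<alpha>_def \<beta>_def by (simp add: sum.distrib sum_distrib_left)
    also have "\<dots> = (\<Sum>b\<in>Bas V1. 3 * (z \<bullet> z))"
      by (intro sum.cong refl) (use norm_mul_13[OF Bas_mem(1) z] in \<open>simp add: mul_commute[of z] PP inner_commute Bas_norm'\<close>)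
    finally show ?thesis by (simp add: card_Bas sub1)
  qed
  have d: "\<delta> = real (dim V2) * (z \<bullet> z) + 2 * \<gamma> + 1/2 * (w \<bullet> (z \<odot> z))"
  proof -
    have "\<delta> = (\<Sum>b\<in>Bas V2. z \<bullet> z + 2 * (P1 (z \<odot> b) \<bullet> (z \<odot> b)) + 1/2 * (m b b \<bullet> (z \<odot> z)))"
      unfolding \<delta>_def
    proof (intro sum.cong refl)
      fix b assume b: "b \<in> Bas V2"
      show "P3 (z \<odot> b) \<bullet> (z \<odot> b) = z \<bullet> z + 2 * (P1 (z \<odot> b) \<bullet> (z \<odot> b)) + 1/2 * (m b b \<bullet> (z \<odot> z))"
        using norm_mul_23_V3[OF Bas_mem(2)[OF b] Bas_mem(2)[OF b] z z] Bas_norm'(2)[OF b]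
        unfolding PP by (simp add: mul_commute[of z b] m_def)
    qed
    also have "\<dots> = real (dim V2) * (z \<bullet> z) + 2 * \<gamma> + 1/2 * (\<Sum>b\<in>Bas V2. m b b \<bullet> (z \<odot> z))"
      unfolding \<gamma>_def by (simp only: sum.distrib sum_distrib_left) (simp add: card_Bas sub2)
    finally show ?thesis by (simp add: w_def inner_sum_left)
  qed
  show ?thesis
    unfolding gram_split 1 2 3 q0_def using a b d z
    by (simp add: mul_commute[of z e] mul_e3 algebra_simps)
qed

lemma gram_diag_polar:
  shows gram_11: "x \<in> V1 \<Longrightarrow> x' \<in> V1 \<Longrightarrow> gram x x' = q0 * (x \<bullet> x')"
    and gram_22: "y \<in> V2 \<Longrightarrow> y' \<in> V2 \<Longrightarrow> gram y y' = q0 * (y \<bullet> y') - w \<bullet> (y \<odot> y')"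
    and gram_33: "z \<in> V3 \<Longrightarrow> z' \<in> V3 \<Longrightarrow> gram z z' = q0 * (z \<bullet> z') + w \<bullet> (z \<odot> z')"
proof -
  note l = linear_iff gram_linear mul_linear inner_linear
  show "gram x x' = q0 * (x \<bullet> x')" if "x \<in> V1" "x' \<in> V1"
    using polarize2[where V = V1 and B = "\<lambda>u v. gram u v - q0 * (u \<bullet> v)", OF _ _ sub1 _ that]
    by (simp add: l gram_commute inner_commute gram_11_diag algebra_simps)
  show "gram y y' = q0 * (y \<bullet> y') - w \<bullet> (y \<odot> y')" if "y \<in> V2" "y' \<in> V2"
    using polarize2[where V = V2 and B = "\<lambda>u v. gram u v - q0 * (u \<bullet> v) + w \<bullet> (u \<odot> v)", OF _ _ sub2 _ that]
    by (simp add: l gram_commute inner_commute mul_commute gram_22_diag algebra_simps)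
  show "gram z z' = q0 * (z \<bullet> z') + w \<bullet> (z \<odot> z')" if "z \<in> V3" "z' \<in> V3"
    using polarize2[where V = V3 and B = "\<lambda>u v. gram u v - q0 * (u \<bullet> v) - w \<bullet> (u \<odot> v)", OF _ _ sub3 _ that]
    by (simp add: l gram_commute inner_commute mul_commute gram_33_diag algebra_simps)
qed

text \<open>All multiples of \<open>w\<close> must cancel, sorted by degree in the four components
  of \<open>u\<close>. Terms with two factors \<open>z\<close> and one \<open>x\<close> are
  controlled by \<open>anti_w\<close>, those cubic in \<open>z\<close> by \<open>cubic_w\<close>,
  those with one each of \<open>x\<close>, \<open>y\<close>, \<open>z\<close> by
  \<open>w_swap\<close>, and those with one \<open>y\<close> and two \<open>z\<close> by
  \<open>norm_mul_23_V2\<close>.\<close>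

lemma gram_square_blocks:
  fixes t :: real
  assumes x: "x \<in> V1" and y: "y \<in> V2" and z: "z \<in> V3"
  defines "u \<equiv> t *\<^sub>R e + x + y + z"
  shows "gram u (u \<odot> u) = q0 * ((u \<odot> u) \<bullet> u)"
proof -
  define a0 b0 c0 where "a0 = 2 *\<^sub>R P1 (y \<odot> z) + P1 (z \<odot> z)"
    and "b0 = 2 *\<^sub>R P2 (x \<odot> z) + P2 (y \<odot> y) + P2 (z \<odot> z)"
    and "c0 = 2 *\<^sub>R (x \<odot> y) + 2 *\<^sub>R P3 (x \<odot> z) + 2 *\<^sub>R P3 (y \<odot> z)"
  define a b c where "a = (-4 * t) *\<^sub>R x + a0" and "b = (-2 * t) *\<^sub>R y + b0" and "c = (2 * t) *\<^sub>R z + c0"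
  define T where "T = 2 * t^2 - 2 * (x \<bullet> x) - y \<bullet> y + z \<bullet> z"
  have abc: "a \<in> V1" "b \<in> V2" "c \<in> V3"
    using x y z unfolding a_def b_def c_def a0_def b0_def c0_def
    by (intro sub_closed mul_12_in P_in; simp)+
  have uu: "u \<odot> u = T *\<^sub>R e + a + b + c"
  proof -
    define v where "v = x + y + z"
    have ev: "e \<odot> v = -2 *\<^sub>R x - y + z" unfolding v_def using x y z by (simp add: mul_linear mul_e1 mul_e2 mul_e3)
    have u: "u = t *\<^sub>R e + v" by (simp add: u_def v_def)
    have vv: "v \<odot> v = (-2 * (x \<bullet> x) - y \<bullet> y + z \<bullet> z) *\<^sub>R e + a0 + b0 + c0"
      unfolding v_def a0_def b0_def c0_def by (rule square_blocks[OF x y z])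
    have "u \<odot> u = (2 * t^2) *\<^sub>R e + (2 * t) *\<^sub>R (e \<odot> v) + v \<odot> v"
    proof -
      have "u \<odot> u = v \<odot> v + (2 * t) *\<^sub>R (v \<odot> e) + t^2 *\<^sub>R (e \<odot> e)"
        using square_expand[of v t e] by (simp add: u add.commute)
      then show ?thesis by (simp add: mul_ee mul_commute[of v e] algebra_simps)
    qed
    then show ?thesis
      unfolding ev vv T_def a_def b_def c_def
      by (simp add: scaleR_add_left scaleR_add_right scaleR_diff_left scaleR_diff_right algebra_simps)
  qed
  have cubic: "(u \<odot> u) \<bullet> u = T * t + a \<bullet> x + b \<bullet> y + c \<bullet> z"
    using block_inner[OF abc x y z, of T t] unfolding u_def[symmetric] uu[symmetric] .
  have gs: "gram e e = q0" "gram e a = 0" "gram e b = -2 * (w \<bullet> b)" "gram e c = 0"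
    "gram x e = 0" "gram x a = q0 * (x \<bullet> a)" "gram x b = 0" "gram x c = -2 * (w \<bullet> (x \<odot> c))"
    "gram y e = -2 * (w \<bullet> y)" "gram y a = 0" "gram y b = q0 * (y \<bullet> b) - w \<bullet> (y \<odot> b)" "gram y c = 0"
    "gram z e = 0" "gram z a = -2 * (w \<bullet> (a \<odot> z))" "gram z b = 0" "gram z c = q0 * (z \<bullet> c) + w \<bullet> (z \<odot> c)"
    using x y z abc gram_commute gram_ee gram_e1 gram_e2 gram_e3 gram_11 gram_12 gram_13 gram_22 gram_23 gram_33
    by metis+
  \<comment> \<open>The part proportional to \<open>q0\<close> reassembles to the cubic; what is
    left over is linear in \<open>w\<close>.\<close>
  have g: "gram u (u \<odot> u) = q0 * ((u \<odot> u) \<bullet> u) - 2 * t * (w \<bullet> b) - 2 * T * (w \<bullet> y) - w \<bullet> (y \<odot> b)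
      - 2 * (w \<bullet> (x \<odot> c)) - 2 * (w \<bullet> (a \<odot> z)) + w \<bullet> (z \<odot> c)"
    unfolding cubic unfolding uu unfolding u_def
    unfolding gram_linear gs by (simp add: algebra_simps inner_commute)
  define k h mm yw where "k = w \<bullet> (x \<odot> z)" and "h = w \<bullet> (z \<odot> z)" and "mm = w \<bullet> (y \<odot> y)" and "yw = w \<bullet> y"
  define q where "q = (x \<odot> w) \<bullet> (y \<odot> z)"
  define r1 r2 where "r1 = m y w \<bullet> (x \<odot> z)" and "r2 = m y w \<bullet> (z \<odot> z)"
  define p1 p3 where "p1 = P1 (y \<odot> z) \<bullet> P1 (w \<odot> z)" and "p3 = P3 (y \<odot> z) \<bullet> P3 (w \<odot> z)"
  have wP: "w \<bullet> P2 u = w \<bullet> u" for u by (simp add: proj_inner' sub2)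
  have e1: "w \<bullet> b = - 2 * t * yw + 2 * k + mm + h"
    unfolding b_def b0_def k_def h_def mm_def yw_def by (simp add: inner_linear wP)
  have e2: "w \<bullet> (y \<odot> b) = - 2 * t * mm + 2 * r1 + 2 * (y \<bullet> y) * yw + r2"
  proof -
    have "w \<bullet> (y \<odot> b) = m y w \<bullet> b" using abc(2) unfolding m_def by simp (metis mul_inner mul_commute)
    also have "\<dots> = -2 * t * (m y w \<bullet> y) + 2 * (m y w \<bullet> (x \<odot> z)) + m y w \<bullet> m y y + m y w \<bullet> (z \<odot> z)"
      unfolding b_def b0_def by (simp add: inner_linear proj_inner' sub2 m_def)
    also have "m y w \<bullet> y = mm" unfolding mm_def m_def using y by simp (metis mul_inner mul_commute)
    finally show ?thesis using norm_m_1[OF y w_in] by (simp add: r1_def r2_def yw_def inner_commute)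
  qed
  have e3: "w \<bullet> (x \<odot> c) = 2 * t * k + 2 * (x \<bullet> x) * yw + 2 * q"
  proof -
    have xw: "x \<odot> w \<in> V3" by (rule mul_12_in[OF x w_in])
    have "w \<bullet> (x \<odot> c) = (x \<odot> w) \<bullet> c" by (metis mul_inner mul_commute)
    also have "\<dots> = 2 * t * ((x \<odot> w) \<bullet> z) + 2 * ((x \<odot> w) \<bullet> (x \<odot> y)) + 2 * ((x \<odot> w) \<bullet> (x \<odot> z)) + 2 * q"
      unfolding c_def c0_def q_def using xw by (simp add: inner_linear proj_inner' sub3)
    also have "(x \<odot> w) \<bullet> z = k" unfolding k_def by (metis mul_inner mul_commute)
    finally show ?thesis
      using norm_mul_12_V2[OF x x w_in y] mixed_211[OF x w_in z] by (simp add: yw_def)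
  qed
  have e4: "w \<bullet> (a \<odot> z) = - 4 * t * k + 2 * p1"
  proof -
    have "w \<bullet> (a \<odot> z) = a \<bullet> P1 (w \<odot> z)"
      using abc(1) by (simp add: proj_inner' sub1) (metis mul_inner mul_commute inner_commute)
    also have "\<dots> = -4 * t * (x \<bullet> P1 (w \<odot> z)) + 2 * p1 + (z \<odot> z) \<bullet> P1 (w \<odot> z)"
      unfolding a_def a0_def p1_def by (simp add: inner_linear proj_symmetric proj_id sub1)
    also have "x \<bullet> P1 (w \<odot> z) = k"
      unfolding k_def using x by (simp add: proj_inner' sub1) (metis mul_inner mul_commute inner_commute)
    finally show ?thesis by (simp add: cubic_w[OF z])
  qed
  have e5: "w \<bullet> (z \<odot> c) = 2 * t * h + 2 * q + 2 * p3"
  proof -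
    have "w \<bullet> (z \<odot> c) = (w \<odot> z) \<bullet> c" by (metis mul_inner)
    also have "\<dots> = 2 * t * ((w \<odot> z) \<bullet> z) + 2 * ((w \<odot> z) \<bullet> (x \<odot> y)) + 2 * ((w \<odot> z) \<bullet> P3 (x \<odot> z)) + 2 * p3"
      unfolding c_def c0_def p3_def by (simp add: inner_linear proj_inner' sub3 inner_commute)
    also have "(w \<odot> z) \<bullet> z = h" unfolding h_def by (metis mul_inner)
    finally show ?thesis
      using anti_w[OF x z] w_swap[OF x y z] by (simp add: q_def inner_commute)
  qed
  \<comment> \<open>The terms of \<open>e1\<close> to \<open>e5\<close> that do not cancel on sight
    satisfy two relations: \<open>f1\<close> for degree two in \<open>z\<close>, \<open>f2\<close>
    for degree one in each of \<open>x\<close>, \<open>y\<close>, \<open>z\<close>.\<close>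
  have f1: "p3 = yw * (z \<bullet> z) + 2 * p1 + 1/2 * r2"
    using norm_mul_23_V2[OF y w_in z z] by (simp add: p3_def p1_def r2_def yw_def m_def inner_commute)
  have f2: "2 * q = - 2 * r1"
    using mixed_121_polar[OF x y w_in z] w_swap[OF x y z] by (simp add: q_def r1_def m_def)
  have "- 2 * t * (w \<bullet> b) - 2 * T * (w \<bullet> y) - w \<bullet> (y \<odot> b)
      - 2 * (w \<bullet> (x \<odot> c)) - 2 * (w \<bullet> (a \<odot> z)) + w \<bullet> (z \<odot> c) = 0"
    unfolding e1 e2 e3 e4 e5 T_def yw_def[symmetric] using f1 f2 by algebra
  then show ?thesis using g by simp
qed

lemma gram_square: "gram u (u \<odot> u) = q0 * ((u \<odot> u) \<bullet> u)"
  using gram_square_blocks[of "P1 u" "P2 u" "P3 u" "u \<bullet> e"] od_expand[of u] by simp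

text \<open>By \<open>dim_total\<close>, \<open>n + 6 - q0\<close> equals
  \<open>-3 * (dim V1 - 1)\<close>; the dimension of \<open>V2\<close> drops out.\<close>

theorem cube_trace:
  "(\<Sum>b\<in>Basis. (u \<odot> (u \<odot> b)) \<bullet> (u \<odot> b)) = -3 * (real (dim V1) - 1) * ((u \<odot> u) \<bullet> u)"
  using cube_trace_gram[of u] gram_square[of u] dim_total unfolding q0_def
  by (simp add: algebra_simps)

end

section \<open>Homogeneous cubics and their products\<close>

text \<open>The induction carries the partial derivatives along as polynomials, so that they can be
  differentiated again.\<close>

lemma real_polynomial_function_has_derivative:
  fixes f :: "real ^ 'n \<Rightarrow> real"
  assumes "real_polynomial_function f"
  shows "\<exists>D. (\<forall>i. real_polynomial_function (D i)) \<and>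
    (\<forall>x. (f has_derivative (\<lambda>h. \<Sum>i\<in>UNIV. h $ i * D i x)) (at x))"
  using assms
proof induction
  case (linear f)
  have lf: "linear f" using bounded_linear.linear[OF linear] .
  have "f h = (\<Sum>i\<in>UNIV. h $ i * f (axis i 1))" for h
  proof -
    have "f h = f (\<Sum>i\<in>UNIV. h $ i *\<^sub>R axis i 1)"
      by (simp only: scalar_mult_eq_scaleR[symmetric] basis_expansion)
    also have "\<dots> = (\<Sum>i\<in>UNIV. h $ i * f (axis i 1))"
      by (simp add: linear_sum[OF lf] linear_scale[OF lf])
    finally show ?thesis .
  qed
  then have eq: "(\<lambda>h. \<Sum>i\<in>UNIV. h $ i * f (axis i 1)) = f" by (intro ext) metis
  have "\<forall>x. (f has_derivative (\<lambda>h. \<Sum>i\<in>UNIV. h $ i * f (axis i 1))) (at x)"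
    unfolding eq using bounded_linear_imp_has_derivative[OF linear] by blast
  then show ?case
    by (intro exI[of _ "\<lambda>i x. f (axis i 1)"] conjI allI real_polynomial_function.intros(2)) blast
next
  case (const c)
  show ?case by (intro exI[of _ "\<lambda>i x. 0"] conjI allI real_polynomial_function.intros(2)) simp
next
  case (add f g)
  then obtain D E where D: "\<forall>i. real_polynomial_function (D i)"
    "\<forall>x. (f has_derivative (\<lambda>h. \<Sum>i\<in>UNIV. h $ i * D i x)) (at x)"
    and E: "\<forall>i. real_polynomial_function (E i)"
    "\<forall>x. (g has_derivative (\<lambda>h. \<Sum>i\<in>UNIV. h $ i * E i x)) (at x)" by blast
  have "((\<lambda>x. f x + g x) has_derivative (\<lambda>h. \<Sum>i\<in>UNIV. h $ i * (D i x + E i x))) (at x)" for x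
    using has_derivative_add[OF D(2)[rule_format] E(2)[rule_format]]
    by (simp add: distrib_left sum.distrib)
  then show ?case using D(1) E(1)
    by (intro exI[of _ "\<lambda>i x. D i x + E i x"] conjI allI real_polynomial_function.intros(3)) simp_all
next
  case (mult f g)
  then obtain D E where D: "\<forall>i. real_polynomial_function (D i)"
    "\<forall>x. (f has_derivative (\<lambda>h. \<Sum>i\<in>UNIV. h $ i * D i x)) (at x)"
    and E: "\<forall>i. real_polynomial_function (E i)"
    "\<forall>x. (g has_derivative (\<lambda>h. \<Sum>i\<in>UNIV. h $ i * E i x)) (at x)" by blast
  have "((\<lambda>x. f x * g x) has_derivative (\<lambda>h. \<Sum>i\<in>UNIV. h $ i * (f x * E i x + D i x * g x))) (at x)" for x
    using has_derivative_mult[OF D(2)[rule_format, of x] E(2)[rule_format, of x]]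
    by (simp add: algebra_simps sum.distrib sum_distrib_left)
  then show ?case using D(1) E(1) mult.hyps
    by (intro exI[of _ "\<lambda>i x. f x * E i x + D i x * g x"] conjI allI
        real_polynomial_function.intros(3) real_polynomial_function.intros(4)) simp_all
qed

lemma has_derivative_partials:
  fixes f :: "real ^ 'n \<Rightarrow> real"
  assumes "(f has_derivative (\<lambda>h. \<Sum>i\<in>UNIV. h $ i * D i)) (at x)"
  shows "partial i f x = D i"
proof -
  have "partial i f x = (\<Sum>j\<in>UNIV. axis i 1 $ j * D j)"
    unfolding partial_def using frechet_derivative_at[OF assms] by metis
  also have "\<dots> = (\<Sum>j\<in>UNIV. if j = i then D j else 0)"
    by (intro sum.cong refl) (simp add: axis_def)
  finally show ?thesis by simp
qed

lemma real_polynomial_function_partials: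
  fixes f :: "real ^ 'n \<Rightarrow> real"
  assumes "real_polynomial_function f"
  shows real_polynomial_function_partial: "real_polynomial_function (partial i f)"
    and has_derivative_partial: "(f has_derivative (\<lambda>h. \<Sum>i\<in>UNIV. h $ i * partial i f x)) (at x)"
proof -
  obtain D where D: "\<forall>i. real_polynomial_function (D i)"
    "\<forall>x. (f has_derivative (\<lambda>h. \<Sum>i\<in>UNIV. h $ i * D i x)) (at x)"
    using real_polynomial_function_has_derivative[OF assms] by blast
  have p: "partial i f = D i" for i
    by (rule ext) (use D(2) in \<open>intro has_derivative_partials; blast\<close>)
  show "real_polynomial_function (partial i f)" using D(1) by (simp add: p)
  show "(f has_derivative (\<lambda>h. \<Sum>i\<in>UNIV. h $ i * partial i f x)) (at x)" using D(2) by (simp add: p)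
qed

lemma has_real_derivative_line:
  fixes f :: "real ^ 'n \<Rightarrow> real"
  assumes "real_polynomial_function f"
  shows "((\<lambda>s. f (y + s *\<^sub>R h)) has_real_derivative (\<Sum>i\<in>UNIV. h $ i * partial i f (y + t *\<^sub>R h))) (at t)"
proof -
  have "((\<lambda>s. y + s *\<^sub>R h) has_derivative (\<lambda>s. s *\<^sub>R h)) (at t)"
    by (auto intro!: derivative_eq_intros)
  from has_derivative_compose[OF this has_derivative_partial[OF assms]]
  have "((\<lambda>s. f (y + s *\<^sub>R h)) has_derivative (\<lambda>s. \<Sum>i\<in>UNIV. (s *\<^sub>R h) $ i * partial i f (y + t *\<^sub>R h))) (at t)" .
  then show ?thesis
    unfolding has_field_derivative_def
    by (rule has_derivative_eq_rhs) (auto simp: sum_distrib_left sum_distrib_right mult_ac)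
qed

lemma homogeneous_poly_euler:
  fixes f :: "real ^ 'n \<Rightarrow> real"
  assumes "homogeneous_poly d f"
  shows "real d * f x = (\<Sum>i\<in>UNIV. x $ i * partial i f x)"
proof -
  have f: "real_polynomial_function f" "\<And>t x. f (t *\<^sub>R x) = t ^ d * f x"
    using assms unfolding homogeneous_poly_def by auto
  have "((\<lambda>s. f (0 + s *\<^sub>R x)) has_real_derivative (\<Sum>i\<in>UNIV. x $ i * partial i f (0 + 1 *\<^sub>R x))) (at 1)"
    by (rule has_real_derivative_line[OF f(1)])
  moreover have "((\<lambda>s. s ^ d * f x) has_real_derivative real d * f x) (at 1)"
    by (auto intro!: derivative_eq_intros)
  ultimately show ?thesis using DERIV_unique by (fastforce simp: f(2))
qed

lemma homogeneous_poly_partial: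
  fixes f :: "real ^ 'n \<Rightarrow> real"
  assumes "homogeneous_poly (Suc d) f"
  shows "homogeneous_poly d (partial i f)"
proof -
  have f: "real_polynomial_function f" "\<And>t x. f (t *\<^sub>R x) = t ^ Suc d * f x"
    using assms unfolding homogeneous_poly_def by auto
  have p: "real_polynomial_function (partial i f)" by (rule real_polynomial_function_partial[OF f(1)])
  have line: "((\<lambda>s. f (y + s *\<^sub>R (r *\<^sub>R axis i 1))) has_real_derivative r * partial i f y) (at 0)" for y r
  proof -
    have "(\<Sum>j\<in>UNIV. (r *\<^sub>R axis i 1) $ j * partial j f (y + 0 *\<^sub>R (r *\<^sub>R axis i 1)))
      = (\<Sum>j\<in>UNIV. if j = i then r * partial j f y else 0)"
      by (intro sum.cong refl) (simp add: axis_def)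
    then show ?thesis using has_real_derivative_line[OF f(1), of y "r *\<^sub>R axis i 1" 0] by simp
  qed
  have nz: "partial i f (t *\<^sub>R x) = t ^ d * partial i f x" if "t \<noteq> 0" for t x
  proof -
    have eq: "(\<lambda>s. f (t *\<^sub>R x + s *\<^sub>R (t *\<^sub>R axis i 1))) = (\<lambda>s. t ^ Suc d * f (x + s *\<^sub>R (1 *\<^sub>R axis i 1)))"
      unfolding f(2)[symmetric] by (rule ext) (simp add: scaleR_add_right mult.commute)
    have "((\<lambda>s. t ^ Suc d * f (x + s *\<^sub>R (1 *\<^sub>R axis i 1))) has_real_derivative t * partial i f (t *\<^sub>R x)) (at 0)"
      using line[of "t *\<^sub>R x" t] unfolding eq .
    moreover have "((\<lambda>s. t ^ Suc d * f (x + s *\<^sub>R (1 *\<^sub>R axis i 1))) has_real_derivative t ^ Suc d * (1 * partial i f x)) (at 0)"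
      by (rule DERIV_cmult[OF line])
    ultimately have "t * partial i f (t *\<^sub>R x) = t ^ Suc d * (1 * partial i f x)"
      by (rule DERIV_unique)
    then show ?thesis using that by simp
  qed
  \<comment> \<open>The comparison of derivatives determines the scaled value only after division by
    \<open>t\<close>. At \<open>t = 0\<close> continuity takes over; for \<open>d = 0\<close> the
    convention \<open>0 ^ 0 = 1\<close> makes this say that the derivative is constant.\<close>
  have "partial i f (0 *\<^sub>R x) = 0 ^ d * partial i f x" for x
  proof -
    have "isCont (\<lambda>t. partial i f (t *\<^sub>R x)) 0"
    proof (rule isCont_o2[where g = "partial i f"])
      show "isCont (\<lambda>t. t *\<^sub>R x) 0" by (intro continuous_intros)
      show "isCont (partial i f) (0 *\<^sub>R x)" by (rule continuous_real_polymonial_function[OF p])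
    qed
    then have 1: "((\<lambda>t. partial i f (t *\<^sub>R x)) \<longlongrightarrow> partial i f (0 *\<^sub>R x)) (at 0)"
      unfolding isCont_def .
    have "((\<lambda>t::real. t ^ d * partial i f x) \<longlongrightarrow> 0 ^ d * partial i f x) (at 0)"
      by (intro tendsto_intros)
    moreover have "eventually (\<lambda>t. t ^ d * partial i f x = partial i f (t *\<^sub>R x)) (at 0)"
      unfolding eventually_at by (rule exI[of _ 1]) (simp add: nz)
    ultimately have "((\<lambda>t. partial i f (t *\<^sub>R x)) \<longlongrightarrow> 0 ^ d * partial i f x) (at 0)"
      by (rule Lim_transform_eventually)
    then show ?thesis by (rule LIM_unique[OF 1])
  qed
  then have "partial i f (t *\<^sub>R x) = t ^ d * partial i f x" for t x
    using nz by (cases "t = 0") auto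
  then show ?thesis using p unfolding homogeneous_poly_def by blast
qed

text \<open>Euler's identity is applied three times, with degrees 3, 2 and 1. The third partial
  derivatives are homogeneous of degree 0, hence constant, and the accumulated factor is
  1/6.\<close>

lemma homogeneous_cubic_coefficients:
  fixes f :: "real ^ 'n \<Rightarrow> real"
  assumes "homogeneous_poly 3 f"
  shows "\<exists>a. \<forall>x. f x = (\<Sum>i\<in>UNIV. \<Sum>j\<in>UNIV. \<Sum>k\<in>UNIV. a i j k * (x $ i * x $ j * x $ k))"
proof -
  define D2 D3 where "D2 i j = partial j (partial i f)" and "D3 i j k = partial k (D2 i j)" for i j k
  have h2: "homogeneous_poly 2 (partial i f)" for i
    using homogeneous_poly_partial[of 2 f i] assms by (simp add: eval_nat_numeral)
  have h1: "homogeneous_poly 1 (D2 i j)" for i j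
    unfolding D2_def using homogeneous_poly_partial[of 1 "partial i f" j] h2[of i] by (simp add: eval_nat_numeral)
  have h0: "homogeneous_poly 0 (D3 i j k)" for i j k
    unfolding D3_def using homogeneous_poly_partial[of 0 "D2 i j" k] h1[of i j] by simp
  have c: "D3 i j k x = D3 i j k 0" for i j k x
  proof -
    have "D3 i j k (0 *\<^sub>R x) = 0 ^ 0 * D3 i j k x" using h0[of i j k] unfolding homogeneous_poly_def by blast
    then show ?thesis by simp
  qed
  have e1: "D2 i j x = (\<Sum>k\<in>UNIV. x $ k * D3 i j k 0)" for i j x
    using homogeneous_poly_euler[OF h1[of i j], of x] by (simp add: D3_def[symmetric] c[of _ _ _ x])
  have e2: "partial i f x = 1/2 * (\<Sum>j\<in>UNIV. x $ j * D2 i j x)" for i x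
    using homogeneous_poly_euler[OF h2[of i], of x] by (simp add: D2_def)
  have e3: "f x = 1/3 * (\<Sum>i\<in>UNIV. x $ i * partial i f x)" for x
    using homogeneous_poly_euler[OF assms, of x] by simp
  have "f x = (\<Sum>i\<in>UNIV. \<Sum>j\<in>UNIV. \<Sum>k\<in>UNIV. (D3 i j k 0 / 6) * (x $ i * x $ j * x $ k))" for x
    unfolding e3[of x] e2 e1
    by (simp add: sum_distrib_left sum_distrib_right mult_ac sum_divide_distrib)
  then show ?thesis by (intro exI[of _ "\<lambda>i j k. D3 i j k 0 / 6"] allI)
qed

section \<open>Cubic forms as commutative products, and their differential operators\<close>

lemma sum_Basis_vec:
  fixes g :: "real ^ 'n \<Rightarrow> real"
  shows "(\<Sum>b\<in>Basis. g b) = (\<Sum>i\<in>UNIV. g (axis i 1))"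
proof -
  have 1: "(Basis :: (real ^ 'n) set) = (\<lambda>i. axis i 1) ` UNIV" by (auto simp: Basis_vec_def)
  have 2: "inj (\<lambda>i. axis i (1::real) :: real ^ 'n)" by (auto intro!: injI simp: axis_eq_axis)
  show ?thesis unfolding 1 by (subst sum.reindex[OF 2]) simp
qed

text \<open>The coefficient form \<open>T\<close> is symmetrised over the six permutations, which
  makes the product commutative and the inner product invariant; \<open>mul x y\<close> represents
  the functional \<open>S x y\<close>. The factor \<open>c / 3\<close> is chosen so that
  \<open>S x x x = 2 * c * f x\<close>.\<close>

lemma cubic_form_product:
  fixes f :: "real ^ 'n \<Rightarrow> real"
  assumes "homogeneous_poly 3 f" and "c \<noteq> 0"
  shows "\<exists>mul. metrised_algebra mul \<and> (\<forall>x. c * f x = (mul x x \<bullet> x) / 2)"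
proof -
  obtain a where a: "\<And>x. f x = (\<Sum>i\<in>UNIV. \<Sum>j\<in>UNIV. \<Sum>k\<in>UNIV. a i j k * (x $ i * x $ j * x $ k))"
    using homogeneous_cubic_coefficients[OF assms(1)] by blast
  define T where "T x y z = (\<Sum>i\<in>UNIV. \<Sum>j\<in>UNIV. \<Sum>k\<in>UNIV. a i j k * (x $ i * y $ j * z $ k))" for x y z
  have T_add: "T (x + x') y z = T x y z + T x' y z" "T x (y + y') z = T x y z + T x y' z"
    "T x y (z + z') = T x y z + T x y z'" for x x' y y' z z'
    unfolding T_def by (simp_all add: algebra_simps sum.distrib)
  have T_scale: "T (r *\<^sub>R x) y z = r * T x y z" "T x (r *\<^sub>R y) z = r * T x y z"
    "T x y (r *\<^sub>R z) = r * T x y z" for r x y z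
    unfolding T_def by (simp_all add: sum_distrib_left mult_ac)
  define S where "S x y z = c / 3 * (T x y z + T x z y + T y x z + T y z x + T z x y + T z y x)" for x y z
  define mul :: "real ^ 'n \<Rightarrow> real ^ 'n \<Rightarrow> real ^ 'n" where "mul x y = (\<chi> k. S x y (axis k 1))" for x y
  have S_linear: "linear (S x y)" for x y
    unfolding S_def by (simp add: linear_iff T_add T_scale algebra_simps add_divide_distrib)
  have mS: "mul x y \<bullet> z = S x y z" for x y z
  proof -
    have "S x y z = S x y (\<Sum>k\<in>UNIV. z $ k *\<^sub>R axis k 1)"
      by (simp only: scalar_mult_eq_scaleR[symmetric] basis_expansion)
    also have "\<dots> = (\<Sum>k\<in>UNIV. z $ k * S x y (axis k 1))"
      by (simp add: linear_sum[OF S_linear] linear_scale[OF S_linear])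
    finally show ?thesis by (simp add: inner_vec_def mul_def mult.commute)
  qed
  have "metrised_algebra mul"
  proof
    show "mul (x + y) z = mul x z + mul y z" for x y z
      by (simp add: mul_def vec_eq_iff S_def T_add algebra_simps)
    show "mul (r *\<^sub>R x) y = r *\<^sub>R mul x y" for r x y
      by (simp add: mul_def vec_eq_iff S_def T_scale algebra_simps)
    show "mul x y = mul y x" for x y
      by (simp add: mul_def vec_eq_iff S_def algebra_simps)
    show "mul x y \<bullet> z = x \<bullet> mul y z" for x y z
      unfolding mS inner_commute[of x] by (simp add: S_def algebra_simps)
  qed
  moreover have "c * f x = (mul x x \<bullet> x) / 2" for x
    unfolding mS S_def by (simp add: a T_def)
  ultimately show ?thesis by blast
qed

locale cubic_form = metrised_algebra mul
  for mul :: "real ^ 'n \<Rightarrow> real ^ 'n \<Rightarrow> real ^ 'n" (infixl "\<odot>" 76) +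
  fixes f :: "real ^ 'n \<Rightarrow> real" and c :: real
  assumes c_nonzero: "c \<noteq> 0" and cubic: "c * f x = ((x \<odot> x) \<bullet> x) / 2"
begin

lemma f_eq: "f x = 1 / (2 * c) * ((x \<odot> x) \<bullet> x)"
  using cubic[of x] c_nonzero by (simp add: field_simps)

lemma partial_f: "partial i f x = 3 / (2 * c) * ((x \<odot> x) \<bullet> axis i 1)"
proof -
  have "((\<lambda>x. 1 / (2 * c) * ((x \<odot> x) \<bullet> x)) has_derivative
      (\<lambda>h. 1 / (2 * c) * ((x \<odot> x) \<bullet> h + (x \<odot> h + h \<odot> x) \<bullet> x))) (at x)"
    by (rule has_derivative_mult_right has_derivative_inner bounded_bilinear.FDERIV[OF bounded_bilinear_mul]
        has_derivative_ident)+
  then have "(f has_derivative (\<lambda>h. 1 / (2 * c) * ((x \<odot> x) \<bullet> h + (x \<odot> h + h \<odot> x) \<bullet> x))) (at x)"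
    by (subst ext[of f, OF f_eq])
  from frechet_derivative_at[OF this, symmetric]
  have "partial i f x = 1 / (2 * c) * ((x \<odot> x) \<bullet> axis i 1 + (x \<odot> axis i 1 + axis i 1 \<odot> x) \<bullet> x)"
    unfolding partial_def by simp
  moreover have "(x \<odot> axis i 1) \<bullet> x = (x \<odot> x) \<bullet> axis i 1" by (rule trilinear_swap)
  ultimately show ?thesis unfolding mul_commute[of "axis i 1"] inner_add_left by simp
qed

lemma partial_partial_f: "partial j (partial i f) x = 3 / c * ((x \<odot> axis i 1) \<bullet> axis j 1)"
proof -
  have "((\<lambda>x. 3 / (2 * c) * ((x \<odot> x) \<bullet> axis i 1)) has_derivative
      (\<lambda>h. 3 / (2 * c) * ((x \<odot> x) \<bullet> 0 + (x \<odot> h + h \<odot> x) \<bullet> axis i 1))) (at x)"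
    by (rule has_derivative_mult_right has_derivative_inner bounded_bilinear.FDERIV[OF bounded_bilinear_mul]
        has_derivative_ident has_derivative_const)+
  then have "(partial i f has_derivative (\<lambda>h. 3 / (2 * c) * ((x \<odot> x) \<bullet> 0 + (x \<odot> h + h \<odot> x) \<bullet> axis i 1))) (at x)"
    by (subst ext[of "partial i f", OF partial_f])
  from frechet_derivative_at[OF this, symmetric]
  have "partial j (partial i f) x = 3 / (2 * c) * ((x \<odot> axis j 1 + axis j 1 \<odot> x) \<bullet> axis i 1)"
    unfolding partial_def[of j] by simp
  moreover have "(x \<odot> axis j 1) \<bullet> axis i 1 = (x \<odot> axis i 1) \<bullet> axis j 1" by (rule trilinear_swap)
  ultimately show ?thesis unfolding mul_commute[of "axis j 1"] inner_add_left by simp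
qed

text \<open>The gradient is \<open>3 / (2 * c)\<close> times \<open>x \<odot> x\<close> and the
  Hessian is \<open>3 / c\<close> times multiplication by \<open>x\<close>, so both terms carry
  \<open>27 / (4 * c^3)\<close>. The double sum is the Hessian form at the gradient, which becomes
  the quintic.\<close>

lemma L_op_f: "L_op f x = 27 / (4 * c^3) * (((x \<odot> x) \<bullet> (x \<odot> x)) * tr x - ((x \<odot> x) \<odot> (x \<odot> x)) \<bullet> x)"
proof -
  define p where "p = x \<odot> x"
  have "gradient f x = (3 / (2 * c)) *\<^sub>R p"
    unfolding gradient_def p_def by (simp add: vec_eq_iff partial_f inner_axis)
  then have 1: "(norm (gradient f x))\<^sup>2 = 9 / (4 * c^2) * (p \<bullet> p)"
    by (simp add: power_mult_distrib power_divide dot_square_norm)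
  have 2: "laplacian f x = 3 / c * tr x"
    unfolding laplacian_def tr_def sum_Basis_vec by (simp add: partial_partial_f sum_distrib_left)
  have "(\<Sum>i\<in>UNIV. \<Sum>j\<in>UNIV. partial i f x * partial j f x * partial j (partial i f) x)
     = 27 / (4 * c^3) * (\<Sum>i\<in>UNIV. \<Sum>j\<in>UNIV. p $ i * p $ j * ((x \<odot> axis i 1) \<bullet> axis j 1))"
    unfolding sum_distrib_left partial_f partial_partial_f p_def[symmetric]
    by (intro sum.cong refl) (simp add: inner_axis power3_eq_cube)
  also have "(\<Sum>i\<in>UNIV. \<Sum>j\<in>UNIV. p $ i * p $ j * ((x \<odot> axis i 1) \<bullet> axis j 1)) = (x \<odot> p) \<bullet> p"
  proof -
    have ex: "p = (\<Sum>i\<in>UNIV. p $ i *\<^sub>R axis i 1)"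
      by (simp only: scalar_mult_eq_scaleR[symmetric] basis_expansion)
    have "(x \<odot> p) \<bullet> p = (x \<odot> (\<Sum>i\<in>UNIV. p $ i *\<^sub>R axis i 1)) \<bullet> (\<Sum>j\<in>UNIV. p $ j *\<^sub>R axis j 1)"
      using ex by simp
    also have "\<dots> = (\<Sum>i\<in>UNIV. \<Sum>j\<in>UNIV. p $ i * p $ j * ((x \<odot> axis i 1) \<bullet> axis j 1))"
      unfolding mul_sum_right inner_sum_left inner_sum_right
      by (intro sum.cong refl) (simp add: mul_linear, metis trilinear_swap)
    finally show ?thesis by simp
  qed
  also have "(x \<odot> p) \<bullet> p = (p \<odot> p) \<bullet> x" by (rule trilinear_rotate[of x p p, THEN trans]) simp
  finally show ?thesis
    unfolding L_op_def 1 2 p_def[symmetric]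
    by (simp add: power2_eq_square power3_eq_cube right_diff_distrib)
qed

lemma trace_hessian_cube:
  "trace (hessian f x ** hessian f x ** hessian f x) =
     27 / c^3 * (\<Sum>b\<in>Basis. (x \<odot> (x \<odot> b)) \<bullet> (x \<odot> b))"
proof -
  define g where "g v = (3 / c) *\<^sub>R (x \<odot> v)" for v
  have g: "linear g" unfolding g_def by (simp add: linear_iff mul_linear scaleR_add_right)
  have "hessian f x = matrix g"
    unfolding hessian_def matrix_def g_def
    by (simp add: vec_eq_iff partial_partial_f trilinear_swap[of x "axis _ 1" "axis _ 1"] inner_axis)
       (metis inner_axis real_inner_1_right trilinear_swap)
  then have "hessian f x ** hessian f x ** hessian f x = matrix (g \<circ> g \<circ> g)"
    using g by (simp add: matrix_compose linear_compose)
  then have "trace (hessian f x ** hessian f x ** hessian f x) = (\<Sum>i\<in>UNIV. g (g (g (axis i 1))) \<bullet> axis i 1)"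
    by (simp add: trace_def matrix_def inner_axis)
  also have "\<dots> = (\<Sum>i\<in>UNIV. 27 / c^3 * ((x \<odot> (x \<odot> axis i 1)) \<bullet> (x \<odot> axis i 1)))"
  proof (intro sum.cong refl)
    fix i :: 'n
    have "(x \<odot> (x \<odot> (x \<odot> axis i 1))) \<bullet> axis i 1 = (x \<odot> (x \<odot> axis i 1)) \<bullet> (x \<odot> axis i 1)"
      by (metis mul_inner mul_commute)
    then show "g (g (g (axis i 1))) \<bullet> axis i 1 = 27 / c^3 * ((x \<odot> (x \<odot> axis i 1)) \<bullet> (x \<odot> axis i 1))"
      unfolding g_def by (simp add: mul_linear power3_eq_cube)
  qed
  finally show ?thesis unfolding sum_Basis_vec by (simp add: sum_distrib_left)
qed

end

section \<open>From the normal form to the algebra\<close>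

lemma trihomogeneous_scale:
  assumes "trihomogeneous_poly i j k V1 V2 V3 \<psi>" "x \<in> V1" "y \<in> V2" "z \<in> V3"
  shows "\<psi> (a *\<^sub>R x, b *\<^sub>R y, d *\<^sub>R z) = a ^ i * b ^ j * d ^ k * \<psi> (x, y, z)"
  using assms unfolding trihomogeneous_poly_def by blast

lemma normal_form_hsiang:
  fixes f :: "real ^ 'n \<Rightarrow> real"
  assumes f: "radial_eigencubic f" and nf: "normal_form f e V1 V2 V3"
  shows "\<exists>mul c nu. hsiang mul e V1 V2 V3 nu \<and> cubic_form mul f c"
proof -
  have od: "orth_decomposition e V1 V2 V3" using nf unfolding normal_form_def by blast
  interpret orth_decomp e V1 V2 V3 by unfold_locales (rule od)
  note sub1 = od_subspace(1) and sub2 = od_subspace(2) and sub3 = od_subspace(3)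
  have zero: "0 \<in> V1" "0 \<in> V2" "0 \<in> V3" by (simp_all add: subspace_0 sub1 sub2 sub3)
  obtain c \<psi>111 \<psi>102 \<psi>012 \<psi>030 where c: "c \<noteq> 0"
    and \<psi>: "trihomogeneous_poly 1 1 1 V1 V2 V3 \<psi>111" "trihomogeneous_poly 1 0 2 V1 V2 V3 \<psi>102"
      "trihomogeneous_poly 0 1 2 V1 V2 V3 \<psi>012" "trihomogeneous_poly 0 3 0 V1 V2 V3 \<psi>030"
    and N: "\<forall>t. \<forall>\<xi>\<in>V1. \<forall>\<eta>\<in>V2. \<forall>\<zeta>\<in>V3. c * f (t *\<^sub>R e + \<xi> + \<eta> + \<zeta>) =
      t ^ 3 - 3 / 2 * t * (2 * (norm \<xi>)\<^sup>2 + (norm \<eta>)\<^sup>2 - (norm \<zeta>)\<^sup>2)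
      + \<psi>111 (\<xi>, \<eta>, \<zeta>) + \<psi>102 (\<xi>, \<eta>, \<zeta>) + \<psi>012 (\<xi>, \<eta>, \<zeta>) + \<psi>030 (\<xi>, \<eta>, \<zeta>)"
    using nf unfolding normal_form_def by blast
  have "homogeneous_poly 3 f" using f unfolding radial_eigencubic_def by blast
  then obtain mul where ma: "metrised_algebra mul" and cf: "\<And>x. c * f x = (mul x x \<bullet> x) / 2"
    using cubic_form_product[OF _ c] by blast
  interpret cubic_form mul f c
    by (intro cubic_form.intro ma cubic_form_axioms.intro c cf)
  define F where "F x = mul x x \<bullet> x" for x
  have NF: "F (t *\<^sub>R e + x + y + z) = 2 * t ^ 3 - 3 * t * (2 * (x \<bullet> x) + y \<bullet> y - z \<bullet> z)
      + 2 * (\<psi>111 (x, y, z) + \<psi>102 (x, y, z) + \<psi>012 (x, y, z) + \<psi>030 (x, y, z))"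
    if "x \<in> V1" "y \<in> V2" "z \<in> V3" for t x y z
    using N[rule_format, OF that, of t] cf[of "t *\<^sub>R e + x + y + z"]
    unfolding F_def by (simp add: power2_norm_eq_inner)
  have Ft: "F (t *\<^sub>R e + x + y + z) = 2 * t ^ 3 - 3 * t * (2 * (x \<bullet> x) + y \<bullet> y - z \<bullet> z) + F (x + y + z)"
    if "x \<in> V1" "y \<in> V2" "z \<in> V3" for t x y z
    using NF[OF that, of t] NF[OF that, of 0] by simp
  have F_expand: "F (x + s *\<^sub>R y) = F x + s * (3 * (mul x x \<bullet> y)) + s^2 * (3 * (mul y y \<bullet> x)) + s^3 * F y" for x y s
    unfolding F_def by (rule cubic_expand)
  have F0: "F 0 = 0" by (simp add: F_def)
  have ee: "mul e e \<bullet> e = 2" using Ft[OF zero, of 1] F0 by (simp add: F_def)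
  have key: "mul e e \<bullet> (x + y + z) = 0"
    "mul (x + y + z) (x + y + z) \<bullet> e = - (2 * (x \<bullet> x) + y \<bullet> y - z \<bullet> z)"
    if "x \<in> V1" "y \<in> V2" "z \<in> V3" for x y z
  proof -
    have "F ((x + y + z) + s *\<^sub>R e) = 2 * s ^ 3 - 3 * s * (2 * (x \<bullet> x) + y \<bullet> y - z \<bullet> z) + F (x + y + z)" for s
      using Ft[OF that, of s] by (simp add: add_ac)
    then have E: "s * (3 * (mul (x + y + z) (x + y + z) \<bullet> e)) + s^2 * (3 * (mul e e \<bullet> (x + y + z))) + s^3 * 2
      = 2 * s ^ 3 - 3 * s * (2 * (x \<bullet> x) + y \<bullet> y - z \<bullet> z)" for s
      unfolding F_expand using ee by (simp add: F_def)
    \<comment> \<open>The values at \<open>s = 1\<close> and \<open>s = -1\<close> separate the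
      coefficient odd in \<open>s\<close> from the even one.\<close>
    show "mul e e \<bullet> (x + y + z) = 0"
      "mul (x + y + z) (x + y + z) \<bullet> e = - (2 * (x \<bullet> x) + y \<bullet> y - z \<bullet> z)"
      using E[of 1] E[of "-1"] by simp_all
  qed
  note l = linear_iff mul_linear inner_linear
  have e0: "mul e e \<bullet> x = 0" if "x \<in> V1 \<or> x \<in> V2 \<or> x \<in> V3" for x
    using that key(1)[of x 0 0] key(1)[of 0 x 0] key(1)[of 0 0 x] zero by auto
  have q: "x \<in> V1 \<Longrightarrow> mul x x \<bullet> e = -2 * (x \<bullet> x)" "x \<in> V2 \<Longrightarrow> mul x x \<bullet> e = - (x \<bullet> x)"
    "x \<in> V3 \<Longrightarrow> mul x x \<bullet> e = x \<bullet> x" for x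
    using key(2)[of x 0 0] key(2)[of 0 x 0] key(2)[of 0 0 x] zero by simp_all
  have sq: "mul (u + v) (u + v) \<bullet> e = mul u u \<bullet> e + mul v v \<bullet> e + 2 * (mul u v \<bullet> e)" for u v
    unfolding mul_add_left mul_add_right inner_add_left mul_commute[of v u] by simp
  have cross: "x \<in> V1 \<Longrightarrow> y \<in> V2 \<Longrightarrow> mul x y \<bullet> e = 0" "x \<in> V1 \<Longrightarrow> z \<in> V3 \<Longrightarrow> mul x z \<bullet> e = 0"
    "y \<in> V2 \<Longrightarrow> z \<in> V3 \<Longrightarrow> mul y z \<bullet> e = 0" for x y z
    using key(2)[of x y 0] key(2)[of x 0 z] key(2)[of 0 y z] zero q[of x] q[of y] q[of z]
    by (simp_all add: sq)
  have cross': "x \<in> V1 \<Longrightarrow> y \<in> V2 \<Longrightarrow> mul y x \<bullet> e = 0" "x \<in> V1 \<Longrightarrow> z \<in> V3 \<Longrightarrow> mul z x \<bullet> e = 0"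
    "y \<in> V2 \<Longrightarrow> z \<in> V3 \<Longrightarrow> mul z y \<bullet> e = 0" for x y z
    using cross mul_commute by metis+
  have P11: "mul x y \<bullet> e + 2 * (x \<bullet> y) = 0" if "x \<in> V1" "y \<in> V1" for x y
    by (rule polarize2[where V = V1 and B = "\<lambda>x y. mul x y \<bullet> e + 2 * (x \<bullet> y)"])
      (use that q sub1 in \<open>simp_all add: l mul_commute inner_commute algebra_simps\<close>)
  have P22: "mul x y \<bullet> e + x \<bullet> y = 0" if "x \<in> V2" "y \<in> V2" for x y
    by (rule polarize2[where V = V2 and B = "\<lambda>x y. mul x y \<bullet> e + x \<bullet> y"])
      (use that q sub2 in \<open>simp_all add: l mul_commute inner_commute algebra_simps\<close>)
  have P33: "mul x y \<bullet> e - x \<bullet> y = 0" if "x \<in> V3" "y \<in> V3" for x y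
    by (rule polarize2[where V = V3 and B = "\<lambda>x y. mul x y \<bullet> e - x \<bullet> y"])
      (use that q sub3 in \<open>simp_all add: l mul_commute inner_commute algebra_simps\<close>)
  have rot: "mul e x \<bullet> v = mul x v \<bullet> e" for x v by (rule trilinear_rotate)
  have rot': "mul e x \<bullet> e = mul e e \<bullet> x" for x by (rule trilinear_swap)
  have F12: "F (x + y) = F y" if "x \<in> V1" "y \<in> V2" for x y
  proof -
    \<comment> \<open>Scaling a zero argument by 0 changes nothing, so a form of positive degree in
      that argument vanishes. For \<open>\<psi>030\<close>, scaling \<open>\<xi>\<close> by 0
      contributes \<open>0 ^ 0 = 1\<close>, which removes the dependence on
      \<open>\<xi>\<close>.\<close>
    note s = trihomogeneous_scale[OF \<psi>(1) that zero(3), of 1 1 0] trihomogeneous_scale[OF \<psi>(2) that zero(3), of 1 1 0]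
      trihomogeneous_scale[OF \<psi>(3) that zero(3), of 1 1 0] trihomogeneous_scale[OF \<psi>(4) that zero(3), of 0 1 1]
      trihomogeneous_scale[OF \<psi>(1) zero(1) that(2) zero(3), of 1 1 0] trihomogeneous_scale[OF \<psi>(2) zero(1) that(2) zero(3), of 1 1 0]
      trihomogeneous_scale[OF \<psi>(3) zero(1) that(2) zero(3), of 1 1 0]
    show ?thesis using NF[OF that zero(3), of 0] NF[OF zero(1) that(2) zero(3), of 0] s by simp
  qed
  have F3: "F z = 0" if "z \<in> V3" for z
  proof -
    note s = trihomogeneous_scale[OF \<psi>(1) zero(1) zero(2) that, of 0 1 1] trihomogeneous_scale[OF \<psi>(2) zero(1) zero(2) that, of 0 1 1]
      trihomogeneous_scale[OF \<psi>(3) zero(1) zero(2) that, of 1 0 1] trihomogeneous_scale[OF \<psi>(4) zero(1) zero(2) that, of 1 0 1]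
    show ?thesis using NF[OF zero(1) zero(2) that, of 0] s by simp
  qed
  \<comment> \<open>At \<open>\<eta> = 0\<close> only \<open>\<psi>102\<close> survives, and it is
    even in \<open>\<zeta>\<close>; in \<open>D113\<close> this kills the term linear in
    \<open>z\<close>.\<close>
  have F13: "F (x + - z) = F (x + z)" if "x \<in> V1" "z \<in> V3" for x z
  proof -
    have z': "- z \<in> V3" using that by (simp add: subspace_neg sub3)
    note s = trihomogeneous_scale[OF \<psi>(1) that(1) zero(2) that(2), of 1 0 1] trihomogeneous_scale[OF \<psi>(2) that(1) zero(2) that(2), of 1 1 "-1"]
      trihomogeneous_scale[OF \<psi>(3) that(1) zero(2) that(2), of 1 0 1] trihomogeneous_scale[OF \<psi>(4) that(1) zero(2) that(2), of 1 0 1]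
      trihomogeneous_scale[OF \<psi>(1) that(1) zero(2) z', of 1 0 1]
      trihomogeneous_scale[OF \<psi>(3) that(1) zero(2) z', of 1 0 1] trihomogeneous_scale[OF \<psi>(4) that(1) zero(2) z', of 1 0 1]
    show ?thesis using NF[OF that(1) zero(2) that(2), of 0] NF[OF that(1) zero(2) z', of 0] s by simp
  qed
  have F23: "F (y + - z) = F (y + z)" if "y \<in> V2" "z \<in> V3" for y z
  proof -
    have z': "- z \<in> V3" using that by (simp add: subspace_neg sub3)
    note s = trihomogeneous_scale[OF \<psi>(1) zero(1) that, of 0 1 1] trihomogeneous_scale[OF \<psi>(2) zero(1) that, of 0 1 1]
      trihomogeneous_scale[OF \<psi>(3) zero(1) that, of 1 1 "-1"] trihomogeneous_scale[OF \<psi>(4) zero(1) that, of 1 1 "-1"]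
      trihomogeneous_scale[OF \<psi>(1) zero(1) that(1) z', of 0 1 1] trihomogeneous_scale[OF \<psi>(2) zero(1) that(1) z', of 0 1 1]
    show ?thesis using NF[OF zero(1) that, of 0] NF[OF zero(1) that(1) z', of 0] s by simp
  qed
  have F1: "F x = 0" if "x \<in> V1" for x using F12[OF that zero(2)] F0 by simp
  have D112: "mul x x \<bullet> y = 0" and D122: "mul y y \<bullet> x = 0" if "x \<in> V1" "y \<in> V2" for x y
  proof -
    have y': "- y \<in> V2" using that by (simp add: subspace_neg sub2)
    have "F (- y) = - F y" by (simp add: F_def mul_linear inner_linear)
    then have "mul x x \<bullet> y + mul y y \<bullet> x = 0" "- (mul x x \<bullet> y) + mul y y \<bullet> x = 0"
      using F12[OF that] F12[OF that(1) y'] F_expand[of x 1 y] F_expand[of x "-1" y] F1[OF that(1)] by simp_all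
    then show "mul x x \<bullet> y = 0" "mul y y \<bullet> x = 0" by simp_all
  qed
  have D113: "mul x x \<bullet> z = 0" if "x \<in> V1" "z \<in> V3" for x z
    using F13[OF that] F_expand[of x 1 z] F_expand[of x "-1" z] F3[OF that(2)] by simp
  have D223: "mul y y \<bullet> z = 0" if "y \<in> V2" "z \<in> V3" for y z
    using F23[OF that] F_expand[of y 1 z] F_expand[of y "-1" z] F3[OF that(2)] by simp
  have sw: "mul x y \<bullet> z = mul x z \<bullet> y" "mul x y \<bullet> z = mul y x \<bullet> z" for x y z
    using trilinear_swap mul_commute by metis+
  have D122': "mul x y \<bullet> y = 0" if "x \<in> V1" "y \<in> V2" for x y
    using D122[OF that] sw by metis
  obtain lam where lam: "lam \<noteq> 0" "\<And>x. L_op f x = lam * (norm x)\<^sup>2 * f x"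
    using f unfolding radial_eigencubic_def by blast
  \<comment> \<open>The quotient of the factor \<open>1 / (2 * c)\<close> from \<open>f_eq\<close>
    by the factor \<open>27 / (4 * c^3)\<close> from \<open>L_op_f\<close>.\<close>
  define nu where "nu = 2 * c^2 / 27 * lam"
  have "hsiang mul e V1 V2 V3 nu"
  proof unfold_locales
    show "mul e e = 2 *\<^sub>R e"
      by (rule od_eqI) (simp_all add: ee od_ee e0 od_orth)
    show "mul e x = -2 *\<^sub>R x" if "x \<in> V1" for x
    proof (rule od_eqI)
      show "mul e x \<bullet> v = (-2 *\<^sub>R x) \<bullet> v" if "v \<in> V1" for v
        unfolding rot using P11[OF \<open>x \<in> V1\<close> that] by simp
    qed (use that in \<open>simp_all add: rot' e0 od_orth, simp_all add: rot cross\<close>)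
    show "mul e x = - x" if "x \<in> V2" for x
    proof (rule od_eqI)
      show "mul e x \<bullet> v = (- x) \<bullet> v" if "v \<in> V2" for v
        unfolding rot using P22[OF \<open>x \<in> V2\<close> that] by simp
    qed (use that in \<open>simp_all add: rot' e0 od_orth, simp_all add: rot cross cross'\<close>)
    show "mul e x = x" if "x \<in> V3" for x
    proof (rule od_eqI)
      show "mul e x \<bullet> v = x \<bullet> v" if "v \<in> V3" for v
        unfolding rot using P33[OF \<open>x \<in> V3\<close> that] by simp
    qed (use that in \<open>simp_all add: rot' e0 od_orth, simp_all add: rot cross cross'\<close>)
    show "mul x y \<bullet> z = 0" if "x \<in> V1" "y \<in> V1" "z \<in> V1" for x y z
      by (rule polarize3[where V = V1 and S = "\<lambda>x y z. mul x y \<bullet> z"])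
        (use that F1 sub1 sw in \<open>simp_all add: l F_def\<close>)
    show "mul x y \<bullet> z = 0" if "x \<in> V1" "y \<in> V1" "z \<in> V2" for x y z
      by (rule polarize2[where V = V1 and B = "\<lambda>x y. mul x y \<bullet> z"])
        (use that D112 sub1 sw(2) in \<open>simp_all add: l\<close>)
    show "mul x y \<bullet> z = 0" if "x \<in> V1" "y \<in> V1" "z \<in> V3" for x y z
      by (rule polarize2[where V = V1 and B = "\<lambda>x y. mul x y \<bullet> z"])
        (use that D113 sub1 sw(2) in \<open>simp_all add: l\<close>)
    show "mul x y \<bullet> z = 0" if "x \<in> V1" "y \<in> V2" "z \<in> V2" for x y z
      by (rule polarize2[where V = V2 and B = "\<lambda>y z. mul x y \<bullet> z"])
        (use that D122' sub2 sw(1)[of x] in \<open>simp_all add: l\<close>)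
    show "mul x y \<bullet> z = 0" if "x \<in> V2" "y \<in> V2" "z \<in> V3" for x y z
      by (rule polarize2[where V = V2 and B = "\<lambda>x y. mul x y \<bullet> z"])
        (use that D223 sub2 sw(2) in \<open>simp_all add: l\<close>)
    show "mul x y \<bullet> z = 0" if "x \<in> V3" "y \<in> V3" "z \<in> V3" for x y z
      by (rule polarize3[where V = V3 and S = "\<lambda>x y z. mul x y \<bullet> z"])
        (use that F3 sub3 sw in \<open>simp_all add: l F_def\<close>)
    show "nu \<noteq> 0" using c lam(1) by (simp add: nu_def)
    show "(mul x x \<bullet> mul x x) * tr x - mul (mul x x) (mul x x) \<bullet> x = nu * (x \<bullet> x) * (mul x x \<bullet> x)" for x
    proof -
      have "27 / (4 * c^3) * ((mul x x \<bullet> mul x x) * tr x - mul (mul x x) (mul x x) \<bullet> x)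
        = lam * (x \<bullet> x) * (1 / (2 * c) * (mul x x \<bullet> x))"
        using lam(2)[of x] unfolding L_op_f f_eq[of x] power2_norm_eq_inner .
      then have "4 * c^3 / 27 * (27 / (4 * c^3) * ((mul x x \<bullet> mul x x) * tr x - mul (mul x x) (mul x x) \<bullet> x))
        = 4 * c^3 / 27 * (lam * (x \<bullet> x) * (1 / (2 * c) * (mul x x \<bullet> x)))" by simp
      then show ?thesis using c unfolding nu_def
        by (simp add: power2_eq_square power3_eq_cube)
    qed
  qed
  then show ?thesis using cubic_form_axioms by blast
qed

section \<open>The dimension formulas and their invariance\<close>

lemma normal_form_dims:
  fixes f :: "real ^ 'n \<Rightarrow> real"
  assumes "radial_eigencubic f" and "normal_form f e V1 V2 V3"
  shows normal_form_dim_V1: "L_op f x \<noteq> 0 \<Longrightarrow> real (dim V1) =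
      1 + (norm x)\<^sup>2 * trace (hessian f x ** hessian f x ** hessian f x) / (3 * L_op f x)"
    and normal_form_dim_V2: "real (dim V2) = (real CARD('n) - 3 * real (dim V1) + 1) / 2"
    and normal_form_dim_V3: "real (dim V3) = 2 * real (dim V1) + real (dim V2) - 2"
proof -
  obtain mul c nu where h: "hsiang mul e V1 V2 V3 nu" and cf: "cubic_form mul f c"
    using normal_form_hsiang[OF assms] by blast
  interpret hsiang mul e V1 V2 V3 nu by (rule h)
  interpret cubic_form mul f c by (rule cf)
  show "real (dim V3) = 2 * real (dim V1) + real (dim V2) - 2" by (rule dim_V3)
  show "real (dim V2) = (real CARD('n) - 3 * real (dim V1) + 1) / 2"
    using dim_total by simp
  assume L: "L_op f x \<noteq> 0"
  define G where "G = mul x x \<bullet> x"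
  \<comment> \<open>By \<open>quintic\<close> and \<open>cube_trace\<close>, \<open>L_op f x\<close>
    and \<open>(norm x)\<^sup>2\<close> times the trace are both multiples of
    \<open>(x \<bullet> x) * G\<close>; this is why their ratio is constant.\<close>
  have 1: "L_op f x = - 27 / c^3 * ((x \<bullet> x) * G)"
    unfolding L_op_f tr_zero quintic G_def by simp
  have 2: "trace (hessian f x ** hessian f x ** hessian f x) = 27 / c^3 * (-3 * (real (dim V1) - 1) * G)"
    unfolding trace_hessian_cube cube_trace G_def ..
  have "(norm x)\<^sup>2 * trace (hessian f x ** hessian f x ** hessian f x) = (real (dim V1) - 1) * (3 * L_op f x)"
    unfolding 1 2 power2_norm_eq_inner by (simp add: algebra_simps diff_divide_distrib)
  then show "real (dim V1) =
      1 + (norm x)\<^sup>2 * trace (hessian f x ** hessian f x ** hessian f x) / (3 * L_op f x)"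
    using L by simp
qed

text \<open>A point with \<open>f x \<noteq> 0\<close> works: it is not the origin because
  \<open>f\<close> is homogeneous of degree 3, and the eigenvalue is nonzero.\<close>

lemma radial_eigencubic_L_op_nonzero:
  assumes "radial_eigencubic f"
  shows "\<exists>x. L_op f x \<noteq> 0"
proof -
  obtain x l where x: "f x \<noteq> 0" and l: "l \<noteq> 0" "\<And>x. L_op f x = l * (norm x)\<^sup>2 * f x"
    and f: "\<And>t x. f (t *\<^sub>R x) = t ^ 3 * f x"
    using assms unfolding radial_eigencubic_def homogeneous_poly_def by blast
  have "x \<noteq> 0" using f[of 0 x] x by auto
  then show ?thesis using x l by (intro exI[of _ x]) simp
qed

theorem theorem2:
  fixes f :: "real ^ 'n \<Rightarrow> real"
    and e :: "real ^ 'n"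
    and V1 V2 V3 :: "(real ^ 'n) set"
  assumes "radial_eigencubic f"
    and "normal_form f e V1 V2 V3"
  shows "(\<forall>e' V1' V2' V3'. normal_form f e' V1' V2' V3' \<longrightarrow>
            dim V1' = dim V1 \<and> dim V2' = dim V2 \<and> dim V3' = dim V3) \<and>
         (\<exists>x. L_op f x \<noteq> 0) \<and>
         (\<forall>x. L_op f x \<noteq> 0 \<longrightarrow>
            real (dim V1) =
              1 + (norm x)\<^sup>2 * trace (hessian f x ** hessian f x ** hessian f x) / (3 * L_op f x)) \<and>
         real (dim V2) = (real CARD('n) - 3 * real (dim V1) + 1) / 2 \<and>
         real (dim V3) = 2 * real (dim V1) + real (dim V2) - 2"
proof -
  \<comment> \<open>One such point serves for every normal form, because the right-hand side of the
    formula for \<open>dim V1\<close> depends on \<open>f\<close> and the point alone.\<close>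
  obtain x0 where x0: "L_op f x0 \<noteq> 0"
    using radial_eigencubic_L_op_nonzero[OF assms(1)] by blast
  have "dim V1' = dim V1 \<and> dim V2' = dim V2 \<and> dim V3' = dim V3"
    if nf': "normal_form f e' V1' V2' V3'" for e' V1' V2' V3'
  proof -
    have 1: "real (dim V1') = real (dim V1)"
      using normal_form_dim_V1[OF assms(1) nf' x0] normal_form_dim_V1[OF assms x0] by simp
    have 2: "real (dim V2') = real (dim V2)"
      using normal_form_dim_V2[OF assms(1) nf'] normal_form_dim_V2[OF assms] 1 by simp
    have "real (dim V3') = real (dim V3)"
      using normal_form_dim_V3[OF assms(1) nf'] normal_form_dim_V3[OF assms] 1 2 by simp
    then show ?thesis using 1 2 by simp
  qed
  moreover have "\<forall>x. L_op f x \<noteq> 0 \<longrightarrow> real (dim V1) =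
      1 + (norm x)\<^sup>2 * trace (hessian f x ** hessian f x ** hessian f x) / (3 * L_op f x)"
    using normal_form_dim_V1[OF assms] by blast
  ultimately show ?thesis
    using x0 normal_form_dim_V2[OF assms] normal_form_dim_V3[OF assms] by blast
qed

end
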